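(* Let $M=T^2$ be a torus with a fixed complex structure, $z$ a holomorphic coordinate on its universal cover as in the context, and $n\ge3$. (1) For every conformal immersion $f:M\to S^n$ with Hopf differential $\kappa$ in the coordinate $z$, the $\bar\partial$-problem $\bar b_z=2\langle\sigma,\kappa\rangle$ with $\sigma=\mathrm{Re}\,D_z\kappa$ has a solution $b:M\to\mathbb C$ (where $\bar b_z=\partial_z(\bar b)$), unique once normalized by $\int_M b=0$. (2) Let $f(t):M\to S^n$ be a smooth one-parameter family of conformal immersions evolving by the Novikov--Veselov flow, i.e. with normal variation $\sigma=\mathrm{Re}\,D_z\kappa$ (and $\int_M b=0$) for all $t$, and suppose that the normal bundle of $f(t)$ is flat for all $t$ (which is automatic for $n=3$). Then the Willmore energy $W(f(t))$ is independent of $t$.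
   Context: Let $\mathbb R^{n+1,1}$ carry the Lorentzian form $\langle v,v\rangle=-v_0^2+\sum_{k=1}^{n+1}v_k^2$ (extended complex bilinearly), with forward light cone $\mathcal L_+$; identify $S^n$ with the projectivized light cone via $x\leftrightarrow[1:x]$. On the torus $M=T^2$ fix a nowhere vanishing holomorphic vector field $X$ and let $z$ be the holomorphic coordinate on the universal cover $\mathbb R^2$ with $\frac{\partial}{\partial z}=\frac12(X-iJX)$, $J$ here being the complex structure of $M$; $\partial_z,\partial_{\bar z}$ and $|dz|^2$ are then globally defined on $M$, and integrals over $M$ are with respect to the area measure of $|dz|^2$. For a conformal immersion $f:M\to S^n$ there is a unique normalized lift $\psi:M\to\mathcal L_+$ such that $\psi(p)$ spans the null line $f(p)$ and $|d\psi|^2=|dz|^2$. Let $V=\mathrm{span}\{\psi,d\psi,\psi_{z\bar z}\}$, a rank $4$ subbundle of $M\times\mathbb R^{n+1,1}$ of signature $(3,1)$. The bundle $V^\perp$ is isometric to the normal bundle of $f$ and carries the connection $D$ obtained by projecting the derivative to $V^\perp$. The equation $\psi_{zz}+\frac c2\psi=\kappa$ defines the Schwarzian derivative $c$ (a complex valued function) and the Hopf differential $\kappa\in\Gamma(V^\perp\otimes\mathbb C)$. The Willmore energy is $W(f)=\int_M|\kappa|^2$, $|\kappa|^2=\langle\kappa,\bar\kappa\rangle$. For a smooth family $f(t)$ of conformal immersions with normalized lifts $\psi(t)$ one has $$\psi_t=a\psi+b\psi_z+\bar b\psi_{\bar z}+\sigma$$ with $a$ real valued, $b$ complex valued and $\sigma\in\Gamma(V^\perp)$,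 the normal variation; conformality of the deformation is equivalent to $\bar b_z=2\langle\sigma,\kappa\rangle$ and $a=-\mathrm{Re}\,b_z$. Here $\mathrm{Re}\,D_z\kappa=\frac12(D_z\kappa+D_{\bar z}\bar\kappa)$. *)

theory Defs
  imports "HOL-Analysis.Analysis"
begin

text \<open>Both notions are meant for open sets only, as the derivative is taken in the whole space.\<close>

primrec Ck_on :: "nat \<Rightarrow> ('a::real_normed_vector \<Rightarrow> 'b::real_normed_vector) \<Rightarrow> 'a set \<Rightarrow> bool" where
  "Ck_on 0 f S \<longleftrightarrow> continuous_on S f"
| "Ck_on (Suc k) f S \<longleftrightarrow>
     f differentiable_on S \<and> (\<forall>v. Ck_on k (\<lambda>x. frechet_derivative f (at x) v) S)"

definition smooth_on :: "('a::real_normed_vector \<Rightarrow> 'b::real_normed_vector) \<Rightarrow> 'a set \<Rightarrow> bool" where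
  "smooth_on f S \<longleftrightarrow> (\<forall>k. Ck_on k f S)"

text \<open>A torus with a nowhere vanishing holomorphic vector field \<open>X\<close> is \<open>\<complex>/\<Lambda>\<close>, where \<open>z\<close> is the
  coordinate of \<open>\<complex>\<close> and \<open>\<Lambda>\<close> is the lattice generated by two periods \<open>\<omega>1\<close>, \<open>\<omega>2\<close> that are
  linearly independent over the reals; \<open>X\<close> is then the coordinate field of the real part of \<open>z\<close>.
  Maps on the torus are \<open>\<Lambda>\<close>-periodic maps on \<open>\<complex>\<close>.\<close>

definition lattice_basis :: "complex \<Rightarrow> complex \<Rightarrow> bool" where
  "lattice_basis \<omega>1 \<omega>2 \<longleftrightarrow> Im (cnj \<omega>1 * \<omega>2) \<noteq> 0"

definition on_torus :: "complex \<Rightarrow> complex \<Rightarrow> (complex \<Rightarrow> 'a) \<Rightarrow> bool" where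
  "on_torus \<omega>1 \<omega>2 g \<longleftrightarrow> (\<forall>z. g (z + \<omega>1) = g z \<and> g (z + \<omega>2) = g z)"

definition fundamental_domain :: "complex \<Rightarrow> complex \<Rightarrow> complex set" where
  "fundamental_domain \<omega>1 \<omega>2 =
     {of_real s * \<omega>1 + of_real t * \<omega>2 | s t. s \<in> {0..<1} \<and> t \<in> {0..<1}}"

text \<open>Lebesgue measure on \<open>\<complex>\<close> is the area measure of \<open>|dz|\<^sup>2\<close>.\<close>

definition torus_integral ::
  "complex \<Rightarrow> complex \<Rightarrow> (complex \<Rightarrow> 'a::{banach, second_countable_topology}) \<Rightarrow> 'a" where
  "torus_integral \<omega>1 \<omega>2 g = (LINT z:fundamental_domain \<omega>1 \<omega>2|lborel. g z)"

text \<open>A vector of \<open>\<real>\<^sup>n\<^sup>+\<^sup>1\<^sup>,\<^sup>1\<close> is a pair of its time component \<open>v\<^sub>0\<close> and its space part in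
  \<open>\<real>\<^sup>n\<^sup>+\<^sup>1\<close>; the type \<open>'n\<close> has \<open>n + 1\<close> elements.\<close>

type_synonym 'n lor = "real \<times> (real, 'n) vec"
type_synonym 'n clor = "complex \<times> (complex, 'n) vec"

text \<open>At type \<open>complex\<close> this is the bilinear (not sesquilinear) extension.\<close>

definition lorentz :: "'a::comm_ring \<times> ('a, 'n::finite) vec \<Rightarrow> 'a \<times> ('a, 'n) vec \<Rightarrow> 'a" where
  "lorentz v w = - fst v * fst w + (\<Sum>k\<in>UNIV. snd v $ k * snd w $ k)"

definition forward_light_cone :: "'n::finite lor set" where
  "forward_light_cone = {v. lorentz v v = 0 \<and> fst v > 0}"

definition to_clor :: "'n::finite lor \<Rightarrow> 'n clor" where
  "to_clor v = (of_real (fst v), \<chi> k. of_real (snd v $ k))"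

definition Re_clor :: "'n::finite clor \<Rightarrow> 'n lor" where
  "Re_clor w = (Re (fst w), \<chi> k. Re (snd w $ k))"

definition Im_clor :: "'n::finite clor \<Rightarrow> 'n lor" where
  "Im_clor w = (Im (fst w), \<chi> k. Im (snd w $ k))"

definition cnj_clor :: "'n::finite clor \<Rightarrow> 'n clor" where
  "cnj_clor w = (cnj (fst w), \<chi> k. cnj (snd w $ k))"

definition scale_clor :: "complex \<Rightarrow> 'n::finite clor \<Rightarrow> 'n clor" (infixr "*\<^sub>L" 75) where
  "a *\<^sub>L w = (a * fst w, a *s snd w)"

definition complexify :: "'n::finite lor set \<Rightarrow> 'n clor set" where
  "complexify U = {w. Re_clor w \<in> U \<and> Im_clor w \<in> U}"

definition lorentz_perp :: "'n::finite lor set \<Rightarrow> 'n lor set" where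
  "lorentz_perp U = {w. \<forall>v\<in>U. lorentz w v = 0}"

text \<open>The projection onto \<open>U\<^sup>\<bottom> \<otimes> \<complex>\<close> along \<open>U \<otimes> \<complex>\<close>, for a nondegenerate subspace \<open>U\<close>.\<close>

definition perp_proj :: "'n::finite lor set \<Rightarrow> 'n clor \<Rightarrow> 'n clor" where
  "perp_proj U w = (THE u. u \<in> complexify (lorentz_perp U) \<and> w - u \<in> complexify U)"

definition dz :: "(complex \<Rightarrow> complex) \<Rightarrow> complex \<Rightarrow> complex" where
  "dz g p = (frechet_derivative g (at p) 1 - \<i> * frechet_derivative g (at p) \<i>) / 2"

definition dzbar :: "(complex \<Rightarrow> complex) \<Rightarrow> complex \<Rightarrow> complex" where
  "dzbar g p = (frechet_derivative g (at p) 1 + \<i> * frechet_derivative g (at p) \<i>) / 2"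

definition vdz :: "(complex \<Rightarrow> 'n::finite clor) \<Rightarrow> complex \<Rightarrow> 'n clor" where
  "vdz g p = (dz (\<lambda>q. fst (g q)) p, \<chi> k. dz (\<lambda>q. snd (g q) $ k) p)"

definition vdzbar :: "(complex \<Rightarrow> 'n::finite clor) \<Rightarrow> complex \<Rightarrow> 'n clor" where
  "vdzbar g p = (dzbar (\<lambda>q. fst (g q)) p, \<chi> k. dzbar (\<lambda>q. snd (g q) $ k) p)"

text \<open>The round sphere \<open>S\<^sup>n\<close> is the unit sphere of \<open>\<real>\<^sup>n\<^sup>+\<^sup>1\<close>. The last condition says that the
  induced metric is a positive multiple of \<open>|dz|\<^sup>2\<close> at every point.\<close>

definition conformal_immersion ::
  "complex \<Rightarrow> complex \<Rightarrow> (complex \<Rightarrow> (real, 'n::finite) vec) \<Rightarrow> bool" where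
  "conformal_immersion \<omega>1 \<omega>2 f \<longleftrightarrow>
     on_torus \<omega>1 \<omega>2 f \<and> smooth_on f UNIV \<and> (\<forall>p. f p \<in> sphere 0 1) \<and>
     (\<forall>p. \<exists>r>0. \<forall>v w. frechet_derivative f (at p) v \<bullet> frechet_derivative f (at p) w = r * (v \<bullet> w))"

definition is_normalized_lift ::
  "(complex \<Rightarrow> (real, 'n::finite) vec) \<Rightarrow> (complex \<Rightarrow> 'n lor) \<Rightarrow> bool" where
  "is_normalized_lift f \<psi> \<longleftrightarrow>
     smooth_on \<psi> UNIV \<and>
     (\<forall>p. \<psi> p \<in> forward_light_cone \<and> span {\<psi> p} = span {(1, f p)}) \<and>
     (\<forall>p v. lorentz (frechet_derivative \<psi> (at p) v) (frechet_derivative \<psi> (at p) v) = (norm v)\<^sup>2)"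

definition normalized_lift :: "(complex \<Rightarrow> (real, 'n::finite) vec) \<Rightarrow> complex \<Rightarrow> 'n lor" where
  "normalized_lift f = (THE \<psi>. is_normalized_lift f \<psi>)"

definition clift :: "(complex \<Rightarrow> (real, 'n::finite) vec) \<Rightarrow> complex \<Rightarrow> 'n clor" where
  "clift f p = to_clor (normalized_lift f p)"

text \<open>The mixed second derivative of the lift is a quarter of its Laplacian, hence real, and
  \<open>Re_clor\<close> only changes its type.\<close>

definition V_bundle :: "(complex \<Rightarrow> (real, 'n::finite) vec) \<Rightarrow> complex \<Rightarrow> 'n lor set" where
  "V_bundle f p =
     span ({normalized_lift f p} \<union> range (frechet_derivative (normalized_lift f) (at p))
           \<union> {Re_clor (vdz (vdzbar (clift f)) p)})"

abbreviation V_perp :: "(complex \<Rightarrow> (real, 'n::finite) vec) \<Rightarrow> complex \<Rightarrow> 'n lor set" where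
  "V_perp f p \<equiv> lorentz_perp (V_bundle f p)"

definition schwarzian :: "(complex \<Rightarrow> (real, 'n::finite) vec) \<Rightarrow> complex \<Rightarrow> complex" where
  "schwarzian f p =
     (THE c. vdz (vdz (clift f)) p + (c / 2) *\<^sub>L clift f p \<in> complexify (V_perp f p))"

definition hopf :: "(complex \<Rightarrow> (real, 'n::finite) vec) \<Rightarrow> complex \<Rightarrow> 'n clor" where
  "hopf f p = vdz (vdz (clift f)) p + (schwarzian f p / 2) *\<^sub>L clift f p"

definition D_z ::
  "(complex \<Rightarrow> (real, 'n::finite) vec) \<Rightarrow> (complex \<Rightarrow> 'n clor) \<Rightarrow> complex \<Rightarrow> 'n clor" where
  "D_z f \<xi> p = perp_proj (V_bundle f p) (vdz \<xi> p)"

definition D_zbar ::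
  "(complex \<Rightarrow> (real, 'n::finite) vec) \<Rightarrow> (complex \<Rightarrow> 'n clor) \<Rightarrow> complex \<Rightarrow> 'n clor" where
  "D_zbar f \<xi> p = perp_proj (V_bundle f p) (vdzbar \<xi> p)"

definition normal_section ::
  "complex \<Rightarrow> complex \<Rightarrow> (complex \<Rightarrow> (real, 'n::finite) vec) \<Rightarrow> (complex \<Rightarrow> 'n clor) \<Rightarrow> bool" where
  "normal_section \<omega>1 \<omega>2 f \<xi> \<longleftrightarrow>
     on_torus \<omega>1 \<omega>2 \<xi> \<and> smooth_on \<xi> UNIV \<and> (\<forall>p. \<xi> p \<in> complexify (V_perp f p))"

text \<open>The normal bundle is \<open>V\<^sup>\<bottom>\<close> with its connection \<open>D\<close>. As \<open>\<partial>\<^sub>z\<close> and its conjugate commute,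
  the following says that the curvature of \<open>D\<close> vanishes.\<close>

definition flat_normal_bundle ::
  "complex \<Rightarrow> complex \<Rightarrow> (complex \<Rightarrow> (real, 'n::finite) vec) \<Rightarrow> bool" where
  "flat_normal_bundle \<omega>1 \<omega>2 f \<longleftrightarrow>
     (\<forall>\<xi>. normal_section \<omega>1 \<omega>2 f \<xi> \<longrightarrow> (\<forall>p. D_z f (D_zbar f \<xi>) p = D_zbar f (D_z f \<xi>) p))"

text \<open>The Hermitian square is real, so taking \<open>Re\<close> only changes its type.\<close>

definition willmore :: "complex \<Rightarrow> complex \<Rightarrow> (complex \<Rightarrow> (real, 'n::finite) vec) \<Rightarrow> real" where
  "willmore \<omega>1 \<omega>2 f = torus_integral \<omega>1 \<omega>2 (\<lambda>p. Re (lorentz (hopf f p) (cnj_clor (hopf f p))))"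

text \<open>\<open>Re D\<^sub>z\<kappa>\<close>, as a section of the real bundle \<open>V\<^sup>\<bottom>\<close>; the argument of \<open>Re_clor\<close> is real.\<close>

definition NV_variation :: "(complex \<Rightarrow> (real, 'n::finite) vec) \<Rightarrow> complex \<Rightarrow> 'n lor" where
  "NV_variation f p =
     Re_clor ((1/2) *\<^sub>L (D_z f (hopf f) p + D_zbar f (\<lambda>q. cnj_clor (hopf f q)) p))"

definition solves_dbar ::
  "complex \<Rightarrow> complex \<Rightarrow> (complex \<Rightarrow> (real, 'n::finite) vec) \<Rightarrow> (complex \<Rightarrow> 'n lor)
     \<Rightarrow> (complex \<Rightarrow> complex) \<Rightarrow> bool" where
  "solves_dbar \<omega>1 \<omega>2 f \<sigma> b \<longleftrightarrow>
     on_torus \<omega>1 \<omega>2 b \<and> smooth_on b UNIV \<and>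
     (\<forall>p. dz (\<lambda>q. cnj (b q)) p = 2 * lorentz (to_clor (\<sigma> p)) (hopf f p))"

definition smooth_family ::
  "complex \<Rightarrow> complex \<Rightarrow> real set \<Rightarrow> (real \<Rightarrow> complex \<Rightarrow> (real, 'n::finite) vec) \<Rightarrow> bool" where
  "smooth_family \<omega>1 \<omega>2 I f \<longleftrightarrow>
     smooth_on (\<lambda>(t, p). f t p) (I \<times> UNIV) \<and> (\<forall>t\<in>I. conformal_immersion \<omega>1 \<omega>2 (f t))"

definition variation_decomposition ::
  "(real \<Rightarrow> complex \<Rightarrow> (real, 'n::finite) vec) \<Rightarrow> real
     \<Rightarrow> (complex \<Rightarrow> real) \<Rightarrow> (complex \<Rightarrow> complex) \<Rightarrow> (complex \<Rightarrow> 'n lor) \<Rightarrow> bool" where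
  "variation_decomposition f t a b \<sigma> \<longleftrightarrow>
     (\<forall>p. \<sigma> p \<in> V_perp (f t) p \<and>
       to_clor (vector_derivative (\<lambda>s. normalized_lift (f s) p) (at t)) =
         of_real (a p) *\<^sub>L clift (f t) p + b p *\<^sub>L vdz (clift (f t)) p
         + cnj (b p) *\<^sub>L vdzbar (clift (f t)) p + to_clor (\<sigma> p))"

definition NV_flow ::
  "complex \<Rightarrow> complex \<Rightarrow> real set \<Rightarrow> (real \<Rightarrow> complex \<Rightarrow> (real, 'n::finite) vec) \<Rightarrow> bool" where
  "NV_flow \<omega>1 \<omega>2 I f \<longleftrightarrow>
     smooth_family \<omega>1 \<omega>2 I f \<and>
     (\<forall>t\<in>I. \<exists>a b. variation_decomposition f t a b (NV_variation (f t)) \<and>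
                   torus_integral \<omega>1 \<omega>2 b = 0)"

end

theory Submission
  imports Defs
begin

text \<open>Write \<open>N = \<psi>\<^sub>z\<^sub>z'\<close> for the mixed second derivative of the normalized lift, a prime denoting the
  conjugate coordinate. The frame \<open>\<psi>, \<psi>\<^sub>z, \<psi>\<^sub>z\<^sub>', N\<close> of \<open>V\<close> has constant scalar products except for
  \<open>\<langle>N, N\<rangle> = |\<kappa>|\<^sup>2\<close>. Differentiating these relations gives the structure equations of a conformal
  surface: the Gauss equation \<open>gauss\<close>, the Ricci equation \<open>ricci\<close> and, in the form that the operator
  \<open>E = D' D' \<kappa> + c' \<kappa> / 2\<close> is real (\<open>cnj_E\<close>), the Codazzi equation.

  For \<open>\<sigma> = Re D \<kappa>\<close> the Gauss equation turns \<open>2 \<langle>\<sigma>, \<kappa>\<rangle>\<close> into a total derivative (\<open>sigma_kappa\<close>). Its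
  mean over the torus is therefore zero, and this is the only obstruction to solving the equation
  for \<open>b\<close>: the Fourier series of the right-hand side can be divided term by term by the symbol of
  \<open>\<partial>\<^sub>z\<close> (\<open>dz_equation_solvable\<close>). The same series shows that the solution is unique up to a constant.

  Along a flow, the energy is the integral of \<open>\<langle>N, N\<rangle>\<close>, so that its derivative is twice the integral
  of \<open>\<langle>\<Phi>\<^sub>z\<^sub>z\<^sub>', N\<rangle>\<close> with \<open>\<Phi> = \<psi>\<^sub>t\<close>. Integration by parts moves the derivatives to \<open>N\<close>, and the conformality
  of \<open>\<Phi>\<close> absorbs the tangential part of \<open>\<Phi>\<close>; what remains is the integral of \<open>\<langle>\<sigma>, E\<rangle>\<close>
  (\<open>first_variation\<close>). If the normal bundle is flat, the Ricci equation for the section \<open>\<kappa>\<close> reads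
  \<open>\<langle>\<kappa>, \<kappa>\<rangle> \<kappa>' = |\<kappa>|\<^sup>2 \<kappa>\<close>. Together with the Gauss equation and the commutation of \<open>D\<close> and \<open>D'\<close> this makes
  \<open>\<langle>D \<kappa>, E\<rangle>\<close> a total derivative (\<open>D_kappa_E\<close>), so the energy is conserved. When the normal bundle has
  rank one, the two Ricci terms cancel, which is why surfaces in \<open>S\<^sup>3\<close> always have a flat normal
  bundle.\<close>

section \<open>Calculus of smooth maps\<close>

lemma Ck_on_SucD:
  assumes "open S" "Ck_on (Suc k) f S" "x \<in> S"
  shows "(f has_derivative frechet_derivative f (at x)) (at x)"
proof -
  have "f differentiable (at x within S)"
    using assms by (auto simp: differentiable_on_def)
  then show ?thesis
    using at_within_open[OF assms(3,1)] by (simp add: frechet_derivative_works)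
qed

lemma Ck_on_cong:
  assumes "open S" "\<And>x. x \<in> S \<Longrightarrow> f x = g x" "Ck_on k f S"
  shows "Ck_on k g S"
  using assms(2,3)
proof (induction k arbitrary: f g)
  case 0
  then show ?case by (simp cong: continuous_on_cong)
next
  case (Suc k)
  have d: "(f has_derivative frechet_derivative f (at x)) (at x)" if "x \<in> S" for x
    using Ck_on_SucD[OF assms(1) Suc.prems(2) that] .
  have d': "(g has_derivative frechet_derivative f (at x)) (at x)" if "x \<in> S" for x
    using has_derivative_transform_within_open[OF d[OF that] assms(1) that] Suc.prems(1) by blast
  have e: "frechet_derivative g (at x) = frechet_derivative f (at x)" if "x \<in> S" for x
    using frechet_derivative_at[OF d'[OF that]] by simp
  have "g differentiable_on S"
    using d' by (auto simp: differentiable_on_def differentiable_def intro: has_derivative_at_withinI)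
  moreover have "Ck_on k (\<lambda>x. frechet_derivative g (at x) v) S" for v
  proof (rule Suc.IH)
    show "Ck_on k (\<lambda>x. frechet_derivative f (at x) v) S" using Suc.prems(2) by simp
  qed (simp add: e)
  ultimately show ?case by simp
qed

lemma Ck_on_SucI:
  assumes "open S" "\<And>x. x \<in> S \<Longrightarrow> (f has_derivative D x) (at x)"
    and "\<And>v. Ck_on k (\<lambda>x. D x v) S"
  shows "Ck_on (Suc k) f S"
proof -
  have "f differentiable_on S"
    using assms(2) by (auto simp: differentiable_on_def differentiable_def intro: has_derivative_at_withinI)
  moreover have "Ck_on k (\<lambda>x. frechet_derivative f (at x) v) S" for v
    by (rule Ck_on_cong[OF assms(1) _ assms(3)[of v]])
       (use frechet_derivative_at[OF assms(2)] in simp)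
  ultimately show ?thesis by simp
qed

lemma Ck_on_mono: "Ck_on (Suc k) f S \<Longrightarrow> Ck_on k f S"
proof (induction k arbitrary: f)
  case 0
  then show ?case by (auto intro: differentiable_imp_continuous_on)
next
  case (Suc k)
  show ?case using Suc.prems Suc.IH by auto
qed

lemma Ck_on_const: "Ck_on k (\<lambda>x. c) S"
  by (induction k arbitrary: c) auto

lemma Ck_on_bounded_linear:
  assumes "open S" "bounded_linear L"
  shows "Ck_on k f S \<Longrightarrow> Ck_on k (\<lambda>x. L (f x)) S"
proof (induction k arbitrary: f)
  case 0
  then show ?case using bounded_linear.continuous_on[OF assms(2)] by simp
next
  case (Suc k)
  show ?case
  proof (rule Ck_on_SucI[OF assms(1)])
    show "((\<lambda>x. L (f x)) has_derivative (\<lambda>v. L (frechet_derivative f (at x) v))) (at x)"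
      if "x \<in> S" for x
      using bounded_linear.has_derivative[OF assms(2) Ck_on_SucD[OF assms(1) Suc.prems that]] .
    show "Ck_on k (\<lambda>x. L (frechet_derivative f (at x) v)) S" for v
      using Suc.prems by (intro Suc.IH) auto
  qed
qed

lemma Ck_on_add:
  assumes "open S"
  shows "Ck_on k f S \<Longrightarrow> Ck_on k g S \<Longrightarrow> Ck_on k (\<lambda>x. f x + g x) S"
proof (induction k arbitrary: f g)
  case 0
  then show ?case by (simp add: continuous_on_add)
next
  case (Suc k)
  show ?case
  proof (rule Ck_on_SucI[OF assms(1)])
    show "((\<lambda>x. f x + g x) has_derivative
        (\<lambda>v. frechet_derivative f (at x) v + frechet_derivative g (at x) v)) (at x)"
      if "x \<in> S" for x
      using has_derivative_add Ck_on_SucD[OF assms(1) Suc.prems(1) that]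
        Ck_on_SucD[OF assms(1) Suc.prems(2) that] by blast
    show "Ck_on k (\<lambda>x. frechet_derivative f (at x) v + frechet_derivative g (at x) v) S" for v
      using Suc.prems by (intro Suc.IH) auto
  qed
qed

lemma Ck_on_bilinear:
  assumes "open S" "bounded_bilinear B"
  shows "Ck_on k f S \<Longrightarrow> Ck_on k g S \<Longrightarrow> Ck_on k (\<lambda>x. B (f x) (g x)) S"
proof (induction k arbitrary: f g)
  case 0
  then show ?case by (simp add: bounded_bilinear.continuous_on[OF assms(2)])
next
  case (Suc k)
  show ?case
  proof (rule Ck_on_SucI[OF assms(1)])
    show "((\<lambda>x. B (f x) (g x)) has_derivative
        (\<lambda>v. B (f x) (frechet_derivative g (at x) v) + B (frechet_derivative f (at x) v) (g x))) (at x)"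
      if "x \<in> S" for x
      using bounded_bilinear.FDERIV[OF assms(2) Ck_on_SucD[OF assms(1) Suc.prems(1) that]
        Ck_on_SucD[OF assms(1) Suc.prems(2) that]] .
    show "Ck_on k (\<lambda>x. B (f x) (frechet_derivative g (at x) v)
        + B (frechet_derivative f (at x) v) (g x)) S" for v
      using Suc.prems Ck_on_mono[OF Suc.prems(1)] Ck_on_mono[OF Suc.prems(2)]
      by (intro Ck_on_add[OF assms(1)] Suc.IH) simp_all
  qed
qed

lemma Ck_on_compose_affine:
  assumes "open S" "open T" "bounded_linear A" "\<And>x. x \<in> S \<Longrightarrow> A x + c \<in> T"
  shows "Ck_on k f T \<Longrightarrow> Ck_on k (\<lambda>x. f (A x + c)) S"
proof (induction k arbitrary: f)
  case 0
  have "continuous_on S (\<lambda>x. A x + c)"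
    by (intro continuous_intros bounded_linear.continuous_on[OF assms(3)])
  then show ?case using 0 assms(4) by (auto intro!: continuous_on_compose2[of T f])
next
  case (Suc k)
  show ?case
  proof (rule Ck_on_SucI[OF assms(1)])
    show "((\<lambda>x. f (A x + c)) has_derivative (\<lambda>v. frechet_derivative f (at (A x + c)) (A v))) (at x)"
      if "x \<in> S" for x
    proof -
      have "((\<lambda>x. A x + c) has_derivative A) (at x)"
        by (auto intro!: derivative_eq_intros bounded_linear_imp_has_derivative[OF assms(3)])
      from diff_chain_at[OF this Ck_on_SucD[OF assms(2) Suc.prems assms(4)[OF that]]]
      show ?thesis by (simp add: o_def)
    qed
    show "Ck_on k (\<lambda>x. frechet_derivative f (at (A x + c)) (A v)) S" for v
      using Suc.prems Suc.IH[of "\<lambda>y. frechet_derivative f (at y) (A v)"] by auto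
  qed
qed

text \<open>The derivative of \<open>r\<^sup>-\<^sup>1\<^sup>/\<^sup>2\<close> is \<open>- r' (r\<^sup>-\<^sup>1\<^sup>/\<^sup>2)\<^sup>3 / 2\<close>, a polynomial in \<open>r'\<close> and the function itself,
  so that an induction on the order of differentiability closes without the chain rule for
  higher derivatives.\<close>

lemma Ck_on_inverse_sqrt:
  fixes r :: "'a::real_normed_vector \<Rightarrow> real"
  assumes "open S" "\<And>x. x \<in> S \<Longrightarrow> r x > 0"
  shows "Ck_on k r S \<Longrightarrow> Ck_on k (\<lambda>x. inverse (sqrt (r x))) S"
proof (induction k)
  case 0
  then show ?case using assms(2) by (force intro!: continuous_intros)
next
  case (Suc k)
  let ?s = "\<lambda>x. inverse (sqrt (r x))"
  show ?case
  proof (rule Ck_on_SucI[OF assms(1)])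
    show "(?s has_derivative (\<lambda>v. (-1/2) * (frechet_derivative r (at x) v * (?s x * (?s x * ?s x))))) (at x)"
      if "x \<in> S" for x
    proof -
      have pos: "r x > 0" using assms(2) that by blast
      have d: "(r has_derivative frechet_derivative r (at x)) (at x)"
        by (rule Ck_on_SucD[OF assms(1) Suc.prems that])
      show ?thesis
        using pos by (auto intro!: derivative_eq_intros d simp: field_simps)
    qed
    have s: "Ck_on k ?s S" by (rule Suc.IH[OF Ck_on_mono[OF Suc.prems]])
    show "Ck_on k (\<lambda>x. (-1/2) * (frechet_derivative r (at x) v * (?s x * (?s x * ?s x)))) S" for v
      using Suc.prems s
      by (intro Ck_on_bilinear[OF assms(1) bounded_bilinear_mult] Ck_on_const) auto
  qed
qed

lemma smooth_on_continuous_on: "smooth_on f S \<Longrightarrow> continuous_on S f"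
  unfolding smooth_on_def using Ck_on.simps(1) by blast

lemma smooth_on_has_derivative:
  assumes "smooth_on f S" "open S" "x \<in> S"
  shows "(f has_derivative frechet_derivative f (at x)) (at x)"
  using assms Ck_on_SucD unfolding smooth_on_def by blast

lemma smooth_on_frechet_derivative:
  assumes "smooth_on f S"
  shows "smooth_on (\<lambda>x. frechet_derivative f (at x) v) S"
  using assms Ck_on.simps(2) unfolding smooth_on_def by blast

lemma smooth_on_const: "smooth_on (\<lambda>x. c) S"
  by (simp add: smooth_on_def Ck_on_const)

lemma smooth_on_bounded_linear:
  "bounded_linear L \<Longrightarrow> open S \<Longrightarrow> smooth_on f S \<Longrightarrow> smooth_on (\<lambda>x. L (f x)) S"
  by (simp add: smooth_on_def Ck_on_bounded_linear)

lemma smooth_on_bilinear: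
  "bounded_bilinear B \<Longrightarrow> open S \<Longrightarrow> smooth_on f S \<Longrightarrow> smooth_on g S
    \<Longrightarrow> smooth_on (\<lambda>x. B (f x) (g x)) S"
  by (simp add: smooth_on_def Ck_on_bilinear)

lemma smooth_on_add:
  "open S \<Longrightarrow> smooth_on f S \<Longrightarrow> smooth_on g S \<Longrightarrow> smooth_on (\<lambda>x. f x + g x) S"
  by (simp add: smooth_on_def Ck_on_add)

lemma smooth_on_compose_affine:
  "bounded_linear A \<Longrightarrow> open S \<Longrightarrow> open T \<Longrightarrow> (\<And>x. x \<in> S \<Longrightarrow> A x + c \<in> T)
    \<Longrightarrow> smooth_on f T \<Longrightarrow> smooth_on (\<lambda>x. f (A x + c)) S"
  by (simp add: smooth_on_def Ck_on_compose_affine)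

lemma smooth_on_inverse_sqrt:
  fixes r :: "'a::real_normed_vector \<Rightarrow> real"
  shows "open S \<Longrightarrow> (\<And>x. x \<in> S \<Longrightarrow> r x > 0) \<Longrightarrow> smooth_on r S
    \<Longrightarrow> smooth_on (\<lambda>x. inverse (sqrt (r x))) S"
  by (simp add: smooth_on_def Ck_on_inverse_sqrt)

text \<open>If the second derivative in directions \<open>v\<close>, \<open>w\<close> varies by at most \<open>e\<close> near \<open>x\<close>, two
  applications of the mean value inequality compare it with the second difference quotient, which
  is symmetric in \<open>v\<close> and \<open>w\<close>.\<close>

lemma second_difference_bound:
  fixes u :: "'a::real_normed_vector \<Rightarrow> 'b::real_normed_vector"
  assumes sm: "smooth_on u S" and S: "open S" and x: "x \<in> S" and e: "e > 0"
  shows "\<exists>d>0. \<forall>h. 0 < h \<and> h < d \<longrightarrow>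
    norm (u (x + h *\<^sub>R v + h *\<^sub>R w) - u (x + h *\<^sub>R v) - u (x + h *\<^sub>R w) + u x
      - (h * h) *\<^sub>R frechet_derivative (\<lambda>y. frechet_derivative u (at y) v) (at x) w) \<le> e * (h * h)"
proof -
  let ?uv = "\<lambda>y. frechet_derivative u (at y) v"
  let ?A = "\<lambda>y. frechet_derivative ?uv (at y) w"
  have "continuous_on S ?A"
    by (intro smooth_on_continuous_on smooth_on_frechet_derivative sm)
  then have "\<exists>d>0. \<forall>y. dist y x < d \<longrightarrow> y \<in> S \<and> dist (?A y) (?A x) < e"
  proof -
    assume c: "continuous_on S ?A"
    obtain d1 where d1: "d1 > 0" "ball x d1 \<subseteq> S" using S x open_contains_ball by blast
    obtain d2 where d2: "d2 > 0" "\<forall>y\<in>S. dist y x < d2 \<longrightarrow> dist (?A y) (?A x) < e"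
      using c x e unfolding continuous_on_iff by blast
    have "y \<in> S \<and> dist (?A y) (?A x) < e" if "dist y x < min d1 d2" for y
      using that d1 d2 by (auto simp: subset_iff dist_commute)
    then show ?thesis using d1(1) d2(1) by (intro exI[of _ "min d1 d2"]) auto
  qed
  then obtain d where d: "d > 0" "\<And>y. dist y x < d \<Longrightarrow> y \<in> S \<and> dist (?A y) (?A x) < e"
    by blast
  define \<delta> where "\<delta> = d / (norm v + norm w + 1)"
  have n: "norm v + norm w + 1 > 0" by (simp add: add_nonneg_pos)
  have \<delta>: "\<delta> > 0" using d(1) n by (simp add: \<delta>_def)
  have near: "dist (x + s *\<^sub>R v + t *\<^sub>R w) x < d" if "0 \<le> s" "s \<le> h" "0 \<le> t" "t \<le> h" "h < \<delta>" for s t h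
  proof -
    have "norm (s *\<^sub>R v + t *\<^sub>R w) \<le> s * norm v + t * norm w"
      using that by (metis (no_types) norm_scaleR norm_triangle_ineq abs_of_nonneg)
    also have "\<dots> \<le> h * norm v + h * norm w"
      using that by (intro add_mono mult_right_mono) auto
    also have "\<dots> \<le> h * (norm v + norm w + 1)" using that by (simp add: algebra_simps)
    also have "\<dots> < \<delta> * (norm v + norm w + 1)" using that n by (intro mult_strict_right_mono) auto
    also have "\<dots> = d" using n by (simp add: \<delta>_def)
    finally show ?thesis by (simp add: dist_norm add.assoc)
  qed
  have "norm (u (x + h *\<^sub>R v + h *\<^sub>R w) - u (x + h *\<^sub>R v) - u (x + h *\<^sub>R w) + u x
      - (h * h) *\<^sub>R ?A x) \<le> e * (h * h)" if h: "0 < h" "h < \<delta>" for h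
  proof -
    have inner: "norm (?uv (x + s *\<^sub>R v + h *\<^sub>R w) - ?uv (x + s *\<^sub>R v) - h *\<^sub>R ?A x) \<le> e * h"
      if s: "0 \<le> s" "s \<le> h" for s
    proof -
      let ?g = "\<lambda>t. ?uv (x + s *\<^sub>R v + t *\<^sub>R w) - t *\<^sub>R ?A x"
      have "norm (?g h - ?g 0) \<le> e * norm (h - 0)"
      proof (rule differentiable_bound)
        show "(?g has_derivative (\<lambda>k. k *\<^sub>R ?A (x + s *\<^sub>R v + t *\<^sub>R w) - k *\<^sub>R ?A x))
            (at t within {0..h})" if "t \<in> {0..h}" for t
        proof -
          have inS: "x + s *\<^sub>R v + t *\<^sub>R w \<in> S" using d(2) near s that h by auto
          have D: "(?uv has_derivative frechet_derivative ?uv (at (x + s *\<^sub>R v + t *\<^sub>R w)))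
              (at (x + s *\<^sub>R v + t *\<^sub>R w))"
            by (rule smooth_on_has_derivative[OF smooth_on_frechet_derivative[OF sm] S inS])
          have "((\<lambda>t. x + s *\<^sub>R v + t *\<^sub>R w) has_derivative (\<lambda>k. k *\<^sub>R w)) (at t)"
            by (auto intro!: derivative_eq_intros)
          from diff_chain_at[OF this D]
          have "((\<lambda>t. ?uv (x + s *\<^sub>R v + t *\<^sub>R w)) has_derivative
              (\<lambda>k. frechet_derivative ?uv (at (x + s *\<^sub>R v + t *\<^sub>R w)) (k *\<^sub>R w))) (at t)"
            by (simp add: o_def)
          then have "((\<lambda>t. ?uv (x + s *\<^sub>R v + t *\<^sub>R w)) has_derivative
              (\<lambda>k. k *\<^sub>R ?A (x + s *\<^sub>R v + t *\<^sub>R w))) (at t)"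
            using linear_cmul[OF has_derivative_linear[OF D]] by simp
          then have "(?g has_derivative (\<lambda>k. k *\<^sub>R ?A (x + s *\<^sub>R v + t *\<^sub>R w) - k *\<^sub>R ?A x)) (at t)"
            by (auto intro!: derivative_eq_intros)
          then show ?thesis by (rule has_derivative_at_withinI)
        qed
        show "onorm (\<lambda>k. k *\<^sub>R ?A (x + s *\<^sub>R v + t *\<^sub>R w) - k *\<^sub>R ?A x) \<le> e" if "t \<in> {0..h}" for t
        proof (rule onorm_le)
          fix k :: real
          have "norm (?A (x + s *\<^sub>R v + t *\<^sub>R w) - ?A x) \<le> e"
            using d(2)[OF near[OF s, of t]] that h by (auto simp: dist_norm)
          then show "norm (k *\<^sub>R ?A (x + s *\<^sub>R v + t *\<^sub>R w) - k *\<^sub>R ?A x) \<le> e * norm k"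
            by (metis abs_ge_zero mult.commute mult_left_mono norm_scaleR real_norm_def scaleR_right_diff_distrib)
        qed
      qed (use h in auto)
      then show ?thesis using h by (simp add: algebra_simps)
    qed
    let ?G = "\<lambda>s. u (x + s *\<^sub>R v + h *\<^sub>R w) - u (x + s *\<^sub>R v) - (s * h) *\<^sub>R ?A x"
    have "norm (?G h - ?G 0) \<le> (e * h) * norm (h - 0)"
    proof (rule differentiable_bound)
      show "(?G has_derivative (\<lambda>k. k *\<^sub>R (?uv (x + s *\<^sub>R v + h *\<^sub>R w) - ?uv (x + s *\<^sub>R v) - h *\<^sub>R ?A x)))
          (at s within {0..h})" if "s \<in> {0..h}" for s
      proof -
        have chain: "((\<lambda>s. u (x + s *\<^sub>R v + c *\<^sub>R w)) has_derivative
            (\<lambda>k. k *\<^sub>R ?uv (x + s *\<^sub>R v + c *\<^sub>R w))) (at s)" if "0 \<le> c" "c \<le> h" for c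
        proof -
          have inS: "x + s *\<^sub>R v + c *\<^sub>R w \<in> S" using d(2) near \<open>s \<in> {0..h}\<close> that h by auto
          note D = smooth_on_has_derivative[OF sm S inS]
          have "((\<lambda>s. x + s *\<^sub>R v + c *\<^sub>R w) has_derivative (\<lambda>k. k *\<^sub>R v)) (at s)"
            by (auto intro!: derivative_eq_intros)
          from diff_chain_at[OF this D] show ?thesis
            using linear_cmul[OF has_derivative_linear[OF D]] by (simp add: o_def)
        qed
        have "(?G has_derivative (\<lambda>k. k *\<^sub>R ?uv (x + s *\<^sub>R v + h *\<^sub>R w) - k *\<^sub>R ?uv (x + s *\<^sub>R v)
            - (k * h) *\<^sub>R ?A x)) (at s)"
          using chain[of h] chain[of 0] h by (auto intro!: derivative_eq_intros)
        then show ?thesis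
          by (auto simp: scaleR_right_diff_distrib intro: has_derivative_at_withinI)
      qed
      show "onorm (\<lambda>k. k *\<^sub>R (?uv (x + s *\<^sub>R v + h *\<^sub>R w) - ?uv (x + s *\<^sub>R v) - h *\<^sub>R ?A x)) \<le> e * h"
        if "s \<in> {0..h}" for s
        using inner[of s] that by (intro onorm_le) (simp add: mult.commute mult_left_mono)
    qed (use h in auto)
    then show ?thesis using h by (simp add: algebra_simps)
  qed
  then show ?thesis using \<delta> by blast
qed

lemma smooth_on_commute_derivatives:
  fixes u :: "'a::real_normed_vector \<Rightarrow> 'b::real_normed_vector"
  assumes "smooth_on u S" "open S" "x \<in> S"
  shows "frechet_derivative (\<lambda>y. frechet_derivative u (at y) v) (at x) w
       = frechet_derivative (\<lambda>y. frechet_derivative u (at y) w) (at x) v" (is "?A = ?B")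
proof (rule ccontr)
  assume ne: "?A \<noteq> ?B"
  define e where "e = norm (?A - ?B) / 4"
  have e: "e > 0" using ne by (simp add: e_def)
  obtain d1 where d1: "d1 > 0" "\<And>h. 0 < h \<Longrightarrow> h < d1 \<Longrightarrow>
      norm (u (x + h *\<^sub>R v + h *\<^sub>R w) - u (x + h *\<^sub>R v) - u (x + h *\<^sub>R w) + u x - (h * h) *\<^sub>R ?A) \<le> e * (h * h)"
    using second_difference_bound[OF assms e, of v w] by blast
  obtain d2 where d2: "d2 > 0" "\<And>h. 0 < h \<Longrightarrow> h < d2 \<Longrightarrow>
      norm (u (x + h *\<^sub>R w + h *\<^sub>R v) - u (x + h *\<^sub>R w) - u (x + h *\<^sub>R v) + u x - (h * h) *\<^sub>R ?B) \<le> e * (h * h)"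
    using second_difference_bound[OF assms e, of w v] by blast
  define h where "h = min d1 d2 / 2"
  have h: "0 < h" "h < d1" "h < d2" using d1(1) d2(1) by (auto simp: h_def)
  let ?Q = "u (x + h *\<^sub>R v + h *\<^sub>R w) - u (x + h *\<^sub>R v) - u (x + h *\<^sub>R w) + u x"
  have 1: "norm (?Q - (h * h) *\<^sub>R ?A) \<le> e * (h * h)" using d1(2) h by blast
  have 2: "norm (?Q - (h * h) *\<^sub>R ?B) \<le> e * (h * h)"
    using d2(2)[of h] h by (simp add: algebra_simps)
  have "(h * h) * norm (?A - ?B) = norm ((?Q - (h * h) *\<^sub>R ?B) - (?Q - (h * h) *\<^sub>R ?A))"
  proof -
    have "(?Q - (h * h) *\<^sub>R ?B) - (?Q - (h * h) *\<^sub>R ?A) = (h * h) *\<^sub>R (?A - ?B)"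
      by (simp add: scaleR_right_diff_distrib)
    then show ?thesis by simp
  qed
  also have "\<dots> \<le> e * (h * h) + e * (h * h)"
    using 1 2 by (meson add_mono norm_triangle_ineq4 order_trans)
  also have "\<dots> = (h * h) * (2 * e)" by simp
  finally have "(h * h) * norm (?A - ?B) \<le> (h * h) * (2 * e)" .
  then have "norm (?A - ?B) \<le> 2 * e" using h by simp
  then show False using e by (simp add: e_def)
qed

section \<open>Integration over the torus\<close>

locale torus =
  fixes \<omega>1 \<omega>2 :: complex
  assumes lattice: "lattice_basis \<omega>1 \<omega>2"
begin

abbreviation integ :: "(complex \<Rightarrow> 'a::{banach, second_countable_topology}) \<Rightarrow> 'a" where
  "integ \<equiv> torus_integral \<omega>1 \<omega>2"

abbreviation periodic :: "(complex \<Rightarrow> 'a) \<Rightarrow> bool" where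
  "periodic \<equiv> on_torus \<omega>1 \<omega>2"

definition coord1 :: "complex \<Rightarrow> real" where
  "coord1 z = Im (cnj z * \<omega>2) / Im (cnj \<omega>1 * \<omega>2)"

definition coord2 :: "complex \<Rightarrow> real" where
  "coord2 z = Im (cnj \<omega>1 * z) / Im (cnj \<omega>1 * \<omega>2)"

text \<open>The parallelogram is \<open>strip 0 1\<close>. The other strips are the pieces into which it is cut when it is
  translated along \<open>\<omega>1\<close>.\<close>

definition strip :: "real \<Rightarrow> real \<Rightarrow> complex set" where
  "strip a b = {z. a \<le> coord1 z \<and> coord1 z < b \<and> 0 \<le> coord2 z \<and> coord2 z < 1}"

abbreviation (input) F :: "complex set" where "F \<equiv> fundamental_domain \<omega>1 \<omega>2"

lemma det_nonzero: "Im (cnj \<omega>1 * \<omega>2) \<noteq> 0"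
  using lattice by (simp add: lattice_basis_def)

lemma coord_add [simp]:
  "coord1 (z + w) = coord1 z + coord1 w" "coord2 (z + w) = coord2 z + coord2 w"
  by (simp_all add: coord1_def coord2_def add_divide_distrib[symmetric] algebra_simps)

lemma coord_scale [simp]:
  "coord1 (of_real r * z) = r * coord1 z" "coord2 (of_real r * z) = r * coord2 z"
  by (simp_all add: coord1_def coord2_def diff_divide_distrib algebra_simps)

lemma coord_basis [simp]:
  "coord1 \<omega>1 = 1" "coord1 \<omega>2 = 0" "coord2 \<omega>1 = 0" "coord2 \<omega>2 = 1"
  using det_nonzero by (simp_all add: coord1_def coord2_def)

lemma coord_decomp: "of_real (coord1 z) * \<omega>1 + of_real (coord2 z) * \<omega>2 = z"
proof (rule complex_eqI)
  let ?d = "Im (cnj \<omega>1 * \<omega>2)"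
  have "Im (cnj z * \<omega>2) * Re \<omega>1 + Im (cnj \<omega>1 * z) * Re \<omega>2 = Re z * ?d"
       "Im (cnj z * \<omega>2) * Im \<omega>1 + Im (cnj \<omega>1 * z) * Im \<omega>2 = Im z * ?d"
    by (simp_all add: algebra_simps)
  then have "coord1 z * Re \<omega>1 + coord2 z * Re \<omega>2 = Re z"
       "coord1 z * Im \<omega>1 + coord2 z * Im \<omega>2 = Im z"
    using det_nonzero unfolding coord1_def coord2_def
    by (simp_all only: times_divide_eq_left add_divide_distrib[symmetric] nonzero_mult_div_cancel_right
        not_False_eq_True)
  then show "Re (of_real (coord1 z) * \<omega>1 + of_real (coord2 z) * \<omega>2) = Re z"
       "Im (of_real (coord1 z) * \<omega>1 + of_real (coord2 z) * \<omega>2) = Im z"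
    by simp_all
qed

lemma continuous_coord [continuous_intros]:
  "continuous_on S coord1" "continuous_on S coord2"
  unfolding coord1_def coord2_def by (intro continuous_intros ballI det_nonzero)+

lemma fundamental_domain_eq: "F = strip 0 1"
proof (intro equalityI subsetI)
  fix z assume "z \<in> strip 0 1"
  then have "coord1 z \<in> {0..<1}" "coord2 z \<in> {0..<1}" by (auto simp: strip_def)
  then show "z \<in> F" unfolding fundamental_domain_def
    using coord_decomp[of z] by (intro CollectI) metis
qed (auto simp: fundamental_domain_def strip_def)

lemma strip_measurable [measurable]: "strip a b \<in> sets borel"
proof -
  have [measurable]: "coord1 \<in> borel_measurable borel" "coord2 \<in> borel_measurable borel"
    by (intro borel_measurable_continuous_onI continuous_coord)+
  show ?thesis unfolding strip_def by measurable
qed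

definition domain_radius :: real where "domain_radius = norm \<omega>1 + norm \<omega>2"

lemma strip_subset_cball: "strip 0 1 \<subseteq> cball 0 domain_radius"
proof
  fix z assume z: "z \<in> strip 0 1"
  have "norm z = norm (of_real (coord1 z) * \<omega>1 + of_real (coord2 z) * \<omega>2)"
    by (simp add: coord_decomp)
  also have "\<dots> \<le> norm (of_real (coord1 z) * \<omega>1) + norm (of_real (coord2 z) * \<omega>2)"
    by (rule norm_triangle_ineq)
  also have "\<dots> \<le> norm \<omega>1 + norm \<omega>2"
    using z by (auto simp: norm_mult strip_def intro!: add_mono mult_left_le_one_le)
  finally show "z \<in> cball 0 domain_radius" by (simp add: domain_radius_def)
qed

lemma strip_bounded: "bounded (strip a b)"
proof -
  have "norm z \<le> (\<bar>a\<bar> + \<bar>b\<bar>) * norm \<omega>1 + norm \<omega>2" if z: "z \<in> strip a b" for z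
  proof -
    have "norm z = norm (of_real (coord1 z) * \<omega>1 + of_real (coord2 z) * \<omega>2)"
      by (simp add: coord_decomp)
    also have "\<dots> \<le> norm (of_real (coord1 z) * \<omega>1) + norm (of_real (coord2 z) * \<omega>2)"
      by (rule norm_triangle_ineq)
    also have "\<dots> \<le> (\<bar>a\<bar> + \<bar>b\<bar>) * norm \<omega>1 + norm \<omega>2"
      using z by (auto simp: norm_mult strip_def intro!: add_mono mult_left_le_one_le mult_right_mono)
    finally show ?thesis .
  qed
  then show ?thesis unfolding bounded_iff by blast
qed

lemma set_integrable_strip:
  fixes g :: "complex \<Rightarrow> 'a::{banach, second_countable_topology}"
  assumes "continuous_on UNIV g"
  shows "set_integrable lborel (strip a b) g"
proof -
  have "compact (closure (strip a b))" using strip_bounded by (simp add: compact_closure)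
  then have "set_integrable lborel (closure (strip a b)) g"
    unfolding set_integrable_def
    by (rule borel_integrable_compact) (use assms continuous_on_subset in blast)
  then show ?thesis
    by (rule set_integrable_subset) (auto simp: closure_subset)
qed

definition area :: real where "area = measure lborel F"

lemma emeasure_strip_finite: "emeasure lborel (strip a b) < \<infinity>"
  by (rule emeasure_bounded_finite) (rule strip_bounded)

lemma torus_integral_strip: "integ g = (LINT z:strip 0 1|lborel. g z)"
  by (simp add: torus_integral_def fundamental_domain_eq)

lemma torus_integral_add:
  fixes g h :: "complex \<Rightarrow> 'a::{banach, second_countable_topology}"
  assumes "continuous_on UNIV g" "continuous_on UNIV h"
  shows "integ (\<lambda>z. g z + h z) = integ g + integ h"
  unfolding torus_integral_strip by (intro set_integral_add set_integrable_strip assms)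

lemma torus_integral_diff:
  fixes g h :: "complex \<Rightarrow> 'a::{banach, second_countable_topology}"
  assumes "continuous_on UNIV g" "continuous_on UNIV h"
  shows "integ (\<lambda>z. g z - h z) = integ g - integ h"
  unfolding torus_integral_strip by (intro set_integral_diff set_integrable_strip assms)

lemma torus_integral_cmult:
  fixes g :: "complex \<Rightarrow> complex"
  shows "integ (\<lambda>z. c * g z) = c * integ g"
  unfolding torus_integral_def by simp

lemma torus_integral_cnj:
  "integ (\<lambda>z. cnj (g z)) = cnj (integ g)"
  unfolding torus_integral_def set_lebesgue_integral_def
  by (subst Bochner_Integration.integral_cnj[symmetric]) simp

lemma torus_integral_Re:
  assumes "continuous_on UNIV g"
  shows "integ (\<lambda>z. Re (g z)) = Re (integ g)"
proof -
  have "integrable lborel (\<lambda>z. indicator (strip 0 1) z *\<^sub>R g z)"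
    using set_integrable_strip[OF assms] unfolding set_integrable_def .
  from integral_Re[OF this] show ?thesis
    unfolding torus_integral_strip set_lebesgue_integral_def by simp
qed

lemma torus_integral_norm_bound:
  fixes g :: "complex \<Rightarrow> 'a::{banach, second_countable_topology}"
  assumes "continuous_on UNIV g" "\<And>z. z \<in> F \<Longrightarrow> norm (g z) \<le> B"
  shows "norm (integ g) \<le> B * area"
proof -
  have "norm (integ g) \<le> (LINT z:strip 0 1|lborel. norm (g z))"
    unfolding torus_integral_strip by (rule set_integral_norm_bound[OF set_integrable_strip[OF assms(1)]])
  also have "\<dots> \<le> (LINT z:strip 0 1|lborel. B)"
    using assms(2) fundamental_domain_eq
    by (intro set_integral_mono set_integrable_strip continuous_intros assms(1)) auto
  also have "\<dots> = B * area"
    using emeasure_strip_finite[of 0 1] by (simp add: area_def fundamental_domain_eq set_integral_const)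
  finally show ?thesis .
qed

lemma torus_integral_const:
  fixes c :: complex
  shows "integ (\<lambda>z. c) = of_real area * c"
  using emeasure_strip_finite[of 0 1]
  by (simp add: torus_integral_strip area_def fundamental_domain_eq set_integral_const scaleR_conv_of_real)

text \<open>Positivity at the centre of the parallelogram suffices for the applications, since a translation
  moves any other point there.\<close>

lemma torus_integral_pos:
  fixes u :: "complex \<Rightarrow> real"
  assumes u: "continuous_on UNIV u" "\<And>z. 0 \<le> u z" and p: "u ((\<omega>1 + \<omega>2) / 2) > 0"
  shows "integ u > 0"
proof -
  let ?p = "(\<omega>1 + \<omega>2) / 2"
  let ?O = "{z. 0 < coord1 z} \<inter> {z. coord1 z < 1} \<inter> {z. 0 < coord2 z} \<inter> {z. coord2 z < 1}
    \<inter> {z. u ?p / 2 < u z}"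
  have "open ?O"
    by (intro open_Int open_Collect_less continuous_intros u)
  moreover have pe: "?p = of_real (1/2) * (\<omega>1 + \<omega>2)" by simp
  have "?p \<in> ?O" using p unfolding pe coord_scale coord_add coord_basis mem_Collect_eq Int_iff by simp
  ultimately obtain r where r: "r > 0" "ball ?p r \<subseteq> ?O" using open_contains_ball by blast
  have "0 < measure lborel (ball ?p r)" using content_ball_pos[OF r(1)] by simp
  then have "0 < (u ?p / 2) * measure lborel (ball ?p r)" using p by simp
  also have "\<dots> = (LINT z:ball ?p r|lborel. u ?p / 2)"
    using emeasure_bounded_finite[of "ball ?p r"] by (simp add: set_integral_const)
  also have "\<dots> \<le> (LINT z:strip 0 1|lborel. u z)"
    unfolding set_lebesgue_integral_def
  proof (rule integral_mono)
    show "integrable lborel (\<lambda>z. indicat_real (ball ?p r) z *\<^sub>R (u ?p / 2))"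
      using emeasure_bounded_finite[of "ball ?p r"] by simp
    show "integrable lborel (\<lambda>z. indicat_real (strip 0 1) z *\<^sub>R u z)"
      using set_integrable_strip[OF u(1), of 0 1] by (simp add: set_integrable_def)
    show "indicat_real (ball ?p r) z *\<^sub>R (u ?p / 2) \<le> indicat_real (strip 0 1) z *\<^sub>R u z" for z
      using r(2) u(2)[of z] by (auto simp: indicator_def strip_def)
  qed
  finally show ?thesis by (simp add: torus_integral_strip)
qed

lemma area_pos: "area > 0"
  using torus_integral_pos[of "\<lambda>_. 1"] emeasure_strip_finite[of 0 1]
  by (simp add: torus_integral_strip area_def fundamental_domain_eq set_integral_const)

lemma on_torus_multiple:
  assumes "periodic g"
  shows "g (z + of_int m * \<omega>1 + of_int n * \<omega>2) = g z"
proof -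
  have nat1: "g (z + of_nat k * \<omega>1) = g z" for z k
  proof (induction k)
    case (Suc k)
    have "g (z + of_nat (Suc k) * \<omega>1) = g ((z + of_nat k * \<omega>1) + \<omega>1)" by (simp add: algebra_simps)
    then show ?case using assms Suc unfolding on_torus_def by metis
  qed simp
  have nat2: "g (z + of_nat k * \<omega>2) = g z" for z k
  proof (induction k)
    case (Suc k)
    have "g (z + of_nat (Suc k) * \<omega>2) = g ((z + of_nat k * \<omega>2) + \<omega>2)" by (simp add: algebra_simps)
    then show ?case using assms Suc unfolding on_torus_def by metis
  qed simp
  have int1: "g (z + of_int m * \<omega>1) = g z" for z m
  proof (cases m rule: int_cases2)
    case (nonneg k) then show ?thesis using nat1 by simp
  next
    case (nonpos k) then show ?thesis using nat1[of "z - of_nat k * \<omega>1" k] by simp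
  qed
  have int2: "g (z + of_int m * \<omega>2) = g z" for z m
  proof (cases m rule: int_cases2)
    case (nonneg k) then show ?thesis using nat2 by simp
  next
    case (nonpos k) then show ?thesis using nat2[of "z - of_nat k * \<omega>2" k] by simp
  qed
  show ?thesis using int1 int2 by simp
qed

lemma set_integral_strip_translate:
  fixes g :: "complex \<Rightarrow> 'a::{banach, second_countable_topology}"
  assumes "continuous_on UNIV g"
  shows "(LINT z:strip a b|lborel. g (z + of_real c * \<omega>1)) = (LINT z:strip (a + c) (b + c)|lborel. g z)"
proof -
  let ?h = "\<lambda>z. indicator (strip (a + c) (b + c)) z *\<^sub>R g z"
  have g: "g \<in> borel_measurable borel" by (rule borel_measurable_continuous_onI[OF assms])
  have "(LINT z|lborel. ?h z) = (LINT z|distr lborel borel ((+) (of_real c * \<omega>1)). ?h z)"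
    by (simp add: lborel_distr_plus)
  also have "\<dots> = (LINT z|lborel. ?h (of_real c * \<omega>1 + z))"
    using g by (intro integral_distr) auto
  also have "\<dots> = (LINT z|lborel. indicator (strip a b) z *\<^sub>R g (z + of_real c * \<omega>1))"
    by (intro Bochner_Integration.integral_cong) (auto simp: indicator_def strip_def add.commute)
  finally show ?thesis by (simp add: set_lebesgue_integral_def)
qed

text \<open>Translating the parallelogram by \<open>c \<omega>1\<close> cuts off the strip \<open>strip 0 c\<close> and adds the strip
  \<open>strip 1 (1 + c)\<close>; these are congruent modulo \<open>\<omega>1\<close>.\<close>

lemma torus_integral_translate1:
  fixes g :: "complex \<Rightarrow> 'a::{banach, second_countable_topology}"
  assumes "periodic g" "continuous_on UNIV g" "0 \<le> c" "c < 1"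
  shows "integ (\<lambda>z. g (z + of_real c * \<omega>1)) = integ g"
proof -
  note int = set_integrable_strip[OF assms(2)]
  have split: "(LINT z:strip x y|lborel. g z) + (LINT z:strip y w|lborel. g z) = (LINT z:strip x w|lborel. g z)"
    if "x \<le> y" "y \<le> w" for x y w
  proof -
    have "strip x w = strip x y \<union> strip y w" "strip x y \<inter> strip y w = {}" using that by (auto simp: strip_def)
    then show ?thesis using set_integral_Un[OF _ int int] by metis
  qed
  have per: "(LINT z:strip 1 (1 + c)|lborel. g z) = (LINT z:strip 0 c|lborel. g z)"
    using set_integral_strip_translate[OF assms(2), of 0 c 1] assms(1)
    by (simp add: on_torus_def add.commute)
  have "integ (\<lambda>z. g (z + of_real c * \<omega>1)) = (LINT z:strip c (1 + c)|lborel. g z)"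
    using set_integral_strip_translate[OF assms(2), of 0 1 c] by (simp add: torus_integral_strip)
  also have "\<dots> = (LINT z:strip c 1|lborel. g z) + (LINT z:strip 1 (1 + c)|lborel. g z)"
    using split[of c 1 "1 + c"] assms(3,4) by simp
  also have "\<dots> = integ g"
    using split[of 0 c 1] assms(3,4) per by (simp add: torus_integral_strip add.commute)
  finally show ?thesis .
qed

lemma fundamental_domain_swap: "fundamental_domain \<omega>2 \<omega>1 = F"
  unfolding fundamental_domain_def by (auto simp: add.commute) (metis add.commute)+

lemma torus_integral_translate:
  fixes g :: "complex \<Rightarrow> 'a::{banach, second_countable_topology}"
  assumes g: "periodic g" "continuous_on UNIV g"
  shows "integ (\<lambda>z. g (z + v)) = integ g"
proof -
  \<comment> \<open>Modulo the lattice, \<open>v\<close> is a fractional translation along each period; the one along \<open>\<omega>2\<close> is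
    treated by exchanging the two periods.\<close>
  interpret swap: torus \<omega>2 \<omega>1
    using lattice by unfold_locales (auto simp: lattice_basis_def algebra_simps)
  let ?x = "frac (coord1 v)" and ?y = "frac (coord2 v)"
  have v: "v = of_real ?x * \<omega>1 + of_real ?y * \<omega>2
      + of_int \<lfloor>coord1 v\<rfloor> * \<omega>1 + of_int \<lfloor>coord2 v\<rfloor> * \<omega>2"
    by (subst (1) coord_decomp[symmetric]) (simp add: frac_def algebra_simps)
  have shift: "(\<lambda>z. g (z + v)) = (\<lambda>z. g (z + of_real ?x * \<omega>1 + of_real ?y * \<omega>2))"
  proof
    fix z
    have "g (z + v) = g (z + of_real ?x * \<omega>1 + of_real ?y * \<omega>2
        + of_int \<lfloor>coord1 v\<rfloor> * \<omega>1 + of_int \<lfloor>coord2 v\<rfloor> * \<omega>2)"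
      by (subst (1) v) (simp only: add.assoc)
    then show "g (z + v) = g (z + of_real ?x * \<omega>1 + of_real ?y * \<omega>2)"
      by (simp only: on_torus_multiple[OF g(1)])
  qed
  define h where "h = (\<lambda>z. g (z + of_real ?y * \<omega>2))"
  have h: "periodic h" "continuous_on UNIV h"
  proof -
    show "periodic h" unfolding on_torus_def h_def
    proof
      fix z
      have "z + \<omega>1 + of_real ?y * \<omega>2 = (z + of_real ?y * \<omega>2) + \<omega>1"
           "z + \<omega>2 + of_real ?y * \<omega>2 = (z + of_real ?y * \<omega>2) + \<omega>2" by (simp_all add: algebra_simps)
      then show "g (z + \<omega>1 + of_real ?y * \<omega>2) = g (z + of_real ?y * \<omega>2) \<and>
          g (z + \<omega>2 + of_real ?y * \<omega>2) = g (z + of_real ?y * \<omega>2)"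
        using g(1) unfolding on_torus_def by metis
    qed
    show "continuous_on UNIV h" unfolding h_def
      by (rule continuous_on_compose2[OF g(2)]) (auto intro!: continuous_intros)
  qed
  have "integ h = torus_integral \<omega>2 \<omega>1 h"
    unfolding torus_integral_def by (simp only: fundamental_domain_swap)
  also have "\<dots> = torus_integral \<omega>2 \<omega>1 g"
    unfolding h_def using g by (intro swap.torus_integral_translate1) (auto simp: on_torus_def frac_lt_1)
  also have "\<dots> = integ g"
    unfolding torus_integral_def by (simp only: fundamental_domain_swap)
  finally have "integ h = integ g" .
  moreover have "integ (\<lambda>z. h (z + of_real ?x * \<omega>1)) = integ h"
    using h by (intro torus_integral_translate1) (auto simp: frac_lt_1)
  ultimately show ?thesis by (simp add: h_def shift)
qed

text \<open>Near \<open>{t} \<times> F\<close>, which is relatively compact, \<open>G'\<close> is uniformly continuous; by the mean value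
  inequality the difference quotients then converge uniformly on \<open>F\<close>.\<close>

lemma torus_integral_has_vector_derivative:
  fixes G :: "real \<Rightarrow> complex \<Rightarrow> 'a::{banach, second_countable_topology}"
  assumes I: "open I" "t \<in> I"
    and der: "\<And>s p. s \<in> I \<Longrightarrow> ((\<lambda>s. G s p) has_vector_derivative G' s p) (at s)"
    and cont': "continuous_on (I \<times> UNIV) (\<lambda>(s, p). G' s p)"
    and cont: "\<And>s. s \<in> I \<Longrightarrow> continuous_on UNIV (G s)"
  shows "((\<lambda>s. integ (G s)) has_vector_derivative integ (G' t)) (at t)"
  unfolding has_vector_derivative_def has_derivative_at_alt
proof (intro conjI allI impI)
  show "bounded_linear (\<lambda>h. h *\<^sub>R integ (G' t))" by (rule bounded_linear_scaleR_left)
  fix e :: real assume e: "e > 0"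
  obtain r where r: "r > 0" "cball t r \<subseteq> I" using I open_contains_cball by blast
  let ?K = "cball t r \<times> cball (0::complex) domain_radius"
  have contt: "continuous_on UNIV (G' t)"
  proof -
    have "continuous_on UNIV (\<lambda>p. (\<lambda>(s, p). G' s p) (t, p))"
      using I(2) by (intro continuous_on_compose2[OF cont']) (auto intro!: continuous_intros)
    then show ?thesis by simp
  qed
  have "uniformly_continuous_on ?K (\<lambda>(s, p). G' s p)"
    using r(2) by (intro compact_uniformly_continuous compact_Times compact_cball)
      (auto intro: continuous_on_subset[OF cont'])
  moreover have ea: "e / area > 0" using e area_pos by simp
  ultimately obtain d where d: "d > 0"
    "\<forall>x\<in>?K. \<forall>y\<in>?K. dist y x < d \<longrightarrow> dist (case y of (s, p) \<Rightarrow> G' s p) (case x of (s, p) \<Rightarrow> G' s p) < e / area"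
    unfolding uniformly_continuous_on_def by meson
  have close: "norm (G' s p - G' t p) \<le> e / area" if "dist s t < min d r" "p \<in> F" for s p
  proof -
    have "p \<in> cball 0 domain_radius" using that(2) strip_subset_cball fundamental_domain_eq by blast
    moreover have "dist (s, p) (t, p) < d" using that(1) by (simp add: dist_prod_def)
    ultimately show ?thesis using d(2)[rule_format, of "(t, p)" "(s, p)"] that r(1)
      by (simp add: dist_norm dist_commute less_imp_le norm_minus_commute)
  qed
  show "\<exists>d>0. \<forall>y. norm (y - t) < d \<longrightarrow>
      norm (integ (G y) - integ (G t)
        - (y - t) *\<^sub>R integ (G' t)) \<le> e * norm (y - t)"
  proof (intro exI[of _ "min d r"] conjI allI impI)
    show "min d r > 0" using d(1) r(1) by simp
    fix y assume y: "norm (y - t) < min d r"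
    have seg: "dist s t < min d r" if "s \<in> closed_segment t y" for s
      using dist_in_closed_segment[OF that] y by (auto simp: dist_norm abs_minus_commute)
    have inI: "s \<in> I" if "dist s t < min d r" for s
      using that r(2) by (auto simp: dist_commute subset_iff)
    have yI: "y \<in> I" using inI y by (simp add: dist_norm)
    have bound: "norm (G y p - G t p - (y - t) *\<^sub>R G' t p) \<le> (e / area) * norm (y - t)" if p: "p \<in> F" for p
    proof -
      let ?g = "\<lambda>s. G s p - s *\<^sub>R G' t p"
      have "norm (?g y - ?g t) \<le> (e / area) * norm (y - t)"
      proof (rule differentiable_bound[where S = "closed_segment t y" and f' = "\<lambda>s k. k *\<^sub>R (G' s p - G' t p)"])
        show "(?g has_derivative (\<lambda>k. k *\<^sub>R (G' s p - G' t p))) (at s within closed_segment t y)"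
          if "s \<in> closed_segment t y" for s
        proof -
          have "((\<lambda>s. G s p) has_derivative (\<lambda>k. k *\<^sub>R G' s p)) (at s)"
            using der[OF inI[OF seg[OF that]]] by (simp add: has_vector_derivative_def)
          then have "(?g has_derivative (\<lambda>k. k *\<^sub>R G' s p - k *\<^sub>R G' t p)) (at s)"
            by (auto intro!: derivative_eq_intros)
          then show ?thesis by (auto simp: scaleR_right_diff_distrib intro: has_derivative_at_withinI)
        qed
        show "onorm (\<lambda>k. k *\<^sub>R (G' s p - G' t p)) \<le> e / area" if "s \<in> closed_segment t y" for s
          using close[OF seg[OF that] p] ea
          by (intro onorm_le) (simp add: mult.commute mult_left_mono del: times_divide_eq_left times_divide_eq_right)
      qed auto
      moreover have "G y p - G t p - (y - t) *\<^sub>R G' t p = ?g y - ?g t"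
        by (simp add: algebra_simps)
      ultimately show ?thesis by (simp only:)
    qed
    have "norm (integ (\<lambda>p. G y p - G t p - (y - t) *\<^sub>R G' t p))
        \<le> ((e / area) * norm (y - t)) * area"
      using yI I(2) by (intro torus_integral_norm_bound bound continuous_intros cont contt)
    moreover have "integ (\<lambda>p. G y p - G t p - (y - t) *\<^sub>R G' t p)
        = integ (G y) - integ (G t) - (y - t) *\<^sub>R integ (G' t)"
    proof -
      have "integ (\<lambda>p. (y - t) *\<^sub>R G' t p) = (y - t) *\<^sub>R integ (G' t)"
        unfolding torus_integral_def by simp
      then show ?thesis using yI I(2)
        by (simp add: torus_integral_diff continuous_intros cont contt)
    qed
    ultimately show "norm (integ (G y) - integ (G t)
        - (y - t) *\<^sub>R integ (G' t)) \<le> e * norm (y - t)"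
      using area_pos by (simp only: times_divide_eq_left nonzero_mult_div_cancel_right less_imp_neq[THEN not_sym] not_False_eq_True)
  qed
qed

text \<open>Integration by parts on the torus: the integral of \<open>g (z + s v)\<close> does not depend on \<open>s\<close>, and
  its derivative at \<open>s = 0\<close> is the integral of the derivative of \<open>g\<close>.\<close>

lemma torus_integral_derivative:
  fixes g :: "complex \<Rightarrow> 'a::{banach, second_countable_topology}"
  assumes g: "periodic g" "smooth_on g UNIV"
  shows "integ (\<lambda>z. frechet_derivative g (at z) v) = 0"
proof -
  let ?g' = "\<lambda>z. frechet_derivative g (at z) v"
  let ?G = "\<lambda>s z. g (z + s *\<^sub>R v)" and ?G' = "\<lambda>s z. ?g' (z + s *\<^sub>R v)"
  have c: "continuous_on UNIV g" using g(2) by (rule smooth_on_continuous_on)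
  have c': "continuous_on UNIV ?g'" by (rule smooth_on_continuous_on[OF smooth_on_frechet_derivative[OF g(2)]])
  have "((\<lambda>s. integ (?G s)) has_vector_derivative integ (?G' 0)) (at 0)"
  proof (rule torus_integral_has_vector_derivative[where I = UNIV])
    show "((\<lambda>s. ?G s p) has_vector_derivative ?G' s p) (at s)" for s p
    proof -
      note D = smooth_on_has_derivative[OF g(2) open_UNIV UNIV_I, of "p + s *\<^sub>R v"]
      have "((\<lambda>s. p + s *\<^sub>R v) has_derivative (\<lambda>k. k *\<^sub>R v)) (at s)"
        by (auto intro!: derivative_eq_intros)
      from diff_chain_at[OF this D] show ?thesis
        using linear_cmul[OF has_derivative_linear[OF D]] by (simp add: o_def has_vector_derivative_def)
    qed
    have "continuous_on (UNIV \<times> UNIV) (\<lambda>x. ?g' (snd x + fst x *\<^sub>R v))"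
      by (intro continuous_on_compose2[OF c']) (auto intro!: continuous_intros)
    then show "continuous_on (UNIV \<times> UNIV) (\<lambda>(s, p). ?g' (p + s *\<^sub>R v))"
      by (simp add: case_prod_unfold)
    show "continuous_on UNIV (?G s)" for s
      by (intro continuous_on_compose2[OF c]) (auto intro!: continuous_intros)
  qed auto
  moreover have "(\<lambda>s. integ (?G s)) = (\<lambda>s. integ g)"
    using torus_integral_translate[OF g(1) c] by auto
  ultimately have "((\<lambda>s::real. integ g) has_vector_derivative integ (?G' 0)) (at 0)"
    by simp
  then have "integ (?G' 0) = 0"
    using vector_derivative_unique_at has_vector_derivative_const by blast
  then show ?thesis by simp
qed

end

section \<open>Wirtinger derivatives of periodic functions\<close>

lemma dz_eq: "(g has_derivative D) (at p) \<Longrightarrow> dz g p = (D 1 - \<i> * D \<i>) / 2"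
  using frechet_derivative_at[of g D p] by (simp add: dz_def)

lemma dzbar_eq: "(g has_derivative D) (at p) \<Longrightarrow> dzbar g p = (D 1 + \<i> * D \<i>) / 2"
  using frechet_derivative_at[of g D p] by (simp add: dzbar_def)

lemma smooth_on_mult:
  fixes f g :: "'a::real_normed_vector \<Rightarrow> 'b::real_normed_algebra"
  shows "open S \<Longrightarrow> smooth_on f S \<Longrightarrow> smooth_on g S \<Longrightarrow> smooth_on (\<lambda>x. f x * g x) S"
  by (rule smooth_on_bilinear[OF bounded_bilinear_mult])

lemma smooth_on_cnj: "open S \<Longrightarrow> smooth_on f S \<Longrightarrow> smooth_on (\<lambda>x. cnj (f x)) S"
  by (rule smooth_on_bounded_linear[OF bounded_linear_cnj])

lemma smooth_on_dz: "smooth_on g UNIV \<Longrightarrow> smooth_on (dz g) UNIV"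
  unfolding dz_def[abs_def] diff_conv_add_uminus divide_inverse
  by (intro smooth_on_mult smooth_on_add smooth_on_const smooth_on_frechet_derivative open_UNIV
      smooth_on_bounded_linear[OF bounded_linear_minus[OF bounded_linear_ident]]) 

lemma smooth_on_dzbar: "smooth_on g UNIV \<Longrightarrow> smooth_on (dzbar g) UNIV"
  unfolding dzbar_def[abs_def] divide_inverse
  by (intro smooth_on_mult smooth_on_add smooth_on_const smooth_on_frechet_derivative open_UNIV)

lemma dz_cnj: "smooth_on g UNIV \<Longrightarrow> dz (\<lambda>q. cnj (g q)) p = cnj (dzbar g p)"
  using dz_eq[OF bounded_linear.has_derivative[OF bounded_linear_cnj smooth_on_has_derivative]]
  by (simp add: dzbar_def)

lemma dzbar_cnj: "smooth_on g UNIV \<Longrightarrow> dzbar (\<lambda>q. cnj (g q)) p = cnj (dz g p)"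
  using dzbar_eq[OF bounded_linear.has_derivative[OF bounded_linear_cnj smooth_on_has_derivative]]
  by (simp add: dz_def)

lemma
  assumes "smooth_on f UNIV" "smooth_on g UNIV"
  shows dz_mult: "dz (\<lambda>q. f q * g q) p = dz f p * g p + f p * dz g p"
    and dzbar_mult: "dzbar (\<lambda>q. f q * g q) p = dzbar f p * g p + f p * dzbar g p"
    and dz_add: "dz (\<lambda>q. f q + g q) p = dz f p + dz g p"
    and dzbar_add: "dzbar (\<lambda>q. f q + g q) p = dzbar f p + dzbar g p"
proof -
  note D = smooth_on_has_derivative[OF assms(1) open_UNIV UNIV_I]
    smooth_on_has_derivative[OF assms(2) open_UNIV UNIV_I]
  note m = has_derivative_mult[OF D, of p] and a = has_derivative_add[OF D, of p]
  show "dz (\<lambda>q. f q * g q) p = dz f p * g p + f p * dz g p"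
    unfolding dz_eq[OF m] by (simp add: dz_def[of f] dz_def[of g] field_simps)
  show "dzbar (\<lambda>q. f q * g q) p = dzbar f p * g p + f p * dzbar g p"
    unfolding dzbar_eq[OF m] by (simp add: dzbar_def[of f] dzbar_def[of g] field_simps)
  show "dz (\<lambda>q. f q + g q) p = dz f p + dz g p"
    unfolding dz_eq[OF a] by (simp add: dz_def[of f] dz_def[of g] field_simps)
  show "dzbar (\<lambda>q. f q + g q) p = dzbar f p + dzbar g p"
    unfolding dzbar_eq[OF a] by (simp add: dzbar_def[of f] dzbar_def[of g] field_simps)
qed

lemma frechet_derivative_periodic:
  assumes "smooth_on g UNIV" "\<And>z. g (z + w) = g z"
  shows "frechet_derivative g (at (z + w)) = frechet_derivative g (at z)"
proof -
  have "((\<lambda>z. z + w) has_derivative (\<lambda>v. v)) (at z)" by (auto intro!: derivative_eq_intros)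
  from diff_chain_at[OF this smooth_on_has_derivative[OF assms(1) open_UNIV UNIV_I]]
  have "(g has_derivative frechet_derivative g (at (z + w))) (at z)"
    using assms(2) by (simp add: o_def)
  then show ?thesis by (rule frechet_derivative_at)
qed

lemma on_torus_frechet_derivative:
  "on_torus \<omega>1 \<omega>2 g \<Longrightarrow> smooth_on g UNIV \<Longrightarrow> on_torus \<omega>1 \<omega>2 (\<lambda>z. frechet_derivative g (at z) v)"
  unfolding on_torus_def using frechet_derivative_periodic[of g] by metis

lemma on_torus_dz: "on_torus \<omega>1 \<omega>2 g \<Longrightarrow> smooth_on g UNIV \<Longrightarrow> on_torus \<omega>1 \<omega>2 (dz g)"
  using on_torus_frechet_derivative[of \<omega>1 \<omega>2 g] by (simp add: on_torus_def dz_def)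

context torus
begin

lemma torus_integral_dz:
  assumes "periodic g" "smooth_on g UNIV"
  shows "integ (dz g) = 0"
proof -
  note c = smooth_on_continuous_on[OF smooth_on_frechet_derivative[OF assms(2)]]
  have "dz g = (\<lambda>z. (1/2) * frechet_derivative g (at z) 1 - (\<i>/2) * frechet_derivative g (at z) \<i>)"
    by (auto simp: dz_def field_simps)
  then show ?thesis
    using torus_integral_derivative[OF assms]
    by (simp only: torus_integral_diff[OF continuous_on_mult_left[OF c] continuous_on_mult_left[OF c]]
        torus_integral_cmult) simp
qed

lemma torus_integral_dzbar:
  assumes "periodic g" "smooth_on g UNIV"
  shows "integ (dzbar g) = 0"
proof -
  note c = smooth_on_continuous_on[OF smooth_on_frechet_derivative[OF assms(2)]]
  have "dzbar g = (\<lambda>z. (1/2) * frechet_derivative g (at z) 1 + (\<i>/2) * frechet_derivative g (at z) \<i>)"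
    by (auto simp: dzbar_def field_simps)
  then show ?thesis
    using torus_integral_derivative[OF assms]
    by (simp only: torus_integral_add[OF continuous_on_mult_left[OF c] continuous_on_mult_left[OF c]]
        torus_integral_cmult) simp
qed

section \<open>Fourier series and the \<open>\<partial>\<close>-equation on the torus\<close>

text \<open>The characters of the torus are \<open>exp (freq m n z)\<close> with \<open>freq\<close> real linear and imaginary valued;
  \<open>symbol m n\<close> is the eigenvalue of \<open>\<partial>\<close> on such a character.\<close>

definition freq :: "int \<Rightarrow> int \<Rightarrow> complex \<Rightarrow> complex" where
  "freq m n v = 2 * pi * \<i> * of_real (of_int m * coord1 v + of_int n * coord2 v)"

definition char :: "int \<Rightarrow> int \<Rightarrow> complex \<Rightarrow> complex" where
  "char m n z = exp (freq m n z)"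

definition symbol :: "int \<Rightarrow> int \<Rightarrow> complex" where
  "symbol m n = (freq m n 1 - \<i> * freq m n \<i>) / 2"

lemma coord_complex:
  "coord1 v = Re v * coord1 1 + Im v * coord1 \<i>" "coord2 v = Re v * coord2 1 + Im v * coord2 \<i>"
  by (simp_all add: coord1_def coord2_def add_divide_distrib diff_divide_distrib mult.commute)

lemma freq_linear: "freq m n v = of_real (Re v) * freq m n 1 + of_real (Im v) * freq m n \<i>"
  unfolding freq_def by (subst coord_complex(1)[of v], subst coord_complex(2)[of v]) (simp add: algebra_simps)

lemma bounded_linear_freq: "bounded_linear (freq m n)"
proof -
  have "bounded_linear (\<lambda>v. of_real (Re v) * freq m n 1 + of_real (Im v) * freq m n \<i>)"
    by (intro bounded_linear_add bounded_linear_mult_left bounded_linear_compose[OF bounded_linear_of_real]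
        bounded_linear_Re bounded_linear_Im bounded_linear_compose[OF bounded_linear_mult_left])
  moreover have "freq m n = (\<lambda>v. of_real (Re v) * freq m n 1 + of_real (Im v) * freq m n \<i>)"
    by (rule ext) (rule freq_linear)
  ultimately show ?thesis by (rule back_subst[where a = "\<lambda>v. of_real (Re v) * freq m n 1 + of_real (Im v) * freq m n \<i>", OF _ sym])
qed

lemma cnj_freq: "cnj (freq m n v) = - freq m n v"
  by (simp add: freq_def)

lemma norm_freq: "norm (freq m n v) = 2 * pi * \<bar>of_int m * coord1 v + of_int n * coord2 v\<bar>"
  unfolding freq_def norm_mult norm_of_real by (simp add: norm_mult)

lemma freq_symbol: "freq m n v = symbol m n * v - cnj (symbol m n * v)"
proof -
  have "symbol m n * v - cnj (symbol m n * v) = of_real (Re v) * freq m n 1 + of_real (Im v) * freq m n \<i>"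
    using cnj_freq[of m n 1] cnj_freq[of m n \<i>]
    by (auto simp: symbol_def complex_eq_iff field_simps)
  then show ?thesis using freq_linear[of m n v] by simp
qed

text \<open>The values of \<open>freq m n\<close> at the two periods are \<open>2 \<pi> \<i> m\<close> and \<open>2 \<pi> \<i> n\<close>, while \<open>freq m n\<close> is determined
  by its complex linear part, the symbol. This is the ellipticity of \<open>\<partial>\<close> on the torus.\<close>

lemma symbol_lower_bound: "of_int (\<bar>m\<bar> + \<bar>n\<bar>) \<le> domain_radius * norm (symbol m n)"
proof -
  have b: "norm (freq m n v) \<le> 2 * (norm (symbol m n) * norm v)" for v
    unfolding freq_symbol[of m n v]
    using norm_triangle_ineq4[of "symbol m n * v" "cnj (symbol m n * v)"]
    by (simp only: complex_mod_cnj norm_mult mult_2)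
  have "2 * pi * \<bar>of_int m\<bar> \<le> 2 * (norm (symbol m n) * norm \<omega>1)"
       "2 * pi * \<bar>of_int n\<bar> \<le> 2 * (norm (symbol m n) * norm \<omega>2)"
    using b[of \<omega>1] b[of \<omega>2] by (simp_all add: norm_freq)
  moreover have "1 * \<bar>of_int m\<bar> \<le> pi * \<bar>of_int m :: real\<bar>" "1 * \<bar>of_int n\<bar> \<le> pi * \<bar>of_int n :: real\<bar>"
    using pi_gt3 by (intro mult_right_mono; simp)+
  ultimately show ?thesis unfolding domain_radius_def by (simp add: algebra_simps)
qed

lemma symbol_diff: "symbol (m - m') (n - n') = symbol m n - symbol m' n'"
  by (simp add: symbol_def freq_def field_simps)

lemma symbol_eq_0: "symbol m n = 0 \<Longrightarrow> m = 0 \<and> n = 0"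
  using symbol_lower_bound[of m n] by (simp add: add_nonneg_eq_0_iff abs_le_zero_iff) linarith

lemma char_has_derivative: "(char m n has_derivative (\<lambda>v. freq m n v * char m n z)) (at z)"
proof -
  have 1: "(freq m n has_derivative freq m n) (at z)"
    by (rule bounded_linear_imp_has_derivative[OF bounded_linear_freq])
  have 2: "(exp has_derivative (*) (exp (freq m n z))) (at (freq m n z))"
    using DERIV_exp by (simp add: has_field_derivative_def)
  show ?thesis using diff_chain_at[OF 1 2] by (simp add: char_def[abs_def] o_def mult.commute)
qed

lemma norm_char [simp]: "norm (char m n z) = 1"
  by (simp add: char_def freq_def norm_exp_eq_Re)

lemma char_mult: "char m n z * char m' n' z = char (m + m') (n + n') z"
  by (simp add: char_def exp_add[symmetric] freq_def algebra_simps)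

lemma cnj_char: "cnj (char m n z) = char (- m) (- n) z"
  by (simp add: char_def exp_cnj freq_def algebra_simps)

lemma char_0 [simp]: "char 0 0 z = 1"
  by (simp add: char_def freq_def)

lemma char_periodic: "periodic (char m n)"
proof -
  have "exp (freq m n z + 2 * of_int k * pi * \<i>) = exp (freq m n z)" for z k
    using exp_eq by (metis (no_types, opaque_lifting) of_int_mult of_int_numeral of_real_of_int_eq of_real_mult)
  moreover have "freq m n (z + \<omega>1) = freq m n z + 2 * of_int m * pi * \<i>"
      "freq m n (z + \<omega>2) = freq m n z + 2 * of_int n * pi * \<i>" for z
    by (simp_all add: freq_def algebra_simps)
  ultimately show ?thesis by (simp add: on_torus_def char_def)
qed

text \<open>Every derivative of a character is a multiple of it, so the claim is proved for all multiples at
  once.\<close>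

lemma smooth_char: "smooth_on (char m n) UNIV"
proof -
  have "Ck_on k (\<lambda>z. c * char m n z) UNIV" for k c
  proof (induction k arbitrary: c)
    case 0
    have "continuous_on UNIV (char m n)"
      using has_derivative_continuous[OF char_has_derivative] continuous_at_imp_continuous_on by blast
    then show ?case by (simp add: continuous_on_mult_left)
  next
    case (Suc k)
    show ?case
    proof (rule Ck_on_SucI[OF open_UNIV])
      show "((\<lambda>z. c * char m n z) has_derivative (\<lambda>v. (c * freq m n v) * char m n z)) (at z)" for z
        using has_derivative_mult_right[OF char_has_derivative, of c m n z] by (simp add: mult.assoc)
    qed (rule Suc.IH)
  qed
  from this[of _ 1] show ?thesis by (simp add: smooth_on_def)
qed

lemma dz_char: "dz (char m n) z = symbol m n * char m n z"
  using dz_eq[OF char_has_derivative, of m n z] by (simp add: symbol_def field_simps)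

lemma torus_integral_char:
  assumes "(m, n) \<noteq> (0, 0)"
  shows "integ (char m n) = 0"
proof -
  have "symbol m n * integ (char m n) = integ (dz (char m n))"
    unfolding dz_char[abs_def] torus_integral_cmult ..
  then have "symbol m n * integ (char m n) = 0"
    using torus_integral_dz[OF char_periodic smooth_char] by simp
  then show ?thesis using assms symbol_eq_0[of m n] by auto
qed

subsection \<open>Completeness of the characters\<close>

inductive trig_poly :: "(complex \<Rightarrow> complex) \<Rightarrow> bool" where
  trig_poly_char: "trig_poly (\<lambda>z. c * char m n z)"
| trig_poly_add: "trig_poly f \<Longrightarrow> trig_poly g \<Longrightarrow> trig_poly (\<lambda>z. f z + g z)"

lemma trig_poly_const: "trig_poly (\<lambda>z. c)"
  using trig_poly_char[of c 0 0] by simp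

lemma trig_poly_mult:
  assumes "trig_poly f" "trig_poly g"
  shows "trig_poly (\<lambda>z. f z * g z)"
  using assms(1)
proof induction
  case (trig_poly_char c m n)
  show ?case using assms(2)
  proof induction
    case (trig_poly_char c' m' n')
    have "c * char m n z * (c' * char m' n' z) = (c * c') * char (m + m') (n + n') z" for z
      by (simp add: char_mult[symmetric] mult_ac)
    then show ?case using trig_poly.trig_poly_char[of "c * c'" "m + m'" "n + n'"] by presburger
  qed (simp add: distrib_left trig_poly.trig_poly_add)
qed (simp add: distrib_right trig_poly.trig_poly_add)

lemma trig_poly_continuous: "trig_poly f \<Longrightarrow> continuous_on UNIV f"
  by (induction rule: trig_poly.induct)
     (auto intro!: continuous_intros smooth_on_continuous_on[OF smooth_char])

definition torus_embedding :: "complex \<Rightarrow> complex \<times> complex" where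
  "torus_embedding z = (char 1 0 z, char 0 1 z)"

lemma trig_poly_real_polynomial:
  assumes "real_polynomial_function p"
  shows "trig_poly (\<lambda>z. of_real (p (torus_embedding z)))"
  using assms
proof induction
  case (linear f)
  define c1 c2 where "c1 = (of_real (f (1, 0)) - \<i> * of_real (f (\<i>, 0))) / 2"
    and "c2 = (of_real (f (0, 1)) - \<i> * of_real (f (0, \<i>))) / 2"
  have l: "f (u, v) = Re u * f (1, 0) + Im u * f (\<i>, 0) + Re v * f (0, 1) + Im v * f (0, \<i>)" for u v
  proof -
    have "(u, v) = Re u *\<^sub>R (1, 0) + Im u *\<^sub>R (\<i>, 0) + Re v *\<^sub>R (0, 1) + Im v *\<^sub>R (0, \<i>)"
      by (simp add: complex_eq_iff)
    then have "f (u, v) = f (Re u *\<^sub>R (1, 0) + Im u *\<^sub>R (\<i>, 0) + Re v *\<^sub>R (0, 1) + Im v *\<^sub>R (0, \<i>))"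
      by (rule arg_cong)
    then show ?thesis
      by (simp only: linear_add[OF bounded_linear.linear[OF linear]]
          linear_scale[OF bounded_linear.linear[OF linear]] real_scaleR_def)
  qed
  have "of_real (f (u, v)) = c1 * u + cnj c1 * cnj u + (c2 * v + cnj c2 * cnj v)" for u v
    unfolding l[of u v] c1_def c2_def by (simp add: complex_eq_iff field_simps)
  then have eq: "of_real (f (torus_embedding z)) =
      c1 * char 1 0 z + cnj c1 * char (-1) 0 z + (c2 * char 0 1 z + cnj c2 * char 0 (-1) z)" for z
    by (simp add: torus_embedding_def cnj_char)
  show ?case unfolding eq by (intro trig_poly_add trig_poly_char)
next
  case (const c)
  show ?case by (rule trig_poly_const)
next
  case (add f g)
  then show ?case by (simp add: trig_poly_add)
next
  case (mult f g)
  then show ?case by (simp add: trig_poly_mult)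
qed

lemma torus_embedding_eq:
  assumes "torus_embedding z = torus_embedding w" "periodic d"
  shows "d z = d w"
proof -
  have int: "\<exists>k::int. x = y + of_int k" if "exp (2 * pi * \<i> * of_real x) = exp (2 * pi * \<i> * of_real y)"
    for x y :: real
  proof -
    from that obtain k :: int where "2 * pi * \<i> * of_real x = 2 * pi * \<i> * of_real y + (of_int (2 * k) * pi) * \<i>"
      unfolding exp_eq by blast
    then have "2 * pi * \<i> * of_real x = 2 * pi * \<i> * (of_real (y + of_int k))"
      by (simp add: algebra_simps)
    then show ?thesis by (auto simp del: of_real_add intro!: exI[of _ k])
  qed
  from assms(1) have "exp (2 * pi * \<i> * of_real (coord1 z)) = exp (2 * pi * \<i> * of_real (coord1 w))"
    "exp (2 * pi * \<i> * of_real (coord2 z)) = exp (2 * pi * \<i> * of_real (coord2 w))"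
    by (simp_all add: torus_embedding_def char_def freq_def)
  then obtain k l :: int where "coord1 z = coord1 w + of_int k" "coord2 z = coord2 w + of_int l"
    using int by meson
  then have "of_real (coord1 z) * \<omega>1 + of_real (coord2 z) * \<omega>2
      = (of_real (coord1 w) * \<omega>1 + of_real (coord2 w) * \<omega>2) + of_int k * \<omega>1 + of_int l * \<omega>2"
    by (simp add: algebra_simps)
  then have "z = w + of_int k * \<omega>1 + of_int l * \<omega>2" by (simp only: coord_decomp)
  then show ?thesis using on_torus_multiple[OF assms(2)] by simp
qed

text \<open>The characters of the two basis frequencies embed the torus into \<open>\<complex>\<^sup>2\<close>, and polynomials on \<open>\<complex>\<^sup>2\<close>
  restrict to trigonometric polynomials there; the density is thus an instance of the
  Stone--Weierstrass theorem.\<close>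

lemma trig_poly_dense:
  assumes d: "periodic d" "continuous_on UNIV d" and e: "e > 0"
  obtains g where "trig_poly g" "\<And>z. z \<in> F \<Longrightarrow> norm (d z - g z) < e"
proof -
  define D where "D w = d (SOME z. torus_embedding z = w)" for w
  have D: "D (torus_embedding z) = d z" for z
    unfolding D_def by (rule torus_embedding_eq[OF _ d(1)]) (rule someI, rule refl)
  let ?C = "cball 0 domain_radius"
  let ?K = "torus_embedding ` ?C"
  have ce: "continuous_on S torus_embedding" for S
    unfolding torus_embedding_def
    by (intro continuous_intros continuous_on_subset[OF smooth_on_continuous_on[OF smooth_char]]) auto
  have cd: "continuous_on S d" for S using d(2) continuous_on_subset by blast
  have K: "compact ?K" by (intro compact_continuous_image ce compact_cball)
  \<comment> \<open>The induced function on the embedded torus is continuous because its graph is compact.\<close>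
  have "continuous_on ?K D"
  proof (rule continuous_from_closed_graph)
    show "compact (d ` ?C)" by (intro compact_continuous_image cd compact_cball)
    show "D \<in> ?K \<rightarrow> d ` ?C" using D by auto
    have "(\<lambda>w. (w, D w)) ` ?K = (\<lambda>z. (torus_embedding z, d z)) ` ?C"
      using D by (auto simp: image_iff)
    moreover have "compact ((\<lambda>z. (torus_embedding z, d z)) ` ?C)"
      by (intro compact_continuous_image continuous_on_Pair ce cd compact_cball)
    ultimately show "closed ((\<lambda>w. (w, D w)) ` ?K)" by (simp add: compact_imp_closed)
  qed
  from Stone_Weierstrass_polynomial_function[OF K this e]
  obtain p where p: "polynomial_function p" "\<And>w. w \<in> ?K \<Longrightarrow> norm (D w - p w) < e" by blast
  define g where "g z = of_real (Re (p (torus_embedding z))) + \<i> * of_real (Im (p (torus_embedding z)))" for z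
  have "real_polynomial_function (\<lambda>w. Re (p w))" "real_polynomial_function (\<lambda>w. Im (p w))"
    using p(1) bounded_linear_Re bounded_linear_Im unfolding polynomial_function_def o_def by blast+
  then have "trig_poly g" unfolding g_def
    by (intro trig_poly_add trig_poly_mult trig_poly_const trig_poly_real_polynomial[of "\<lambda>w. Re (p w)"]
        trig_poly_real_polynomial[of "\<lambda>w. Im (p w)"])
  moreover have "norm (d z - g z) < e" if "z \<in> F" for z
  proof -
    have "z \<in> ?C" using that strip_subset_cball fundamental_domain_eq by blast
    then have "norm (D (torus_embedding z) - p (torus_embedding z)) < e" by (intro p(2)) auto
    moreover have "g z = p (torus_embedding z)" by (simp add: g_def complex_eq_iff)
    ultimately show ?thesis by (simp add: D)
  qed
  ultimately show ?thesis using that by blast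
qed

text \<open>Orthogonality to all characters extends to trigonometric polynomials and, by density, to the
  conjugate of \<open>d\<close> itself.\<close>

lemma characters_complete:
  assumes d: "periodic d" "continuous_on UNIV d"
    and orth: "\<And>m n. integ (\<lambda>z. d z * char m n z) = 0"
  shows "d z = 0"
proof -
  have cd: "continuous_on S d" for S using d(2) continuous_on_subset by blast
  have tp: "integ (\<lambda>z. d z * g z) = 0" if "trig_poly g" for g
    using that
  proof induction
    case (trig_poly_char c m n)
    have "(\<lambda>z. d z * (c * char m n z)) = (\<lambda>z. c * (d z * char m n z))" by (simp add: mult_ac)
    then show ?case by (simp only: torus_integral_cmult orth) simp
  next
    case (trig_poly_add f g)
    then show ?case
      by (simp add: distrib_left torus_integral_add continuous_intros cd trig_poly_continuous)
  qed
  obtain B where B: "\<And>z. z \<in> F \<Longrightarrow> norm (d z) \<le> B" "B > 0"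
  proof -
    have "bounded (d ` cball 0 domain_radius)"
      by (intro compact_imp_bounded compact_continuous_image cd compact_cball)
    then obtain B where "B > 0" "\<And>x. x \<in> d ` cball 0 domain_radius \<Longrightarrow> norm x \<le> B"
      by (meson bounded_pos)
    then show ?thesis using that strip_subset_cball fundamental_domain_eq by blast
  qed
  have "norm (integ (\<lambda>z. d z * cnj (d z))) \<le> e" if e: "e > 0" for e
  proof -
    have e': "e / (B * area) > 0" using e B(2) area_pos by simp
    have "periodic (\<lambda>z. cnj (d z))" using d(1) by (simp add: on_torus_def)
    moreover have "continuous_on UNIV (\<lambda>z. cnj (d z))" by (intro continuous_intros d)
    ultimately obtain g where g: "trig_poly g" "\<And>z. z \<in> F \<Longrightarrow> norm (cnj (d z) - g z) < e / (B * area)"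
      using trig_poly_dense[OF _ _ e'] by blast
    have "integ (\<lambda>z. d z * cnj (d z))
        = integ (\<lambda>z. d z * (cnj (d z) - g z) + d z * g z)"
      by (simp add: algebra_simps)
    also have "\<dots> = integ (\<lambda>z. d z * (cnj (d z) - g z))"
      using tp[OF g(1)] by (simp add: torus_integral_add continuous_intros d trig_poly_continuous g)
    finally have eq: "integ (\<lambda>z. d z * cnj (d z)) = integ (\<lambda>z. d z * (cnj (d z) - g z))" .
    have "norm (integ (\<lambda>z. d z * (cnj (d z) - g z))) \<le> (B * (e / (B * area))) * area"
    proof (rule torus_integral_norm_bound)
      show "norm (d z * (cnj (d z) - g z)) \<le> B * (e / (B * area))" if "z \<in> F" for z
        unfolding norm_mult using B g(2)[OF that] that by (intro mult_mono) (auto intro: less_imp_le)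
    qed (intro continuous_intros d trig_poly_continuous g)
    also have "\<dots> = e" using B(2) area_pos by simp
    finally show ?thesis by (simp only: eq)
  qed
  then have zero: "integ (\<lambda>z. d z * cnj (d z)) = 0"
    using field_le_epsilon[of "norm (integ (\<lambda>z. d z * cnj (d z)))" 0] by simp
  let ?p = "(\<omega>1 + \<omega>2) / 2"
  let ?u = "\<lambda>w. (norm (d (w + (z - ?p))))\<^sup>2"
  have "integ ?u = integ (\<lambda>w. (norm (d w))\<^sup>2)"
    using d by (intro torus_integral_translate[of "\<lambda>w. (norm (d w))\<^sup>2"]) (auto simp: on_torus_def intro!: continuous_intros)
  also have "integ (\<lambda>w. (norm (d w))\<^sup>2) = integ (\<lambda>w. Re (d w * cnj (d w)))"
    by (simp add: complex_mult_cnj cmod_power2)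
  also have "\<dots> = 0"
    using zero by (subst torus_integral_Re) (auto intro!: continuous_intros d)
  finally have "integ ?u = 0" .
  moreover have "continuous_on UNIV ?u"
    by (intro continuous_intros continuous_on_compose2[OF d(2)]) auto
  ultimately have "\<not> ?u ?p > 0" using torus_integral_pos[of ?u] by auto
  then show ?thesis by simp
qed

subsection \<open>Rapidly converging Fourier series\<close>

text \<open>The frequencies \<open>\<int> \<times> \<int>\<close> are enumerated by the natural numbers in such a way that the index of
  \<open>(m, n)\<close> and \<open>\<bar>m\<bar> + \<bar>n\<bar>\<close> bound each other polynomially; rapid decay can then be measured in
  terms of the index.\<close>

definition index1 :: "nat \<Rightarrow> int" where "index1 j = int_decode (fst (prod_decode j))"
definition index2 :: "nat \<Rightarrow> int" where "index2 j = int_decode (snd (prod_decode j))"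

lemma index_surj: "\<exists>j. index1 j = m \<and> index2 j = n"
  by (rule exI[of _ "prod_encode (int_encode m, int_encode n)"]) (simp add: index1_def index2_def)

lemma index_inj: "index1 j = index1 k \<Longrightarrow> index2 j = index2 k \<Longrightarrow> j = k"
  unfolding index1_def index2_def
  by (metis int_decode_inverse prod.collapse prod_decode_inverse)

lemma int_encode_bounds: "\<bar>m\<bar> \<le> int (int_encode m)" "int (int_encode m) \<le> 2 * \<bar>m\<bar>"
  by (auto simp: int_encode_def sum_encode_def)

lemma index_bounds:
  "real_of_int (\<bar>index1 j\<bar> + \<bar>index2 j\<bar>) \<le> 2 * real (j + 1)"
  "real (j + 1) \<le> 4 * (1 + of_int (\<bar>index1 j\<bar> + \<bar>index2 j\<bar>))\<^sup>2"
proof -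
  obtain x y where xy: "prod_decode j = (x, y)" by fastforce
  have j: "j = prod_encode (x, y)" by (metis xy prod_decode_inverse)
  have m: "int_encode (index1 j) = x" "int_encode (index2 j) = y"
    by (simp_all add: index1_def index2_def xy)
  have "x \<le> j" "y \<le> j" unfolding j by (rule le_prod_encode_1 le_prod_encode_2)+
  then have ij: "int x \<le> int j" "int y \<le> int j" by (simp_all only: of_nat_le_iff)
  have b: "\<bar>index1 j\<bar> \<le> int x" "\<bar>index2 j\<bar> \<le> int y"
    unfolding m[symmetric] by (rule int_encode_bounds)+
  note a = order_trans[OF b(1) ij(1)] order_trans[OF b(2) ij(2)]
  have "\<bar>index1 j\<bar> + \<bar>index2 j\<bar> \<le> int j + int j"
    by (rule add_mono[OF a])
  also have "\<dots> \<le> 2 * (int j + 1)" by simp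
  finally have "\<bar>index1 j\<bar> + \<bar>index2 j\<bar> \<le> 2 * (int j + 1)" .
  then show "real_of_int (\<bar>index1 j\<bar> + \<bar>index2 j\<bar>) \<le> 2 * real (j + 1)"
    using of_int_le_iff[where 'a = real, of "\<bar>index1 j\<bar> + \<bar>index2 j\<bar>" "2 * (int j + 1)"] by simp
  define s where "s = \<bar>index1 j\<bar> + \<bar>index2 j\<bar>"
  have s: "int (x + y) \<le> 2 * s" "s \<ge> 0"
    using int_encode_bounds(2)[of "index1 j"] int_encode_bounds(2)[of "index2 j"] m by (auto simp: s_def)
  have "2 * triangle a = a * (a + 1)" for a by (induction a) auto
  then have "2 * prod_encode (x, y) = (x + y) * (x + y + 1) + 2 * x" by (simp add: prod_encode_def)
  then have "2 * j = (x + y) * (x + y + 1) + 2 * x" by (simp only: j[symmetric])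
  also have "\<dots> \<le> (x + y) * (x + y + 3)" by (simp add: algebra_simps)
  finally have "int (2 * j) \<le> int ((x + y) * (x + y + 3))" by (simp only: of_nat_le_iff)
  also have "\<dots> = int (x + y) * (int (x + y) + 3)" by simp
  also have "\<dots> \<le> (2 * s) * (2 * s + 3)" using s by (intro mult_mono) auto
  finally have "int j + 1 \<le> 4 * (1 + s)\<^sup>2" using s(2) by (simp add: power2_eq_square algebra_simps)
  then have "real_of_int (int j + 1) \<le> real_of_int (4 * (1 + s)\<^sup>2)" by (simp only: of_int_le_iff)
  then show "real (j + 1) \<le> 4 * (1 + of_int (\<bar>index1 j\<bar> + \<bar>index2 j\<bar>))\<^sup>2" by (simp add: s_def)
qed

abbreviation (input) e :: "nat \<Rightarrow> complex \<Rightarrow> complex" where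
  "e j \<equiv> char (index1 j) (index2 j)"
abbreviation (input) lam :: "nat \<Rightarrow> complex \<Rightarrow> complex" where
  "lam j \<equiv> freq (index1 j) (index2 j)"
abbreviation (input) mu :: "nat \<Rightarrow> complex" where
  "mu j \<equiv> symbol (index1 j) (index2 j)"

definition rapid :: "(nat \<Rightarrow> complex) \<Rightarrow> bool" where
  "rapid a \<longleftrightarrow> (\<forall>r. \<exists>C. \<forall>j. norm (a j) * real (j + 1) ^ r \<le> C)"

definition fourier_series :: "(nat \<Rightarrow> complex) \<Rightarrow> complex \<Rightarrow> complex" where
  "fourier_series a z = (\<Sum>j. a j * e j z)"

lemma rapid_summable:
  assumes "rapid a"
  shows "summable (\<lambda>j. norm (a j) * real (j + 1))"
proof -
  obtain C where C: "\<And>j. norm (a j) * real (j + 1) ^ 3 \<le> C" using assms unfolding rapid_def by blast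
  have "summable (\<lambda>j. C * inverse (real (j + 1) ^ 2))"
    using inverse_squares_sums[THEN sums_summable] by (intro summable_mult) (simp add: inverse_eq_divide add.commute)
  then show ?thesis
  proof (rule summable_comparison_test'[where N = 0])
    fix j
    have "norm (a j) * real (j + 1) * real (j + 1) ^ 2 \<le> C" using C[of j] by (simp add: power_numeral_reduce mult_ac)
    then show "norm (norm (a j) * real (j + 1)) \<le> C * inverse (real (j + 1) ^ 2)"
      by (simp add: field_simps)
  qed
qed

lemma rapid_summable_norm:
  assumes "rapid a"
  shows "summable (\<lambda>j. norm (a j))"
proof (rule summable_comparison_test'[OF rapid_summable[OF assms], where N = 0])
  fix j
  have "norm (a j) * 1 \<le> norm (a j) * real (j + 1)" by (intro mult_left_mono) auto
  then show "norm (norm (a j)) \<le> norm (a j) * real (j + 1)" by simp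
qed

lemma rapid_mult:
  assumes "rapid a" "\<And>j. norm (b j) \<le> K * real (j + 1)"
  shows "rapid (\<lambda>j. a j * b j)"
  unfolding rapid_def
proof
  fix r
  obtain C where C: "\<And>j. norm (a j) * real (j + 1) ^ Suc r \<le> C" using assms(1) unfolding rapid_def by blast
  have "norm (b 0) \<le> K" using assms(2)[of 0] by simp
  then have K: "K \<ge> 0" using norm_ge_zero order_trans by blast
  have "norm (a j * b j) * real (j + 1) ^ r \<le> K * C" for j
  proof -
    have "norm (a j * b j) * real (j + 1) ^ r \<le> norm (a j) * (K * real (j + 1)) * real (j + 1) ^ r"
      unfolding norm_mult by (intro mult_right_mono mult_left_mono assms(2)) auto
    also have "\<dots> = K * (norm (a j) * real (j + 1) ^ Suc r)" by simp
    also have "\<dots> \<le> K * C" using K by (intro mult_left_mono C)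
    finally show ?thesis .
  qed
  then show "\<exists>C. \<forall>j. norm (a j * b j) * real (j + 1) ^ r \<le> C" by blast
qed

lemma freq_growth: "norm (lam j v) \<le> (4 * pi * (\<bar>coord1 v\<bar> + \<bar>coord2 v\<bar>)) * real (j + 1)"
proof -
  let ?m = "\<bar>of_int (index1 j)\<bar> :: real" and ?n = "\<bar>of_int (index2 j)\<bar> :: real"
  have "\<bar>of_int (index1 j) * coord1 v + of_int (index2 j) * coord2 v\<bar> \<le> ?m * \<bar>coord1 v\<bar> + ?n * \<bar>coord2 v\<bar>"
    by (metis abs_mult abs_triangle_ineq)
  also have "\<dots> \<le> (?m + ?n) * (\<bar>coord1 v\<bar> + \<bar>coord2 v\<bar>)" by (simp add: algebra_simps)
  also have "\<dots> \<le> (2 * real (j + 1)) * (\<bar>coord1 v\<bar> + \<bar>coord2 v\<bar>)"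
    using index_bounds(1)[of j] by (intro mult_right_mono) auto
  finally have "(2 * pi) * \<bar>of_int (index1 j) * coord1 v + of_int (index2 j) * coord2 v\<bar>
      \<le> (2 * pi) * ((2 * real (j + 1)) * (\<bar>coord1 v\<bar> + \<bar>coord2 v\<bar>))"
    by (intro mult_left_mono) auto
  also have "\<dots> = (4 * pi * (\<bar>coord1 v\<bar> + \<bar>coord2 v\<bar>)) * real (j + 1)" by simp
  finally show ?thesis unfolding norm_freq .
qed

lemma rapid_freq: "rapid a \<Longrightarrow> rapid (\<lambda>j. a j * lam j v)"
  by (rule rapid_mult[OF _ freq_growth])

lemma fourier_series_summable: "rapid a \<Longrightarrow> summable (\<lambda>j. a j * e j z)"
  by (rule summable_norm_cancel) (simp add: norm_mult rapid_summable_norm)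

text \<open>The estimate is uniform over all series with a common majorant up to the factor \<open>K\<close>. It gives
  both the uniform convergence of the differentiated Fourier series, where \<open>K\<close> contains the norm
  of the direction, and its integration term by term.\<close>

lemma series_tail:
  assumes "summable c" "\<And>j::nat. 0 \<le> c j" "\<epsilon> > 0"
  shows "\<forall>\<^sub>F n in sequentially. \<forall>b::nat \<Rightarrow> complex. \<forall>K\<ge>0. (\<forall>j. norm (b j) \<le> K * c j) \<longrightarrow>
    norm (sum b {..<n} - suminf b) \<le> \<epsilon> * K"
proof -
  have "(\<lambda>n. suminf (\<lambda>j. c (j + n))) \<longlonglongrightarrow> 0" by (rule suminf_exist_split2[OF assms(1)])
  then have "\<forall>\<^sub>F n in sequentially. suminf (\<lambda>j. c (j + n)) < \<epsilon>"
    using assms(3) order_tendstoD(2) by blast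
  then show ?thesis
  proof (rule eventually_mono, intro allI impI)
    fix n and b :: "nat \<Rightarrow> complex" and K :: real
    assume n: "suminf (\<lambda>j. c (j + n)) < \<epsilon>" and K: "K \<ge> 0" and b: "\<forall>j. norm (b j) \<le> K * c j"
    have sc: "summable (\<lambda>j. K * c (j + n))"
      by (intro summable_mult summable_ignore_initial_segment assms)
    have sb: "summable b"
      by (rule summable_comparison_test'[OF summable_mult[OF assms(1), of K], where N = 0]) (use b in auto)
    have "norm (sum b {..<n} - suminf b) = norm (suminf (\<lambda>j. b (j + n)))"
      using suminf_minus_initial_segment[OF sb, of n] by (simp add: norm_minus_commute)
    also have "\<dots> \<le> suminf (\<lambda>j. K * c (j + n))" using b by (intro norm_suminf_le sc) auto
    also have "\<dots> = K * suminf (\<lambda>j. c (j + n))"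
      by (intro suminf_mult summable_ignore_initial_segment assms)
    also have "\<dots> \<le> \<epsilon> * K" using n K by (simp add: mult.commute mult_left_mono)
    finally show "norm (sum b {..<n} - suminf b) \<le> \<epsilon> * K" .
  qed
qed

lemma fourier_series_has_derivative:
  assumes "rapid a"
  shows "(fourier_series a has_derivative (\<lambda>v. fourier_series (\<lambda>j. a j * lam j v) z)) (at z)"
proof -
  let ?f = "\<lambda>j z. a j * e j z" and ?f' = "\<lambda>j z v. a j * lam j v * e j z"
  obtain K where K: "K > 0" "\<And>j v. norm (lam j v) \<le> K * norm v * real (j + 1)"
  proof -
    have "bounded_linear (\<lambda>v. coord1 v)" "bounded_linear (\<lambda>v. coord2 v)"
    proof -
      have "linear coord1" "linear coord2"
        using coord_scale by (auto intro!: linearI simp: scaleR_conv_of_real)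
      then show "bounded_linear (\<lambda>v. coord1 v)" "bounded_linear (\<lambda>v. coord2 v)"
        by (simp_all add: linear_conv_bounded_linear)
    qed
    then obtain K1 K2 where K12: "\<And>v. norm (coord1 v) \<le> norm v * K1" "K1 > 0" "\<And>v. norm (coord2 v) \<le> norm v * K2" "K2 > 0"
      using bounded_linear.pos_bounded by metis
    have "norm (lam j v) \<le> (4 * pi * (K1 + K2)) * norm v * real (j + 1)" for j v
    proof -
      have "(4 * pi * (\<bar>coord1 v\<bar> + \<bar>coord2 v\<bar>)) * real (j + 1) \<le> (4 * pi * (norm v * K1 + norm v * K2)) * real (j + 1)"
        using K12(1,3)[of v] by (intro mult_right_mono mult_left_mono add_mono) auto
      also have "\<dots> = (4 * pi * (K1 + K2)) * norm v * real (j + 1)" by (simp add: algebra_simps)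
      finally show ?thesis using freq_growth[of j v] by linarith
    qed
    then show ?thesis using that[of "4 * pi * (K1 + K2)"] K12 by simp
  qed
  have "\<exists>g. \<forall>x\<in>UNIV. (\<lambda>n. ?f n x) sums g x \<and>
      (g has_derivative (\<lambda>v. fourier_series (\<lambda>j. a j * lam j v) x)) (at x within UNIV)"
  proof (rule has_derivative_series)
    show "(?f n has_derivative ?f' n x) (at x within UNIV)" for n x
      using has_derivative_mult_right[OF char_has_derivative, of "a n" "index1 n" "index2 n" x]
      by (simp add: mult.assoc)
    show "(\<lambda>n. ?f n 0) sums fourier_series a 0"
      unfolding fourier_series_def by (rule summable_sums[OF fourier_series_summable[OF assms]])
    fix \<epsilon> :: real assume \<epsilon>: "\<epsilon> > 0"
    have "\<epsilon> / K > 0" using \<epsilon> K(1) by simp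
    moreover have "0 \<le> norm (a j) * real (j + 1)" for j by simp
    ultimately have "\<forall>\<^sub>F n in sequentially. \<forall>b :: nat \<Rightarrow> complex. \<forall>L\<ge>0.
        (\<forall>j. norm (b j) \<le> L * (norm (a j) * real (j + 1))) \<longrightarrow> norm (sum b {..<n} - suminf b) \<le> \<epsilon> / K * L"
      by (intro series_tail[OF rapid_summable[OF assms]])
    then
    show "\<forall>\<^sub>F n in sequentially. \<forall>x\<in>UNIV. \<forall>h. norm ((\<Sum>i<n. ?f' i x h)
        - fourier_series (\<lambda>j. a j * lam j h) x) \<le> \<epsilon> * norm h"
    proof (rule eventually_mono)
      fix n
      assume *: "\<forall>b :: nat \<Rightarrow> complex. \<forall>L\<ge>0. (\<forall>j. norm (b j) \<le> L * (norm (a j) * real (j + 1))) \<longrightarrow>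
          norm (sum b {..<n} - suminf b) \<le> \<epsilon> / K * L"
      have "norm ((\<Sum>i<n. ?f' i x h) - fourier_series (\<lambda>j. a j * lam j h) x) \<le> \<epsilon> / K * (K * norm h)" for x h
        unfolding fourier_series_def
      proof (rule *[rule_format])
        show "norm (?f' j x h) \<le> (K * norm h) * (norm (a j) * real (j + 1))" for j
        proof -
          have "norm (?f' j x h) = norm (a j) * norm (lam j h)" by (simp add: norm_mult)
          also have "\<dots> \<le> norm (a j) * (K * norm h * real (j + 1))" by (intro mult_left_mono K(2)) auto
          finally show ?thesis by (simp add: mult_ac)
        qed
      qed (use K(1) in auto)
      then show "\<forall>x\<in>UNIV. \<forall>h. norm ((\<Sum>i<n. ?f' i x h)
        - fourier_series (\<lambda>j. a j * lam j h) x) \<le> \<epsilon> * norm h" using K(1) by simp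
    qed
  qed auto
  then obtain g where g: "\<And>x. (\<lambda>n. ?f n x) sums g x"
    "\<And>x. (g has_derivative (\<lambda>v. fourier_series (\<lambda>j. a j * lam j v) x)) (at x)" by auto
  have "g = fourier_series a" using sums_unique[OF g(1)] by (auto simp: fourier_series_def)
  then show ?thesis using g(2) by simp
qed

lemma fourier_series_smooth:
  assumes "rapid a"
  shows "smooth_on (fourier_series a) UNIV"
proof -
  have "rapid a \<Longrightarrow> Ck_on k (fourier_series a) UNIV" for k a
  proof (induction k arbitrary: a)
    case 0
    then show ?case
      using has_derivative_continuous[OF fourier_series_has_derivative]
      by (auto intro!: continuous_at_imp_continuous_on)
  next
    case (Suc k)
    show ?case
      by (rule Ck_on_SucI[OF open_UNIV fourier_series_has_derivative[OF Suc.prems]])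
         (rule Suc.IH[OF rapid_freq[OF Suc.prems]])
  qed
  then show ?thesis using assms by (simp add: smooth_on_def)
qed

lemma fourier_series_periodic: "periodic (fourier_series a)"
  using char_periodic by (simp add: on_torus_def fourier_series_def)

lemma dz_fourier_series:
  assumes "rapid a"
  shows "dz (fourier_series a) z = fourier_series (\<lambda>j. a j * mu j) z"
proof -
  have s: "(\<lambda>j. a j * lam j v * e j z) sums fourier_series (\<lambda>j. a j * lam j v) z" for v
    unfolding fourier_series_def by (rule summable_sums[OF fourier_series_summable[OF rapid_freq[OF assms]]])
  have "(\<lambda>j. (a j * lam j 1 * e j z - \<i> * (a j * lam j \<i> * e j z)) / 2) sums
      ((fourier_series (\<lambda>j. a j * lam j 1) z - \<i> * fourier_series (\<lambda>j. a j * lam j \<i>) z) / 2)"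
    by (intro sums_divide sums_diff sums_mult s)
  moreover have "(a j * lam j 1 * e j z - \<i> * (a j * lam j \<i> * e j z)) / 2 = a j * mu j * e j z" for j
    by (simp add: symbol_def field_simps)
  ultimately show ?thesis
    unfolding dz_eq[OF fourier_series_has_derivative[OF assms]] fourier_series_def[of "\<lambda>j. a j * mu j"]
    by (simp add: sums_iff)
qed

definition fourier_coeff :: "(complex \<Rightarrow> complex) \<Rightarrow> nat \<Rightarrow> complex" where
  "fourier_coeff h j = integ (\<lambda>z. h z * cnj (e j z)) / of_real area"

lemma continuous_char: "continuous_on S (char m n)"
  using smooth_on_continuous_on[OF smooth_char] continuous_on_subset by blast

lemma fourier_coeff_dz:
  assumes h: "periodic h" "smooth_on h UNIV"
  shows "fourier_coeff (dz h) j = mu j * fourier_coeff h j"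
proof -
  let ?e' = "char (- index1 j) (- index2 j)"
  have sm: "symbol (- index1 j) (- index2 j) = - mu j" using symbol_diff[of 0 _ 0] symbol_diff[of 0 0 0 0] by simp
  have ch: "continuous_on UNIV h" "continuous_on UNIV (dz h)"
    using h(2) smooth_on_dz[OF h(2)] by (auto intro: smooth_on_continuous_on)
  have "dz (\<lambda>z. h z * ?e' z) = (\<lambda>z. dz h z * ?e' z - mu j * (h z * ?e' z))"
    by (rule ext) (simp add: dz_mult[OF h(2) smooth_char] dz_char sm)
  moreover have "integ (dz (\<lambda>z. h z * ?e' z)) = 0"
    using h char_periodic by (intro torus_integral_dz smooth_on_mult smooth_char open_UNIV) (auto simp: on_torus_def)
  ultimately have "integ (\<lambda>z. dz h z * ?e' z) = mu j * integ (\<lambda>z. h z * ?e' z)"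
    by (simp add: torus_integral_diff torus_integral_cmult continuous_intros ch continuous_char)
  then show ?thesis by (simp add: fourier_coeff_def cnj_char)
qed

lemma fourier_coeff_bound:
  assumes "continuous_on UNIV h"
  shows "\<exists>C. \<forall>j. norm (fourier_coeff h j) \<le> C"
proof -
  have "bounded (h ` cball 0 domain_radius)"
    by (intro compact_imp_bounded compact_continuous_image compact_cball continuous_on_subset[OF assms]) auto
  then obtain B where "\<And>x. x \<in> h ` cball 0 domain_radius \<Longrightarrow> norm x \<le> B" by (meson bounded_pos)
  then have B: "norm (h z) \<le> B" if "z \<in> F" for z
    using that strip_subset_cball fundamental_domain_eq by blast
  have "norm (fourier_coeff h j) \<le> B" for j
  proof -
    have "norm (integ (\<lambda>z. h z * cnj (e j z))) \<le> B * area"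
      using B by (intro torus_integral_norm_bound) (auto simp: norm_mult intro!: continuous_intros assms continuous_char)
    then show ?thesis using area_pos by (simp add: fourier_coeff_def norm_divide field_simps)
  qed
  then show ?thesis by blast
qed

lemma fourier_coeff_iterated_bound:
  assumes h: "periodic h" "smooth_on h UNIV"
  shows "\<exists>C. \<forall>j. norm (mu j) ^ r * norm (fourier_coeff h j) \<le> C"
  using h
proof (induction r arbitrary: h)
  case 0
  then show ?case using fourier_coeff_bound smooth_on_continuous_on by fastforce
next
  case (Suc r)
  from Suc.IH[OF on_torus_dz[OF Suc.prems] smooth_on_dz[OF Suc.prems(2)]]
  show ?case unfolding fourier_coeff_dz[OF Suc.prems] by (simp add: norm_mult mult_ac)
qed

text \<open>Smooth functions have rapidly decaying coefficients, because \<open>\<partial>\<close> multiplies the coefficients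
  by \<open>mu\<close>, which grows at least linearly in the frequency.\<close>

lemma rapid_fourier_coeff:
  assumes h: "periodic h" "smooth_on h UNIV"
  shows "rapid (fourier_coeff h)"
  unfolding rapid_def
proof
  fix r
  obtain C0 where C0: "\<And>j. norm (fourier_coeff h j) \<le> C0"
    using fourier_coeff_bound smooth_on_continuous_on[OF h(2)] by blast
  obtain C1 where C1: "\<And>j. norm (mu j) ^ (2 * r) * norm (fourier_coeff h j) \<le> C1"
    using fourier_coeff_iterated_bound[OF h] by blast
  let ?K = "domain_radius"
  have K: "?K \<ge> 0" by (simp add: domain_radius_def)
  have "norm (fourier_coeff h j) * real (j + 1) ^ r \<le> 16 ^ r * (C0 + ?K ^ (2 * r) * C1)" for j
  proof -
    define s x where "s = real_of_int (\<bar>index1 j\<bar> + \<bar>index2 j\<bar>)" and "x = ?K * norm (mu j)"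
    have sx: "0 \<le> s" "s \<le> x" using symbol_lower_bound[of "index1 j" "index2 j"] by (auto simp: s_def x_def)
    have "real (j + 1) ^ r \<le> (4 * (1 + s)\<^sup>2) ^ r"
      using index_bounds(2)[of j] by (intro power_mono) (auto simp: s_def)
    also have "\<dots> \<le> (4 * (1 + x)\<^sup>2) ^ r" using sx by (intro power_mono mult_left_mono) auto
    also have "\<dots> = 4 ^ r * (1 + x) ^ (2 * r)" by (simp add: power_mult_distrib power_mult)
    also have "(1 + x) ^ (2 * r) \<le> (2 * max 1 x) ^ (2 * r)" using sx by (intro power_mono) auto
    also have "\<dots> = 4 ^ r * (max 1 x) ^ (2 * r)" by (simp add: power_mult_distrib power_mult)
    also have "(max 1 x) ^ (2 * r) \<le> 1 + x ^ (2 * r)" using sx by (auto simp: max_def)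
    finally have "real (j + 1) ^ r \<le> 4 ^ r * (4 ^ r * (1 + x ^ (2 * r)))" by simp
    also have "\<dots> = 16 ^ r * (1 + x ^ (2 * r))" by (simp add: power_mult_distrib[symmetric] mult.assoc[symmetric])
    finally have "norm (fourier_coeff h j) * real (j + 1) ^ r \<le> norm (fourier_coeff h j) * (16 ^ r * (1 + x ^ (2 * r)))"
      by (intro mult_left_mono) auto
    also have "\<dots> = 16 ^ r * (norm (fourier_coeff h j) + ?K ^ (2 * r) * (norm (mu j) ^ (2 * r) * norm (fourier_coeff h j)))"
      by (simp add: x_def power_mult_distrib algebra_simps)
    also have "\<dots> \<le> 16 ^ r * (C0 + ?K ^ (2 * r) * C1)"
      using K by (intro mult_left_mono add_mono C0 C1) auto
    finally show ?thesis .
  qed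
  then show "\<exists>C. \<forall>j. norm (fourier_coeff h j) * real (j + 1) ^ r \<le> C" by blast
qed

lemma fourier_coeff_series:
  assumes "rapid a"
  shows "fourier_coeff (fourier_series a) k = a k"
proof -
  let ?I = "\<lambda>j. integ (\<lambda>z. a j * e j z * cnj (e k z))"
  let ?L = "integ (\<lambda>z. fourier_series a z * cnj (e k z))"
  have cs: "continuous_on UNIV (fourier_series a)"
    by (rule smooth_on_continuous_on[OF fourier_series_smooth[OF assms]])
  have I: "?I j = (if j = k then of_real area * a k else 0)" for j
  proof -
    have "(\<lambda>z. a j * e j z * cnj (e k z)) = (\<lambda>z. a j * char (index1 j - index1 k) (index2 j - index2 k) z)"
      by (simp add: cnj_char char_mult mult.assoc)
    then have "?I j = a j * integ (char (index1 j - index1 k) (index2 j - index2 k))"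
      by (simp only: torus_integral_cmult)
    moreover have "integ (char (index1 j - index1 k) (index2 j - index2 k)) = 0" if "j \<noteq> k"
      using index_inj[of j k] that by (intro torus_integral_char) auto
    moreover have "integ (char 0 0) = of_real area"
    proof -
      have "char 0 0 = (\<lambda>z. 1)" by auto
      then show ?thesis using torus_integral_const[of 1] by simp
    qed
    ultimately show ?thesis by simp
  qed
  have "?I sums ?L"
    unfolding sums_def LIMSEQ_iff
  proof (intro allI impI)
    fix \<epsilon> :: real assume \<epsilon>: "\<epsilon> > 0"
    have "\<epsilon> / (2 * area) > 0" using \<epsilon> area_pos by simp
    from series_tail[OF rapid_summable_norm[OF assms] norm_ge_zero this]
    obtain N where N: "\<And>n (b :: nat \<Rightarrow> complex) L. n \<ge> N \<Longrightarrow> L \<ge> 0 \<Longrightarrow> (\<And>j. norm (b j) \<le> L * norm (a j)) \<Longrightarrow>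
        norm (sum b {..<n} - suminf b) \<le> \<epsilon> / (2 * area) * L"
      unfolding eventually_sequentially by blast
    have "norm (sum ?I {..<n} - ?L) < \<epsilon>" if n: "n \<ge> N" for n
    proof -
      let ?P = "\<lambda>z. (\<Sum>j<n. a j * e j z) * cnj (e k z)"
      have sum: "sum ?I {..<m} = integ (\<lambda>z. (\<Sum>j<m. a j * e j z) * cnj (e k z))" for m
      proof (induction m)
        case 0
        show ?case by (simp add: torus_integral_def)
      next
        case (Suc m)
        then show ?case
          by (simp add: distrib_right torus_integral_add continuous_intros continuous_char)
      qed
      have "sum ?I {..<n} - ?L = integ (\<lambda>z. ?P z - fourier_series a z * cnj (e k z))"
        unfolding sum by (simp add: torus_integral_diff continuous_intros continuous_char cs)
      moreover have "norm (integ (\<lambda>z. ?P z - fourier_series a z * cnj (e k z))) \<le> (\<epsilon> / (2 * area)) * area"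
      proof (rule torus_integral_norm_bound)
        show "continuous_on UNIV (\<lambda>z. ?P z - fourier_series a z * cnj (e k z))"
          by (intro continuous_intros continuous_char cs)
        show "norm (?P z - fourier_series a z * cnj (e k z)) \<le> \<epsilon> / (2 * area)" for z
        proof -
          have "norm (?P z - fourier_series a z * cnj (e k z)) = norm ((\<Sum>j<n. a j * e j z) - fourier_series a z)"
            by (simp add: left_diff_distrib[symmetric] norm_mult)
          also have "\<dots> \<le> \<epsilon> / (2 * area) * 1"
            unfolding fourier_series_def using n by (intro N) (auto simp: norm_mult)
          finally show ?thesis by simp
        qed
      qed
      moreover have "(\<epsilon> / (2 * area)) * area < \<epsilon>" using \<epsilon> area_pos by simp
      ultimately show ?thesis by simp
    qed
    then show "\<exists>N. \<forall>n\<ge>N. norm (sum ?I {..<n} - ?L) < \<epsilon>" by blast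
  qed
  moreover have "?I sums (of_real area * a k)"
    using sums_single[of k "\<lambda>j. of_real area * a k"] unfolding I .
  ultimately have "?L = of_real area * a k" by (rule sums_unique2)
  then show ?thesis using area_pos by (simp add: fourier_coeff_def)
qed

lemma fourier_inversion:
  assumes h: "periodic h" "smooth_on h UNIV"
  shows "fourier_series (fourier_coeff h) z = h z"
proof -
  let ?s = "fourier_series (fourier_coeff h)"
  have ch: "continuous_on UNIV h" "continuous_on UNIV ?s"
    using h(2) fourier_series_smooth[OF rapid_fourier_coeff[OF h]] by (auto intro: smooth_on_continuous_on)
  have "?s z - h z = 0"
  proof (rule characters_complete[where d = "\<lambda>z. ?s z - h z"])
    show "periodic (\<lambda>z. ?s z - h z)"
      using h(1) fourier_series_periodic by (simp add: on_torus_def)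
    show "continuous_on UNIV (\<lambda>z. ?s z - h z)" by (intro continuous_intros ch)
    fix m n
    obtain j where j: "index1 j = - m" "index2 j = - n" using index_surj by blast
    have "fourier_coeff ?s j = fourier_coeff h j" by (rule fourier_coeff_series[OF rapid_fourier_coeff[OF h]])
    then have "integ (\<lambda>z. ?s z * char m n z) = integ (\<lambda>z. h z * char m n z)"
      using area_pos by (simp add: fourier_coeff_def cnj_char j)
    then show "integ (\<lambda>z. (?s z - h z) * char m n z) = 0"
      by (simp add: left_diff_distrib torus_integral_diff continuous_intros ch continuous_char)
  qed
  then show ?thesis by simp
qed

text \<open>Dividing the coefficients by \<open>mu\<close> solves \<open>\<partial>u = g\<close>: \<open>mu\<close> vanishes at frequency zero only, where
  the coefficient of \<open>g\<close> vanishes too, and is bounded below elsewhere.\<close>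

lemma dz_equation_solvable:
  assumes g: "periodic g" "smooth_on g UNIV" and mean: "integ g = 0"
  obtains u where "periodic u" "smooth_on u UNIV" "dz u = g"
proof -
  let ?a = "\<lambda>j. fourier_coeff g j * inverse (mu j)"
  have "rapid ?a"
  proof (rule rapid_mult[OF rapid_fourier_coeff[OF g], where K = domain_radius])
    fix j
    have K: "domain_radius \<ge> 0" by (simp add: domain_radius_def)
    have "norm (inverse (mu j)) \<le> domain_radius"
    proof (cases "mu j = 0")
      case False
      then have "\<not> (index1 j = 0 \<and> index2 j = 0)" by (auto simp: symbol_def freq_def)
      then have "1 \<le> \<bar>index1 j\<bar> + \<bar>index2 j\<bar>" by linarith
      then have "1 \<le> real_of_int (\<bar>index1 j\<bar> + \<bar>index2 j\<bar>)" by linarith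
      then have "1 \<le> domain_radius * norm (mu j)" using symbol_lower_bound order_trans by blast
      moreover have "norm (mu j) > 0" using False by simp
      ultimately show ?thesis unfolding norm_inverse[of "mu j"] inverse_eq_divide[of "norm (mu j)"] by (simp only: pos_divide_le_eq)
    qed (simp add: K)
    also have "\<dots> \<le> domain_radius * real (j + 1)" using K by (simp add: distrib_left)
    finally show "norm (inverse (mu j)) \<le> domain_radius * real (j + 1)" .
  qed
  note u = fourier_series_periodic[of ?a] fourier_series_smooth[OF this] dz_fourier_series[OF this]
  have "?a j * mu j = fourier_coeff g j" for j
  proof (cases "mu j = 0")
    case True
    then have 0: "index1 j = 0" "index2 j = 0" using symbol_eq_0 by auto
    then have "fourier_coeff g j = 0" using mean by (simp add: fourier_coeff_def)
    then show ?thesis by simp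
  qed simp
  then have "(\<lambda>j. ?a j * mu j) = fourier_coeff g" by blast
  then have "dz (fourier_series ?a) z = g z" for z
    unfolding u(3) using fourier_inversion[OF g] by simp
  then have "dz (fourier_series ?a) = g" by blast
  then show ?thesis using that u by blast
qed

lemma dz_equation_unique:
  assumes u: "periodic u" "smooth_on u UNIV" and "dz u = (\<lambda>p. 0)" "integ u = 0"
  shows "u p = 0"
proof -
  have "fourier_coeff u j = 0" for j
  proof (cases "mu j = 0")
    case True
    then have "index1 j = 0" "index2 j = 0" using symbol_eq_0 by auto
    then show ?thesis using assms(4) by (simp add: fourier_coeff_def)
  next
    case False
    have "mu j * fourier_coeff u j = fourier_coeff (\<lambda>p. 0) j"
      using fourier_coeff_dz[OF u, of j] assms(3) by simp
    then show ?thesis using False by (simp add: fourier_coeff_def torus_integral_def)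
  qed
  then show ?thesis using fourier_inversion[OF u, of p] by (simp add: fourier_series_def)
qed

end

section \<open>Complexified Lorentz space\<close>

lemma lorentz_sym: "lorentz v w = lorentz w v"
  by (simp add: lorentz_def mult.commute)

lemma lorentz_add_left: "lorentz (u + v) w = lorentz u w + lorentz v w"
  by (simp add: lorentz_def algebra_simps sum.distrib)

lemma lorentz_add_right: "lorentz w (u + v) = lorentz w u + lorentz w v"
  by (simp add: lorentz_def algebra_simps sum.distrib)

lemma lorentz_diff_left: "lorentz (u - v) w = lorentz u w - lorentz v w"
  by (simp add: lorentz_def algebra_simps sum_subtractf)

lemma lorentz_diff_right: "lorentz w (u - v) = lorentz w u - lorentz w v"
  by (simp add: lorentz_def algebra_simps sum_subtractf)

lemma lorentz_zero [simp]: "lorentz 0 w = 0" "lorentz w 0 = 0"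
  by (simp_all add: lorentz_def)

lemma lorentz_scale_left: "lorentz (a *\<^sub>L v) w = a * lorentz v w"
  by (simp add: lorentz_def scale_clor_def algebra_simps sum_distrib_left)

lemma lorentz_scale_right: "lorentz w (a *\<^sub>L v) = a * lorentz w v"
  by (simp add: lorentz_def scale_clor_def algebra_simps sum_distrib_left)

lemmas lorentz_linear = lorentz_add_left lorentz_add_right lorentz_diff_left lorentz_diff_right
  lorentz_scale_left lorentz_scale_right

lemma cnj_lorentz: "cnj (lorentz v w) = lorentz (cnj_clor v) (cnj_clor w)"
  by (simp add: lorentz_def cnj_clor_def)

lemma clor_eq_iff: "v = w \<longleftrightarrow> fst v = fst w \<and> (\<forall>k. snd v $ k = snd w $ k)"
  by (simp add: prod_eq_iff vec_eq_iff)

lemma scale_clor_simps: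
  "a *\<^sub>L (v + w) = a *\<^sub>L v + a *\<^sub>L w" "a *\<^sub>L (v - w) = a *\<^sub>L v - a *\<^sub>L w"
  "(a + b) *\<^sub>L v = a *\<^sub>L v + b *\<^sub>L v" "(a - b) *\<^sub>L v = a *\<^sub>L v - b *\<^sub>L v"
  "a *\<^sub>L b *\<^sub>L v = (a * b) *\<^sub>L v" "1 *\<^sub>L v = v" "0 *\<^sub>L v = 0" "a *\<^sub>L 0 = 0" "(- a) *\<^sub>L v = - (a *\<^sub>L v)"
  by (simp_all add: clor_eq_iff scale_clor_def algebra_simps)

lemma cnj_clor_simps [simp]:
  "cnj_clor (v + w) = cnj_clor v + cnj_clor w" "cnj_clor (v - w) = cnj_clor v - cnj_clor w"
  "cnj_clor (a *\<^sub>L v) = cnj a *\<^sub>L cnj_clor v" "cnj_clor (cnj_clor v) = v" "cnj_clor 0 = 0"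
  by (simp_all add: clor_eq_iff scale_clor_def cnj_clor_def)

lemma scaleR_clor: "r *\<^sub>R v = of_real r *\<^sub>L v" for v :: "'n::finite clor"
  by (simp add: clor_eq_iff scale_clor_def scaleR_conv_of_real[where 'a = complex])

lemma bounded_bilinear_lorentz:
  "bounded_bilinear (lorentz :: 'n::finite clor \<Rightarrow> 'n clor \<Rightarrow> complex)"
  unfolding bilinear_conv_bounded_bilinear[symmetric] bilinear_def
  by (intro conjI allI linearI)
     (simp_all only: lorentz_linear scaleR_clor scaleR_conv_of_real[where 'a = complex])

lemma bounded_bilinear_scale_clor:
  "bounded_bilinear (scale_clor :: complex \<Rightarrow> 'n::finite clor \<Rightarrow> 'n clor)"
  unfolding bilinear_conv_bounded_bilinear[symmetric] bilinear_def
  by (intro conjI allI linearI)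
     (simp_all add: scale_clor_simps scaleR_clor scaleR_conv_of_real[where 'a = complex] mult.commute)

lemma bounded_linear_cnj_clor: "bounded_linear (cnj_clor :: 'n::finite clor \<Rightarrow> 'n clor)"
  unfolding linear_conv_bounded_linear[symmetric]
  by (intro linearI) (simp_all add: scaleR_clor)

lemma bounded_linear_to_clor: "bounded_linear (to_clor :: 'n::finite lor \<Rightarrow> 'n clor)"
  unfolding linear_conv_bounded_linear[symmetric]
  by (intro linearI) (simp_all add: scaleR_clor clor_eq_iff to_clor_def scale_clor_def)

lemma bounded_linear_component: "bounded_linear (\<lambda>v :: 'n::finite clor. snd v $ k)"
  by (rule bounded_linear_compose[OF bounded_linear_vec_nth bounded_linear_snd])

lemma smooth_on_clor:
  "open S \<Longrightarrow> smooth_on \<xi> S \<Longrightarrow> smooth_on (\<lambda>p. cnj_clor (\<xi> p)) S"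
  "open S \<Longrightarrow> smooth_on a S \<Longrightarrow> smooth_on \<xi> S \<Longrightarrow> smooth_on (\<lambda>p. a p *\<^sub>L \<xi> p) S"
  "open S \<Longrightarrow> smooth_on \<xi> S \<Longrightarrow> smooth_on \<eta> S \<Longrightarrow> smooth_on (\<lambda>p. lorentz (\<xi> p) (\<eta> p)) S"
  for \<xi> \<eta> :: "'a::real_normed_vector \<Rightarrow> 'n::finite clor"
  by (rule smooth_on_bounded_linear[OF bounded_linear_cnj_clor], assumption+)
     (rule smooth_on_bilinear[OF bounded_bilinear_scale_clor] smooth_on_bilinear[OF bounded_bilinear_lorentz], assumption+)+

lemma smooth_on_uminus: "open S \<Longrightarrow> smooth_on f S \<Longrightarrow> smooth_on (\<lambda>x. - f x) S"
  by (rule smooth_on_bounded_linear[OF bounded_linear_minus[OF bounded_linear_ident]])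

lemma smooth_on_diff:
  "open S \<Longrightarrow> smooth_on f S \<Longrightarrow> smooth_on g S \<Longrightarrow> smooth_on (\<lambda>x. f x - g x) S"
  using smooth_on_add[of S f "\<lambda>x. - g x"] smooth_on_uminus[of S g] by simp

lemma smooth_on_divide_const:
  fixes f :: "'a::real_normed_vector \<Rightarrow> complex"
  shows "open S \<Longrightarrow> smooth_on f S \<Longrightarrow> smooth_on (\<lambda>x. f x / c) S"
  unfolding divide_inverse by (intro smooth_on_mult smooth_on_const)

lemma
  fixes \<xi> :: "complex \<Rightarrow> 'n::finite clor"
  assumes "(\<xi> has_derivative D) (at p)"
  shows vdz_eq: "vdz \<xi> p = (1/2) *\<^sub>L (D 1 - \<i> *\<^sub>L D \<i>)"
    and vdzbar_eq: "vdzbar \<xi> p = (1/2) *\<^sub>L (D 1 + \<i> *\<^sub>L D \<i>)"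
proof -
  have f: "((\<lambda>q. fst (\<xi> q)) has_derivative (\<lambda>v. fst (D v))) (at p)"
    by (rule bounded_linear.has_derivative[OF bounded_linear_fst assms])
  have s: "((\<lambda>q. snd (\<xi> q) $ k) has_derivative (\<lambda>v. snd (D v) $ k)) (at p)" for k
    by (rule bounded_linear.has_derivative[OF bounded_linear_component assms])
  show "vdz \<xi> p = (1/2) *\<^sub>L (D 1 - \<i> *\<^sub>L D \<i>)"
    by (simp add: vdz_def clor_eq_iff scale_clor_def dz_eq[OF f] dz_eq[OF s])
  show "vdzbar \<xi> p = (1/2) *\<^sub>L (D 1 + \<i> *\<^sub>L D \<i>)"
    by (simp add: vdzbar_def clor_eq_iff scale_clor_def dzbar_eq[OF f] dzbar_eq[OF s])
qed

lemmas smooth_on_UNIV_has_derivative = smooth_on_has_derivative[OF _ open_UNIV UNIV_I]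

lemma
  fixes \<xi> :: "complex \<Rightarrow> 'n::finite clor"
  assumes "smooth_on \<xi> UNIV"
  shows smooth_on_vdz: "smooth_on (vdz \<xi>) UNIV"
    and smooth_on_vdzbar: "smooth_on (vdzbar \<xi>) UNIV"
proof -
  note sm = smooth_on_clor(2)[OF open_UNIV smooth_on_const] smooth_on_frechet_derivative[OF assms]
  have "vdz \<xi> = (\<lambda>p. (1/2) *\<^sub>L (frechet_derivative \<xi> (at p) 1 - \<i> *\<^sub>L frechet_derivative \<xi> (at p) \<i>))"
    using vdz_eq[OF smooth_on_UNIV_has_derivative[OF assms]] by blast
  then show "smooth_on (vdz \<xi>) UNIV" by (simp only:) (intro sm smooth_on_diff open_UNIV)
  have "vdzbar \<xi> = (\<lambda>p. (1/2) *\<^sub>L (frechet_derivative \<xi> (at p) 1 + \<i> *\<^sub>L frechet_derivative \<xi> (at p) \<i>))"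
    using vdzbar_eq[OF smooth_on_UNIV_has_derivative[OF assms]] by blast
  then show "smooth_on (vdzbar \<xi>) UNIV" by (simp only:) (intro sm smooth_on_add open_UNIV)
qed

lemma
  fixes \<xi> \<eta> :: "complex \<Rightarrow> 'n::finite clor"
  assumes "smooth_on \<xi> UNIV" "smooth_on \<eta> UNIV"
  shows vdzbar_add: "vdzbar (\<lambda>q. \<xi> q + \<eta> q) p = vdzbar \<xi> p + vdzbar \<eta> p"
    and vdz_diff: "vdz (\<lambda>q. \<xi> q - \<eta> q) p = vdz \<xi> p - vdz \<eta> p"
    and vdzbar_diff: "vdzbar (\<lambda>q. \<xi> q - \<eta> q) p = vdzbar \<xi> p - vdzbar \<eta> p"
    and dz_lorentz: "dz (\<lambda>q. lorentz (\<xi> q) (\<eta> q)) p = lorentz (vdz \<xi> p) (\<eta> p) + lorentz (\<xi> p) (vdz \<eta> p)"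
    and dzbar_lorentz: "dzbar (\<lambda>q. lorentz (\<xi> q) (\<eta> q)) p = lorentz (vdzbar \<xi> p) (\<eta> p) + lorentz (\<xi> p) (vdzbar \<eta> p)"
proof -
  note D = smooth_on_UNIV_has_derivative[OF assms(1), of p] smooth_on_UNIV_has_derivative[OF assms(2), of p]
  note eqs = vdz_eq[OF D(1)] vdz_eq[OF D(2)] vdzbar_eq[OF D(1)] vdzbar_eq[OF D(2)]
  note a = has_derivative_add[OF D] and d = has_derivative_diff[OF D]
    and l = bounded_bilinear.FDERIV[OF bounded_bilinear_lorentz D]
  show "vdzbar (\<lambda>q. \<xi> q + \<eta> q) p = vdzbar \<xi> p + vdzbar \<eta> p"
    unfolding vdzbar_eq[OF a] eqs by (simp add: scale_clor_simps)
  show "vdz (\<lambda>q. \<xi> q - \<eta> q) p = vdz \<xi> p - vdz \<eta> p"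
    unfolding vdz_eq[OF d] eqs by (simp add: scale_clor_simps)
  show "vdzbar (\<lambda>q. \<xi> q - \<eta> q) p = vdzbar \<xi> p - vdzbar \<eta> p"
    unfolding vdzbar_eq[OF d] eqs by (simp add: scale_clor_simps)
  show "dz (\<lambda>q. lorentz (\<xi> q) (\<eta> q)) p = lorentz (vdz \<xi> p) (\<eta> p) + lorentz (\<xi> p) (vdz \<eta> p)"
    unfolding dz_eq[OF l] eqs by (simp add: lorentz_linear field_simps)
  show "dzbar (\<lambda>q. lorentz (\<xi> q) (\<eta> q)) p = lorentz (vdzbar \<xi> p) (\<eta> p) + lorentz (\<xi> p) (vdzbar \<eta> p)"
    unfolding dzbar_eq[OF l] eqs by (simp add: lorentz_linear field_simps)
qed

lemma
  fixes \<xi> :: "complex \<Rightarrow> 'n::finite clor"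
  assumes "smooth_on a UNIV" "smooth_on \<xi> UNIV"
  shows vdz_scale: "vdz (\<lambda>q. a q *\<^sub>L \<xi> q) p = dz a p *\<^sub>L \<xi> p + a p *\<^sub>L vdz \<xi> p"
    and vdzbar_scale: "vdzbar (\<lambda>q. a q *\<^sub>L \<xi> q) p = dzbar a p *\<^sub>L \<xi> p + a p *\<^sub>L vdzbar \<xi> p"
proof -
  note D = smooth_on_UNIV_has_derivative[OF assms(1), of p] smooth_on_UNIV_has_derivative[OF assms(2), of p]
  note l = bounded_bilinear.FDERIV[OF bounded_bilinear_scale_clor D]
  show "vdz (\<lambda>q. a q *\<^sub>L \<xi> q) p = dz a p *\<^sub>L \<xi> p + a p *\<^sub>L vdz \<xi> p"
    unfolding vdz_eq[OF l] vdz_eq[OF D(2)] dz_def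
    by (simp add: clor_eq_iff scale_clor_def field_simps)
  show "vdzbar (\<lambda>q. a q *\<^sub>L \<xi> q) p = dzbar a p *\<^sub>L \<xi> p + a p *\<^sub>L vdzbar \<xi> p"
    unfolding vdzbar_eq[OF l] vdzbar_eq[OF D(2)] dzbar_def
    by (simp add: clor_eq_iff scale_clor_def field_simps)
qed

lemma
  fixes \<xi> :: "complex \<Rightarrow> 'n::finite clor"
  assumes "smooth_on \<xi> UNIV"
  shows vdz_cnj: "vdz (\<lambda>q. cnj_clor (\<xi> q)) p = cnj_clor (vdzbar \<xi> p)"
    and vdzbar_cnj: "vdzbar (\<lambda>q. cnj_clor (\<xi> q)) p = cnj_clor (vdz \<xi> p)"
    and vdz_vdzbar_commute: "vdzbar (vdz \<xi>) p = vdz (vdzbar \<xi>) p"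
proof -
  note D = smooth_on_UNIV_has_derivative[OF assms, of p]
  note l = bounded_linear.has_derivative[OF bounded_linear_cnj_clor D]
  show "vdz (\<lambda>q. cnj_clor (\<xi> q)) p = cnj_clor (vdzbar \<xi> p)"
    unfolding vdz_eq[OF l] vdzbar_eq[OF D] by (simp add: scale_clor_simps)
  show "vdzbar (\<lambda>q. cnj_clor (\<xi> q)) p = cnj_clor (vdz \<xi> p)"
    unfolding vdzbar_eq[OF l] vdz_eq[OF D] by (simp add: scale_clor_simps)
  let ?x = "\<lambda>p. frechet_derivative \<xi> (at p) 1" and ?y = "\<lambda>p. frechet_derivative \<xi> (at p) \<i>"
  have E: "vdz \<xi> = (\<lambda>p. (1/2) *\<^sub>L (?x p - \<i> *\<^sub>L ?y p))" "vdzbar \<xi> = (\<lambda>p. (1/2) *\<^sub>L (?x p + \<i> *\<^sub>L ?y p))"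
    using vdz_eq[OF smooth_on_UNIV_has_derivative[OF assms]]
      vdzbar_eq[OF smooth_on_UNIV_has_derivative[OF assms]] by blast+
  have sx: "smooth_on ?x UNIV" and sy: "smooth_on ?y UNIV"
    by (rule smooth_on_frechet_derivative[OF assms])+
  note Dx = smooth_on_UNIV_has_derivative[OF sx, of p] and Dy = smooth_on_UNIV_has_derivative[OF sy, of p]
  note sc = bounded_linear.has_derivative[OF bounded_bilinear.bounded_linear_right[OF bounded_bilinear_scale_clor]]
  note A = sc[OF has_derivative_diff[OF Dx sc[OF Dy]]] and B = sc[OF has_derivative_add[OF Dx sc[OF Dy]]]
  show "vdzbar (vdz \<xi>) p = vdz (vdzbar \<xi>) p"
    unfolding E vdzbar_eq[OF A] vdz_eq[OF B]
    using smooth_on_commute_derivatives[OF assms open_UNIV UNIV_I, of 1 p \<i>]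
    by (simp add: scale_clor_simps algebra_simps)
qed

lemma vdz_periodic:
  fixes \<xi> :: "complex \<Rightarrow> 'n::finite clor"
  assumes "on_torus \<omega>1 \<omega>2 \<xi>" "smooth_on \<xi> UNIV"
  shows "on_torus \<omega>1 \<omega>2 (vdz \<xi>)" "on_torus \<omega>1 \<omega>2 (vdzbar \<xi>)"
  using on_torus_frechet_derivative[OF assms]
  by (simp_all add: on_torus_def vdz_eq[OF smooth_on_UNIV_has_derivative[OF assms(2)]]
      vdzbar_eq[OF smooth_on_UNIV_has_derivative[OF assms(2)]])

section \<open>The structure equations of a conformal surface\<close>

lemmas smooth_intros =
  smooth_on_const smooth_on_add[OF open_UNIV] smooth_on_diff[OF open_UNIV] smooth_on_mult[OF open_UNIV]
  smooth_on_divide_const[OF open_UNIV] smooth_on_cnj[OF open_UNIV] smooth_on_clor[OF open_UNIV]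
  smooth_on_vdz smooth_on_vdzbar smooth_on_dz smooth_on_dzbar

locale conformal_lift = torus \<omega>1 \<omega>2 for \<omega>1 \<omega>2 +
  fixes \<Psi> :: "complex \<Rightarrow> 'n::finite clor"
  assumes smooth_lift: "smooth_on \<Psi> UNIV"
    and periodic_lift: "on_torus \<omega>1 \<omega>2 \<Psi>"
    and real_lift: "cnj_clor (\<Psi> p) = \<Psi> p"
    and null_lift: "lorentz (\<Psi> p) (\<Psi> p) = 0"
    and conformal_zz: "lorentz (vdz \<Psi> p) (vdz \<Psi> p) = 0"
    and conformal_zzbar: "lorentz (vdz \<Psi> p) (vdzbar \<Psi> p) = 1 / 2"
begin

abbreviation "Pz \<equiv> vdz \<Psi>"
abbreviation "Pb \<equiv> vdzbar \<Psi>"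
abbreviation "N \<equiv> vdz (vdzbar \<Psi>)"
abbreviation "Pzz \<equiv> vdz (vdz \<Psi>)"

text \<open>The scalar product \<open>q\<close> equals \<open>|\<kappa>|\<^sup>2\<close> (\<open>kappa_kappabar\<close>), but as a scalar product of derivatives of
  the lift it can be differentiated in time without knowing the evolution of \<open>\<kappa>\<close>. The function
  \<open>c\<close> is the Schwarzian: its value is forced by the orthogonality of \<open>\<kappa>\<close> and \<open>N\<close>.\<close>

definition q :: "complex \<Rightarrow> complex" where "q p = lorentz (N p) (N p)"
definition c :: "complex \<Rightarrow> complex" where "c p = 4 * lorentz (Pzz p) (N p)"
definition \<kappa> :: "complex \<Rightarrow> 'n clor" where "\<kappa> p = Pzz p + (c p / 2) *\<^sub>L \<Psi> p"
abbreviation "\<kappa>b \<equiv> \<lambda>p. cnj_clor (\<kappa> p)"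

lemma smooth_q: "smooth_on q UNIV" unfolding q_def[abs_def] by (intro smooth_intros smooth_lift)
lemma smooth_c: "smooth_on c UNIV" unfolding c_def[abs_def] by (intro smooth_intros smooth_lift)
lemma smooth_kappa: "smooth_on \<kappa> UNIV" unfolding \<kappa>_def[abs_def] by (intro smooth_intros smooth_lift smooth_c)

lemmas smooth = smooth_intros smooth_lift smooth_q smooth_c smooth_kappa

lemma cnj_Pz [simp]: "cnj_clor (Pz p) = Pb p"
  using vdzbar_cnj[OF smooth_lift, of p] by (simp add: real_lift)

lemma cnj_Pb [simp]: "cnj_clor (Pb p) = Pz p"
  using vdz_cnj[OF smooth_lift, of p] by (simp add: real_lift)

lemma vdzbar_Pz [simp]: "vdzbar Pz p = N p"
  by (rule vdz_vdzbar_commute[OF smooth_lift])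

lemma cnj_N [simp]: "cnj_clor (N p) = N p"
  using vdzbar_cnj[of "vdzbar \<Psi>" p] by (simp add: smooth)

lemma cnj_Pzz: "cnj_clor (Pzz p) = vdzbar Pb p"
  using vdzbar_cnj[of "vdz \<Psi>" p] by (simp add: smooth)

lemma dz_lorentz_const:
  fixes \<xi> \<eta> :: "complex \<Rightarrow> 'n clor"
  assumes "smooth_on \<xi> UNIV" "smooth_on \<eta> UNIV" "\<And>p. lorentz (\<xi> p) (\<eta> p) = k"
  shows "lorentz (\<xi> p) (vdz \<eta> p) = - lorentz (vdz \<xi> p) (\<eta> p)"
    and "lorentz (\<xi> p) (vdzbar \<eta> p) = - lorentz (vdzbar \<xi> p) (\<eta> p)"
  using dz_lorentz[OF assms(1,2), of p] dzbar_lorentz[OF assms(1,2), of p]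
  unfolding assms(3) by (simp_all add: dz_def dzbar_def eq_neg_iff_add_eq_0 add.commute)

lemma P_P [simp]: "lorentz (\<Psi> p) (\<Psi> p) = 0" by (rule null_lift)
lemma P_Pz [simp]: "lorentz (\<Psi> p) (Pz p) = 0" "lorentz (Pz p) (\<Psi> p) = 0"
  using dz_lorentz_const(1)[of \<Psi> \<Psi> 0 p] by (simp_all add: smooth lorentz_sym)
lemma P_Pb [simp]: "lorentz (\<Psi> p) (Pb p) = 0" "lorentz (Pb p) (\<Psi> p) = 0"
  using dz_lorentz_const(2)[of \<Psi> \<Psi> 0 p] by (simp_all add: smooth lorentz_sym)
lemma Pz_Pz [simp]: "lorentz (Pz p) (Pz p) = 0" by (rule conformal_zz)
lemma Pb_Pb [simp]: "lorentz (Pb p) (Pb p) = 0"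
  using cnj_lorentz[of "Pz p" "Pz p"] by simp
lemma Pz_Pb [simp]: "lorentz (Pz p) (Pb p) = 1/2" "lorentz (Pb p) (Pz p) = 1/2"
  using conformal_zzbar[of p] by (simp_all add: lorentz_sym)
lemma P_N [simp]: "lorentz (\<Psi> p) (N p) = - 1/2" "lorentz (N p) (\<Psi> p) = - 1/2"
  using dz_lorentz_const(1)[of \<Psi> Pb 0 p] by (simp_all add: smooth lorentz_sym)
lemma Pz_N [simp]: "lorentz (Pz p) (N p) = 0" "lorentz (N p) (Pz p) = 0"
  using dz_lorentz_const(2)[of Pz Pz 0 p] by (simp_all add: smooth lorentz_sym)
lemma Pb_N [simp]: "lorentz (Pb p) (N p) = 0" "lorentz (N p) (Pb p) = 0"
  using dz_lorentz_const(1)[of Pb Pb 0 p] by (simp_all add: smooth lorentz_sym)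
lemma Pzz_P [simp]: "lorentz (Pzz p) (\<Psi> p) = 0"
  using dz_lorentz_const(1)[of \<Psi> Pz 0 p] by (simp add: smooth lorentz_sym)
lemma Pzz_Pz [simp]: "lorentz (Pzz p) (Pz p) = 0"
  using dz_lorentz_const(1)[of Pz Pz 0 p] by (simp add: smooth lorentz_sym)
lemma Pzz_Pb [simp]: "lorentz (Pzz p) (Pb p) = 0"
  using dz_lorentz_const(1)[of Pz Pb "1/2" p] by (simp add: smooth)

lemma cnj_q [simp]: "cnj (q p) = q p" by (simp add: q_def cnj_lorentz)
lemma N_N [simp]: "lorentz (N p) (N p) = q p" by (simp add: q_def)

subsection \<open>The normal projection\<close>

definition normal_at :: "complex \<Rightarrow> 'n clor \<Rightarrow> bool" where
  "normal_at p w \<longleftrightarrow> lorentz w (\<Psi> p) = 0 \<and> lorentz w (Pz p) = 0 \<and> lorentz w (Pb p) = 0 \<and> lorentz w (N p) = 0"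

text \<open>The coefficients are obtained by inverting the Gram matrix of the frame \<open>\<psi>, \<psi>\<^sub>z, \<psi>\<^sub>z\<^sub>', N\<close>.\<close>

definition tang :: "complex \<Rightarrow> 'n clor \<Rightarrow> 'n clor" where
  "tang p w = (- 4 * q p * lorentz w (\<Psi> p) - 2 * lorentz w (N p)) *\<^sub>L \<Psi> p
     + (2 * lorentz w (Pb p)) *\<^sub>L Pz p + (2 * lorentz w (Pz p)) *\<^sub>L Pb p
     + (- 2 * lorentz w (\<Psi> p)) *\<^sub>L N p"

definition perp :: "complex \<Rightarrow> 'n clor \<Rightarrow> 'n clor" where
  "perp p w = w - tang p w"

lemma normalD:
  assumes "normal_at p w"
  shows "lorentz w (\<Psi> p) = 0" "lorentz w (Pz p) = 0" "lorentz w (Pb p) = 0" "lorentz w (N p) = 0"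
    "lorentz (\<Psi> p) w = 0" "lorentz (Pz p) w = 0" "lorentz (Pb p) w = 0" "lorentz (N p) w = 0"
  using assms by (simp_all add: normal_at_def lorentz_sym)

lemma normal_perp: "normal_at p (perp p w)"
  by (simp add: normal_at_def perp_def tang_def lorentz_linear field_simps)

lemma perp_linear:
  "perp p (v + w) = perp p v + perp p w" "perp p (v - w) = perp p v - perp p w"
  "perp p (a *\<^sub>L w) = a *\<^sub>L perp p w"
  by (simp_all add: perp_def tang_def lorentz_linear scale_clor_simps algebra_simps)

lemma perp_frame [simp]:
  "perp p (\<Psi> p) = 0" "perp p (Pz p) = 0" "perp p (Pb p) = 0" "perp p (N p) = 0"
  by (simp_all add: perp_def tang_def scale_clor_simps)

lemma perp_normal: "normal_at p w \<Longrightarrow> perp p w = w"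
  by (simp add: perp_def tang_def normalD scale_clor_simps)

lemma lorentz_perp_right: "normal_at p v \<Longrightarrow> lorentz v (perp p w) = lorentz v w"
  by (simp add: perp_def tang_def lorentz_linear normalD)

lemma cnj_perp: "cnj_clor (perp p w) = perp p (cnj_clor w)"
proof -
  have "cnj (lorentz w (\<Psi> p)) = lorentz (cnj_clor w) (\<Psi> p)" "cnj (lorentz w (N p)) = lorentz (cnj_clor w) (N p)"
     "cnj (lorentz w (Pz p)) = lorentz (cnj_clor w) (Pb p)" "cnj (lorentz w (Pb p)) = lorentz (cnj_clor w) (Pz p)"
    by (simp_all add: cnj_lorentz real_lift)
  then show ?thesis by (simp add: perp_def tang_def real_lift)
qed

lemma normal_cnj: "normal_at p w \<Longrightarrow> normal_at p (cnj_clor w)"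
  using cnj_perp[of p w] normal_perp[of p "cnj_clor w"] by (simp add: perp_normal)

lemma normal_combine:
  "normal_at p v \<Longrightarrow> normal_at p w \<Longrightarrow> normal_at p (v + w)"
  "normal_at p w \<Longrightarrow> normal_at p (a *\<^sub>L w)"
  by (simp_all add: normal_at_def lorentz_linear)

lemma normal_kappa: "normal_at p (\<kappa> p)" "normal_at p (\<kappa>b p)"
proof -
  show "normal_at p (\<kappa> p)" by (simp add: normal_at_def \<kappa>_def lorentz_linear) (simp add: c_def)
  then show "normal_at p (\<kappa>b p)" by (rule normal_cnj)
qed

lemma perp_Pzz: "perp p (Pzz p) = \<kappa> p"
proof -
  have "Pzz p = \<kappa> p - (c p / 2) *\<^sub>L \<Psi> p" by (simp add: \<kappa>_def)
  then have "perp p (Pzz p) = perp p (\<kappa> p - (c p / 2) *\<^sub>L \<Psi> p)" by simp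
  then show ?thesis by (simp only: perp_linear perp_normal[OF normal_kappa(1)] perp_frame scale_clor_simps diff_zero)
qed

lemma perp_Pbb: "perp p (vdzbar Pb p) = \<kappa>b p"
  using cnj_perp[of p "Pzz p"] by (simp add: perp_Pzz cnj_Pzz)


subsection \<open>The normal connection\<close>

definition D :: "(complex \<Rightarrow> 'n clor) \<Rightarrow> complex \<Rightarrow> 'n clor" where
  "D \<xi> p = perp p (vdz \<xi> p)"

definition Db :: "(complex \<Rightarrow> 'n clor) \<Rightarrow> complex \<Rightarrow> 'n clor" where
  "Db \<xi> p = perp p (vdzbar \<xi> p)"

definition normal_field :: "(complex \<Rightarrow> 'n clor) \<Rightarrow> bool" where
  "normal_field \<xi> \<longleftrightarrow> smooth_on \<xi> UNIV \<and> periodic \<xi> \<and> (\<forall>p. normal_at p (\<xi> p))"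

lemma normal_fieldD:
  assumes "normal_field \<xi>"
  shows "smooth_on \<xi> UNIV" "periodic \<xi>" "normal_at p (\<xi> p)"
  using assms by (simp_all add: normal_field_def)

lemma on_torus_frame:
  "periodic Pz" "periodic Pb" "periodic Pzz" "periodic N"
  by (intro vdz_periodic periodic_lift smooth)+

lemma on_torus_q: "periodic q" and on_torus_c: "periodic c"
  using on_torus_frame by (simp_all add: on_torus_def q_def c_def del: N_N)

lemma normal_field_kappa: "normal_field \<kappa>"
  using on_torus_frame on_torus_c periodic_lift normal_kappa
  by (auto simp: normal_field_def smooth_kappa on_torus_def \<kappa>_def)

lemma normal_field_cnj: "normal_field \<xi> \<Longrightarrow> normal_field (\<lambda>p. cnj_clor (\<xi> p))"
  by (auto simp: normal_field_def on_torus_def normal_cnj intro: smooth)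

lemma smooth_perp:
  assumes "smooth_on w UNIV"
  shows "smooth_on (\<lambda>p. perp p (w p)) UNIV"
  unfolding perp_def tang_def by (intro smooth assms)

lemma on_torus_perp:
  assumes "periodic w"
  shows "periodic (\<lambda>p. perp p (w p))"
  using assms on_torus_frame on_torus_q periodic_lift by (simp add: on_torus_def perp_def tang_def)

lemma normal_field_D: "normal_field \<xi> \<Longrightarrow> normal_field (D \<xi>)"
  and normal_field_Db: "normal_field \<xi> \<Longrightarrow> normal_field (Db \<xi>)"
  unfolding normal_field_def D_def[abs_def] Db_def[abs_def]
  by (auto intro!: smooth_perp on_torus_perp smooth vdz_periodic normal_perp)

lemma Db_cnj: "smooth_on \<xi> UNIV \<Longrightarrow> Db (\<lambda>p. cnj_clor (\<xi> p)) p = cnj_clor (D \<xi> p)"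
  by (simp add: Db_def D_def vdzbar_cnj cnj_perp)

lemma D_cnj: "smooth_on \<xi> UNIV \<Longrightarrow> D (\<lambda>p. cnj_clor (\<xi> p)) p = cnj_clor (Db \<xi> p)"
  by (simp add: Db_def D_def vdz_cnj cnj_perp)

text \<open>Since \<open>N\<close> is also the conjugate derivative of \<open>\<psi>\<^sub>z\<close>, its derivative is that of \<open>\<psi>\<^sub>z\<^sub>z = \<kappa> - c \<psi> / 2\<close>.\<close>

lemma vdz_N: "vdz N p = vdzbar \<kappa> p - (dzbar (\<lambda>q. c q / 2) p *\<^sub>L \<Psi> p + (c p / 2) *\<^sub>L Pb p)"
proof -
  have N: "N = vdzbar Pz" by auto
  have "vdz N p = vdz (vdzbar Pz) p" by (simp only: N)
  also have "\<dots> = vdzbar Pzz p" by (rule vdz_vdzbar_commute[symmetric]) (intro smooth)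
  also have "\<dots> = vdzbar \<kappa> p - (dzbar (\<lambda>q. c q / 2) p *\<^sub>L \<Psi> p + (c p / 2) *\<^sub>L Pb p)"
  proof -
    have "vdzbar \<kappa> p = vdzbar (\<lambda>p. Pzz p + (c p / 2) *\<^sub>L \<Psi> p) p" by (simp only: \<kappa>_def[abs_def])
    also have "\<dots> = vdzbar Pzz p + vdzbar (\<lambda>p. (c p / 2) *\<^sub>L \<Psi> p) p"
      by (intro vdzbar_add smooth)
    also have "vdzbar (\<lambda>p. (c p / 2) *\<^sub>L \<Psi> p) p = dzbar (\<lambda>q. c q / 2) p *\<^sub>L \<Psi> p + (c p / 2) *\<^sub>L Pb p"
      by (intro vdzbar_scale smooth)
    finally show ?thesis by simp
  qed
  finally show ?thesis .
qed

text \<open>The tangential coefficients of \<open>\<xi>\<^sub>z\<close> are scalar products with the frame, and these are found by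
  differentiating the orthogonality relations of \<open>\<xi>\<close>.\<close>

lemma structure_z:
  assumes "normal_field \<xi>"
  shows "vdz \<xi> p = D \<xi> p + (2 * lorentz (\<xi> p) (vdzbar \<kappa> p)) *\<^sub>L \<Psi> p - (2 * lorentz (\<xi> p) (\<kappa> p)) *\<^sub>L Pb p"
proof -
  note s = normal_fieldD(1)[OF assms] and n = normalD[OF normal_fieldD(3)[OF assms]]
  have 1: "lorentz (vdz \<xi> p) (\<Psi> p) = 0"
    using dz_lorentz_const(1)[OF s smooth_lift n(1), of p] by (simp add: n)
  have 2: "lorentz (vdz \<xi> p) (Pb p) = 0"
    using dz_lorentz_const(1)[OF s smooth_on_vdzbar[OF smooth_lift] n(3), of p] by (simp add: n)
  have 3: "lorentz (vdz \<xi> p) (Pz p) = - lorentz (\<xi> p) (\<kappa> p)"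
    using dz_lorentz_const(1)[OF s smooth_on_vdz[OF smooth_lift] n(2), of p]
    by (simp add: \<kappa>_def lorentz_linear n)
  have 4: "lorentz (vdz \<xi> p) (N p) = - lorentz (\<xi> p) (vdzbar \<kappa> p)"
    using dz_lorentz_const(1)[OF s smooth_on_vdz[OF smooth_on_vdzbar[OF smooth_lift]] n(4), of p]
    by (simp add: vdz_N lorentz_linear n)
  show ?thesis
    unfolding D_def perp_def tang_def 1 2 3 4 by (simp add: scale_clor_simps)
qed

lemma structure_zbar:
  assumes "normal_field \<xi>"
  shows "vdzbar \<xi> p = Db \<xi> p + (2 * lorentz (\<xi> p) (vdz \<kappa>b p)) *\<^sub>L \<Psi> p - (2 * lorentz (\<xi> p) (\<kappa>b p)) *\<^sub>L Pz p"
proof -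
  note s = normal_fieldD(1)[OF assms]
  have "vdzbar \<xi> p = cnj_clor (vdz (\<lambda>q. cnj_clor (\<xi> q)) p)" by (simp add: vdz_cnj s)
  also have "\<dots> = cnj_clor (D (\<lambda>q. cnj_clor (\<xi> q)) p)
      + (2 * lorentz (\<xi> p) (vdz \<kappa>b p)) *\<^sub>L \<Psi> p - (2 * lorentz (\<xi> p) (\<kappa>b p)) *\<^sub>L Pz p"
    by (simp add: structure_z[OF normal_field_cnj[OF assms]] cnj_lorentz real_lift vdz_cnj smooth_kappa)
  finally show ?thesis by (simp add: D_cnj s)
qed

lemma lorentz_D_right: "normal_at p v \<Longrightarrow> lorentz v (D \<xi> p) = lorentz v (vdz \<xi> p)"
  "normal_at p v \<Longrightarrow> lorentz v (Db \<xi> p) = lorentz v (vdzbar \<xi> p)"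
  by (simp_all add: D_def Db_def lorentz_perp_right)

lemma dz_lorentz_normal:
  assumes "normal_field \<xi>" "normal_field \<eta>"
  shows "dz (\<lambda>q. lorentz (\<xi> q) (\<eta> q)) p = lorentz (D \<xi> p) (\<eta> p) + lorentz (\<xi> p) (D \<eta> p)"
    and "dzbar (\<lambda>q. lorentz (\<xi> q) (\<eta> q)) p = lorentz (Db \<xi> p) (\<eta> p) + lorentz (\<xi> p) (Db \<eta> p)"
  using normal_fieldD[OF assms(1)] normal_fieldD[OF assms(2)]
  by (simp_all add: dz_lorentz dzbar_lorentz lorentz_D_right lorentz_sym[of _ "\<eta> p"])

text \<open>The structure equations write a normal derivative as a derivative corrected by multiples of
  \<open>\<psi>\<close> and of \<open>\<psi>\<^sub>z\<close> or its conjugate. After a further derivative and projection only the derivative of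
  the latter survives; it is \<open>\<kappa>\<close>, its conjugate, or tangential.\<close>

lemma perp_vdz_corrected:
  assumes "smooth_on X UNIV" "smooth_on A UNIV" "smooth_on B UNIV" "smooth_on Y UNIV" "perp p (Y p) = 0"
  shows "perp p (vdz (\<lambda>p. X p - (A p *\<^sub>L \<Psi> p - B p *\<^sub>L Y p)) p) = perp p (vdz X p) + B p *\<^sub>L perp p (vdz Y p)"
proof -
  have "vdz (\<lambda>p. X p - (A p *\<^sub>L \<Psi> p - B p *\<^sub>L Y p)) p = vdz X p - vdz (\<lambda>p. A p *\<^sub>L \<Psi> p - B p *\<^sub>L Y p) p"
    by (intro vdz_diff smooth assms)
  also have "vdz (\<lambda>p. A p *\<^sub>L \<Psi> p - B p *\<^sub>L Y p) p = vdz (\<lambda>p. A p *\<^sub>L \<Psi> p) p - vdz (\<lambda>p. B p *\<^sub>L Y p) p"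
    by (intro vdz_diff smooth assms)
  also have "vdz (\<lambda>p. A p *\<^sub>L \<Psi> p) p = dz A p *\<^sub>L \<Psi> p + A p *\<^sub>L Pz p"
    by (intro vdz_scale smooth assms)
  also have "vdz (\<lambda>p. B p *\<^sub>L Y p) p = dz B p *\<^sub>L Y p + B p *\<^sub>L vdz Y p"
    by (intro vdz_scale smooth assms)
  finally show ?thesis by (simp add: perp_linear assms(5) scale_clor_simps)
qed

lemma D_Db:
  assumes "normal_field \<xi>"
  shows "D (Db \<xi>) p = perp p (vdz (vdzbar \<xi>) p) + (2 * lorentz (\<xi> p) (\<kappa>b p)) *\<^sub>L \<kappa> p"
proof -
  note s = normal_fieldD(1)[OF assms]
  have "Db \<xi> = (\<lambda>p. vdzbar \<xi> p - ((2 * lorentz (\<xi> p) (vdz \<kappa>b p)) *\<^sub>L \<Psi> p - (2 * lorentz (\<xi> p) (\<kappa>b p)) *\<^sub>L Pz p))"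
    by (rule ext) (simp add: structure_zbar[OF assms])
  then show ?thesis unfolding D_def[of "Db \<xi>"]
    by (simp only:) (subst perp_vdz_corrected, (intro smooth s perp_frame)+, simp add: perp_Pzz)
qed

lemma Db_D:
  assumes "normal_field \<xi>"
  shows "Db (D \<xi>) p = perp p (vdz (vdzbar \<xi>) p) + (2 * lorentz (\<xi> p) (\<kappa> p)) *\<^sub>L \<kappa>b p"
proof -
  note s = normal_fieldD(1)[OF assms]
  have "D \<xi> = (\<lambda>p. cnj_clor (Db (\<lambda>q. cnj_clor (\<xi> q)) p))"
    using Db_cnj[OF s] by auto
  then have "Db (D \<xi>) p = Db (\<lambda>p. cnj_clor (Db (\<lambda>q. cnj_clor (\<xi> q)) p)) p" by (rule arg_cong)
  also have "\<dots> = cnj_clor (D (Db (\<lambda>q. cnj_clor (\<xi> q))) p)"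
    by (rule Db_cnj) (rule normal_fieldD(1)[OF normal_field_Db[OF normal_field_cnj[OF assms]]])
  also have "\<dots> = perp p (cnj_clor (vdz (vdzbar (\<lambda>q. cnj_clor (\<xi> q))) p)) + (2 * lorentz (\<xi> p) (\<kappa> p)) *\<^sub>L \<kappa>b p"
    by (simp add: D_Db[OF normal_field_cnj[OF assms]] cnj_perp cnj_lorentz)
  also have "vdzbar (\<lambda>q. cnj_clor (\<xi> q)) = (\<lambda>p. cnj_clor (vdz \<xi> p))"
    using vdzbar_cnj[OF s] by auto
  also have "cnj_clor (vdz (\<lambda>p. cnj_clor (vdz \<xi> p)) p) = vdz (vdzbar \<xi>) p"
    by (simp add: vdz_cnj smooth s vdz_vdzbar_commute)
  finally show ?thesis .
qed

lemma ricci: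
  assumes "normal_field \<xi>"
  shows "D (Db \<xi>) p - Db (D \<xi>) p = (2 * lorentz (\<xi> p) (\<kappa>b p)) *\<^sub>L \<kappa> p - (2 * lorentz (\<xi> p) (\<kappa> p)) *\<^sub>L \<kappa>b p"
  by (simp add: D_Db[OF assms] Db_D[OF assms])

lemma D_D:
  assumes "normal_field \<xi>"
  shows "D (D \<xi>) p = perp p (vdz (vdz \<xi>) p)"
proof -
  note s = normal_fieldD(1)[OF assms]
  have "D \<xi> = (\<lambda>p. vdz \<xi> p - ((2 * lorentz (\<xi> p) (vdzbar \<kappa> p)) *\<^sub>L \<Psi> p - (2 * lorentz (\<xi> p) (\<kappa> p)) *\<^sub>L Pb p))"
    by (rule ext) (simp add: structure_z[OF assms])
  then show ?thesis unfolding D_def[of "D \<xi>"]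
    by (simp only:) (subst perp_vdz_corrected, (intro smooth s perp_frame)+, simp add: scale_clor_simps)
qed

text \<open>Both sides equal \<open>- \<langle>\<psi>\<^sub>z, N\<^sub>z\<^sub>'\<rangle>\<close>: differentiate \<open>\<langle>\<psi>\<^sub>z, \<psi>\<^sub>z\<^sub>'\<^sub>z\<^sub>'\<rangle> = 0\<close> for one side and \<open>\<langle>\<psi>\<^sub>z, N\<rangle> = 0\<close> for the
  other.\<close>

lemma kappa_kappabar: "lorentz (\<kappa> p) (\<kappa>b p) = q p"
proof -
  have 1: "lorentz (Pzz p) (vdzbar Pb p) = - lorentz (Pz p) (vdzbar N p)"
  proof -
    have z: "lorentz (Pz p) (vdzbar Pb p) = 0" for p
      using dz_lorentz_const(2)[of Pz Pb "1/2" p] by (simp add: smooth)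
    have "lorentz (Pz p) (vdz (vdzbar Pb) p) = - lorentz (Pzz p) (vdzbar Pb p)"
      by (rule dz_lorentz_const(1)[OF _ _ z]) (intro smooth)+
    moreover have "vdz (vdzbar Pb) p = vdzbar N p"
      by (rule vdz_vdzbar_commute[symmetric]) (intro smooth)
    ultimately show ?thesis by simp
  qed
  have 2: "lorentz (Pz p) (vdzbar N p) = - q p"
    using dz_lorentz_const(2)[of Pz N 0 p] by (simp add: smooth)
  have 3: "lorentz (\<Psi> p) (vdzbar Pb p) = 0"
    using dz_lorentz_const(2)[of \<Psi> Pb 0 p] by (simp add: smooth)
  have "\<kappa>b p = vdzbar Pb p + (cnj (c p) / 2) *\<^sub>L \<Psi> p" by (simp add: \<kappa>_def cnj_Pzz real_lift)
  then show ?thesis using 1 2 3 by (simp add: \<kappa>_def lorentz_linear)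
qed

lemma q_eq_kappa: "q = (\<lambda>p. lorentz (\<kappa> p) (\<kappa>b p))"
  using kappa_kappabar by auto

lemma dz_mult_const:
  assumes "smooth_on g UNIV"
  shows "dz (\<lambda>p. k * g p) p = k * dz g p" "dzbar (\<lambda>p. k * g p) p = k * dzbar g p"
proof -
  have "dz (\<lambda>p. k) p = 0" "dzbar (\<lambda>p. k) p = 0" by (simp_all add: dz_def dzbar_def)
  then show "dz (\<lambda>p. k * g p) p = k * dz g p" "dzbar (\<lambda>p. k * g p) p = k * dzbar g p"
    using dz_mult[OF smooth_on_const assms, of k p] dzbar_mult[OF smooth_on_const assms, of k p] by simp_all
qed

lemma lorentz_kappa_vdz_kappab: "lorentz (\<kappa> p) (vdz \<kappa>b p) = lorentz (Pzz p) (vdzbar N p)"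
proof -
  have "vdzbar N p = cnj_clor (vdz N p)"
    using vdzbar_cnj[of N p] by (simp add: smooth)
  also have "\<dots> = vdz \<kappa>b p - (cnj (dzbar (\<lambda>q. c q / 2) p) *\<^sub>L \<Psi> p + (cnj (c p) / 2) *\<^sub>L Pz p)"
    by (simp add: vdz_N vdz_cnj smooth_kappa real_lift)
  finally have e: "vdzbar N p = vdz \<kappa>b p - (cnj (dzbar (\<lambda>q. c q / 2) p) *\<^sub>L \<Psi> p + (cnj (c p) / 2) *\<^sub>L Pz p)" .
  have "lorentz (\<Psi> p) (vdz \<kappa>b p) = 0"
    using dz_lorentz_const(1)[OF smooth_lift smooth_on_clor(1)[OF open_UNIV smooth_kappa], of 0 p]
      normalD[OF normal_kappa(2)] by simp
  then show ?thesis unfolding e by (simp add: lorentz_linear \<kappa>_def)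
qed

text \<open>Differentiating \<open>c = 4 \<langle>\<psi>\<^sub>z\<^sub>z, N\<rangle>\<close> produces the derivative of \<open>q = \<langle>N, N\<rangle>\<close> from the first factor and
  \<open>\<langle>\<kappa>, \<kappa>'\<^sub>z\<rangle>\<close> from the second.\<close>

lemma gauss: "lorentz (\<kappa> p) (vdz \<kappa>b p) = dzbar c p / 4 - dz q p / 2"
proof -
  have "dzbar c p = 4 * dzbar (\<lambda>p. lorentz (Pzz p) (N p)) p"
    unfolding c_def[abs_def] by (intro dz_mult_const smooth)
  also have "dzbar (\<lambda>p. lorentz (Pzz p) (N p)) p = lorentz (vdzbar Pzz p) (N p) + lorentz (Pzz p) (vdzbar N p)"
    by (intro dzbar_lorentz smooth)
  also have "vdzbar Pzz p = vdz N p"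
  proof -
    have N: "N = vdzbar Pz" by auto
    have "vdzbar (vdz Pz) p = vdz (vdzbar Pz) p" by (rule vdz_vdzbar_commute) (intro smooth)
    then show ?thesis by (simp only: N)
  qed
  also have "lorentz (vdz N p) (N p) = dz q p / 2"
  proof -
    have "dz q p = lorentz (vdz N p) (N p) + lorentz (N p) (vdz N p)"
      unfolding q_def[abs_def] by (intro dz_lorentz smooth)
    then show ?thesis by (simp add: lorentz_sym)
  qed
  finally show ?thesis unfolding lorentz_kappa_vdz_kappab by (simp add: field_simps)
qed

lemma gauss_cnj: "lorentz (\<kappa>b p) (vdzbar \<kappa> p) = dz (\<lambda>p. cnj (c p)) p / 4 - dzbar q p / 2"
proof -
  have "lorentz (\<kappa>b p) (vdzbar \<kappa> p) = cnj (lorentz (\<kappa> p) (vdz \<kappa>b p))"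
    by (simp add: cnj_lorentz vdz_cnj smooth_kappa)
  moreover have "cnj (dz q p) = dzbar q p"
    using dzbar_cnj[OF smooth_q, of p] by simp
  ultimately show ?thesis by (simp add: gauss dz_cnj smooth_c)
qed

end

section \<open>The Novikov--Veselov variation\<close>

context conformal_lift
begin

definition \<sigma> :: "complex \<Rightarrow> 'n clor" where
  "\<sigma> p = (1/2) *\<^sub>L (D \<kappa> p + Db \<kappa>b p)"

definition h :: "complex \<Rightarrow> complex" where "h p = lorentz (\<kappa> p) (\<kappa> p)"

lemma smooth_h: "smooth_on h UNIV" unfolding h_def[abs_def] by (intro smooth)

lemma on_torus_h: "periodic h"
  using normal_fieldD(2)[OF normal_field_kappa] by (simp add: on_torus_def h_def)

lemmas normal_fields = normal_field_kappa normal_field_cnj[OF normal_field_kappa]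
  normal_field_D[OF normal_field_kappa] normal_field_Db[OF normal_field_kappa]
  normal_field_Db[OF normal_field_Db[OF normal_field_kappa]]

lemma cnj_sigma: "cnj_clor (\<sigma> p) = \<sigma> p"
  using D_cnj[OF smooth_kappa, of p] Db_cnj[OF smooth_kappa, of p]
  by (simp add: \<sigma>_def add.commute)

lemma normal_sigma: "normal_at p (\<sigma> p)"
  unfolding \<sigma>_def
  using normal_fieldD(3)[OF normal_field_D[OF normal_field_kappa]]
    normal_fieldD(3)[OF normal_field_Db[OF normal_field_cnj[OF normal_field_kappa]]]
  by (intro normal_combine) auto

lemma dz_h: "dz h p = 2 * lorentz (D \<kappa> p) (\<kappa> p)" and dzbar_h: "dzbar h p = 2 * lorentz (Db \<kappa> p) (\<kappa> p)"
  using dz_lorentz_normal[OF normal_field_kappa normal_field_kappa, of p]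
  by (simp_all add: h_def[abs_def] lorentz_sym)

text \<open>In \<open>\<langle>D' \<kappa>', \<kappa>\<rangle> = q\<^sub>z\<^sub>' - \<langle>\<kappa>', D' \<kappa>\<rangle>\<close> the last term is a total derivative by the Gauss equation.\<close>

lemma sigma_kappa:
  "2 * lorentz (\<sigma> p) (\<kappa> p) = dz (\<lambda>p. (1/2) * h p + (-1/4) * cnj (c p)) p + dzbar (\<lambda>p. (3/2) * q p) p"
proof -
  have "dzbar q p = lorentz (Db \<kappa> p) (\<kappa>b p) + lorentz (\<kappa> p) (Db \<kappa>b p)"
    unfolding q_eq_kappa by (rule dz_lorentz_normal(2)) (rule normal_fields)+
  then have "lorentz (Db \<kappa>b p) (\<kappa> p) = dzbar q p - lorentz (Db \<kappa> p) (\<kappa>b p)"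
    by (simp add: lorentz_sym)
  moreover have "lorentz (Db \<kappa> p) (\<kappa>b p) = dz (\<lambda>p. cnj (c p)) p / 4 - dzbar q p / 2"
    using gauss_cnj[of p] lorentz_D_right(2)[OF normal_kappa(2), of p \<kappa>] by (simp add: lorentz_sym)
  ultimately have "lorentz (Db \<kappa>b p) (\<kappa> p) = (3/2) * dzbar q p - dz (\<lambda>p. cnj (c p)) p / 4"
    by simp
  then have e: "2 * lorentz (\<sigma> p) (\<kappa> p) = (1/2) * dz h p + (3/2) * dzbar q p - dz (\<lambda>p. cnj (c p)) p / 4"
    by (simp add: \<sigma>_def lorentz_linear dz_h)
  have "dz (\<lambda>p. (1/2) * h p + (-1/4) * cnj (c p)) p = dz (\<lambda>p. (1/2) * h p) p + dz (\<lambda>p. (-1/4) * cnj (c p)) p"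
    by (intro dz_add smooth smooth_h)
  also have "dz (\<lambda>p. (1/2) * h p) p = (1/2) * dz h p"
    by (rule dz_mult_const(1)[OF smooth_h])
  also have "dz (\<lambda>p. (-1/4) * cnj (c p)) p = (-1/4) * dz (\<lambda>p. cnj (c p)) p"
    by (intro dz_mult_const smooth)
  finally have f: "dz (\<lambda>p. (1/2) * h p + (-1/4) * cnj (c p)) p = (1/2) * dz h p + (-1/4) * dz (\<lambda>p. cnj (c p)) p" .
  show ?thesis unfolding e f dz_mult_const(2)[OF smooth_q] by simp
qed

lemma torus_integral_total_derivative:
  assumes "periodic f" "smooth_on f UNIV" "periodic g" "smooth_on g UNIV"
  shows "integ (\<lambda>p. dz f p + dzbar g p) = 0"
  using torus_integral_dz[OF assms(1,2)] torus_integral_dzbar[OF assms(3,4)]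
    smooth_on_continuous_on[OF smooth_on_dz[OF assms(2)]] smooth_on_continuous_on[OF smooth_on_dzbar[OF assms(4)]]
  by (simp add: torus_integral_add)

lemma smooth_sigma: "smooth_on \<sigma> UNIV"
  unfolding \<sigma>_def[abs_def]
  using normal_fieldD(1)[OF normal_field_D[OF normal_field_kappa]]
    normal_fieldD(1)[OF normal_field_Db[OF normal_field_cnj[OF normal_field_kappa]]]
  by (intro smooth)

lemma on_torus_sigma: "periodic \<sigma>"
  using normal_fieldD(2)[OF normal_field_D[OF normal_field_kappa]]
    normal_fieldD(2)[OF normal_field_Db[OF normal_field_cnj[OF normal_field_kappa]]]
  by (simp add: on_torus_def \<sigma>_def)

text \<open>By the Gauss equation the right-hand side of the \<open>\<partial>\<close>-equation is a total derivative, so its mean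
  vanishes and the equation is solvable.\<close>

lemma dbar_solution:
  obtains b where "periodic b" "smooth_on b UNIV" "integ b = 0"
    "\<And>p. dz (\<lambda>q. cnj (b q)) p = 2 * lorentz (\<sigma> p) (\<kappa> p)"
proof -
  let ?g = "\<lambda>p. 2 * lorentz (\<sigma> p) (\<kappa> p)"
  have g: "periodic ?g" "smooth_on ?g UNIV"
    using on_torus_sigma normal_fieldD(2)[OF normal_field_kappa]
    by (simp add: on_torus_def) (intro smooth smooth_sigma)
  have "integ ?g = 0"
    unfolding sigma_kappa using on_torus_h on_torus_c on_torus_q
    by (intro torus_integral_total_derivative smooth smooth_h) (simp_all add: on_torus_def)
  then obtain u where u: "periodic u" "smooth_on u UNIV" "dz u = ?g"
    using dz_equation_solvable[OF g] by blast
  define m where "m = integ u / of_real area"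
  let ?b = "\<lambda>p. cnj (u p + (- m))"
  have "dz (\<lambda>p. u p + (- m)) p = dz u p + dz (\<lambda>p. - m) p" for p
    by (intro dz_add smooth u)
  then have "dz (\<lambda>p. cnj (?b p)) p = ?g p" for p
    using u(3) by (simp add: dz_def[of "\<lambda>p. - m"] fun_eq_iff)
  moreover have "integ ?b = 0"
  proof -
    have "integ (\<lambda>p. u p + (- m)) = integ u + integ (\<lambda>p. - m)"
      by (intro torus_integral_add smooth_on_continuous_on u smooth)
    also have "\<dots> = 0" using area_pos by (simp only: torus_integral_const) (simp add: m_def)
    finally show ?thesis unfolding torus_integral_cnj by simp
  qed
  moreover have "smooth_on ?b UNIV" by (intro smooth u)
  moreover have "periodic ?b" using u(1) by (simp add: on_torus_def)
  ultimately show ?thesis using that by blast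
qed

subsection \<open>The bi-Laplacian of the lift\<close>

text \<open>Up to a factor, \<open>F4\<close> is the bi-Laplacian of \<open>\<psi>\<close>, hence real. The following lemmas compute its
  scalar products with the frame and its normal part.\<close>

abbreviation "F4 \<equiv> vdzbar (vdz N)"

lemma cnj_F4 [simp]: "cnj_clor (F4 p) = F4 p"
proof -
  have "vdzbar N = (\<lambda>p. cnj_clor (vdz N p))"
    using vdzbar_cnj[of N] by (intro ext) (simp add: smooth)
  then have "vdz (vdzbar N) p = cnj_clor (vdzbar (vdz N) p)"
    by (simp add: vdz_cnj smooth)
  moreover have "vdzbar (vdz N) p = vdz (vdzbar N) p" by (rule vdz_vdzbar_commute) (intro smooth)
  ultimately show ?thesis by simp
qed

lemma P_F4: "lorentz (\<Psi> p) (F4 p) = q p"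
proof -
  have 1: "lorentz (\<Psi> p) (vdz N p) = 0" for p
    using dz_lorentz_const(1)[of \<Psi> N "-1/2" p] by (simp add: smooth)
  have 2: "lorentz (Pb p) (vdz N p) = - q p"
    using dz_lorentz_const(1)[of Pb N 0 p] by (simp add: smooth)
  have "lorentz (\<Psi> p) (vdzbar (vdz N) p) = - lorentz (vdzbar \<Psi> p) (vdz N p)"
    by (rule dz_lorentz_const(2)[OF _ _ 1]) (intro smooth)+
  then show ?thesis using 2 by simp
qed

lemma Pz_F4: "lorentz (Pz p) (F4 p) = - dzbar c p / 4 - dz q p / 2"
proof -
  have "lorentz (Pz p) (vdz N p) = (-1/4) * c p" for p
    using dz_lorentz_const(1)[of Pz N 0 p] by (simp add: smooth c_def)
  then have "(\<lambda>p. lorentz (Pz p) (vdz N p)) = (\<lambda>p. (-1/4) * c p)" by (rule ext)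
  then have "dzbar (\<lambda>p. lorentz (Pz p) (vdz N p)) p = (-1/4) * dzbar c p"
    using dz_mult_const(2)[OF smooth_c, of "-1/4" p] by (simp only:)
  moreover have "dzbar (\<lambda>p. lorentz (Pz p) (vdz N p)) p = lorentz (vdzbar Pz p) (vdz N p) + lorentz (Pz p) (F4 p)"
    by (intro dzbar_lorentz smooth)
  moreover have "dz q p = lorentz (vdz N p) (N p) + lorentz (N p) (vdz N p)"
    unfolding q_def[abs_def] by (intro dz_lorentz smooth)
  ultimately show ?thesis by (simp add: lorentz_sym[of "vdz N p" "N p"] field_simps)
qed

lemma cnj_dz_q: "cnj (dz q p) = dzbar q p"
  using dzbar_cnj[OF smooth_q, of p] by simp

lemma Pb_F4: "lorentz (Pb p) (F4 p) = - dz (\<lambda>p. cnj (c p)) p / 4 - dzbar q p / 2"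
proof -
  have "lorentz (Pb p) (F4 p) = cnj (lorentz (Pz p) (F4 p))" by (simp add: cnj_lorentz)
  then show ?thesis by (simp add: Pz_F4 cnj_dz_q dz_cnj smooth_c)
qed

lemma Db_Db:
  assumes "normal_field \<xi>"
  shows "Db (Db \<xi>) p = perp p (vdzbar (vdzbar \<xi>) p)"
proof -
  note s = normal_fieldD(1)[OF assms]
  have "Db \<xi> = (\<lambda>p. cnj_clor (D (\<lambda>q. cnj_clor (\<xi> q)) p))"
    using D_cnj[OF s] by auto
  then have "Db (Db \<xi>) p = Db (\<lambda>p. cnj_clor (D (\<lambda>q. cnj_clor (\<xi> q)) p)) p" by (rule arg_cong)
  also have "\<dots> = cnj_clor (D (D (\<lambda>q. cnj_clor (\<xi> q))) p)"
    by (rule Db_cnj) (rule normal_fieldD(1)[OF normal_field_D[OF normal_field_cnj[OF assms]]])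
  also have "\<dots> = perp p (cnj_clor (vdz (vdz (\<lambda>q. cnj_clor (\<xi> q))) p))"
    by (simp add: D_D[OF normal_field_cnj[OF assms]] cnj_perp)
  also have "vdz (\<lambda>q. cnj_clor (\<xi> q)) = (\<lambda>p. cnj_clor (vdzbar \<xi> p))"
    using vdz_cnj[OF s] by auto
  also have "cnj_clor (vdz (\<lambda>p. cnj_clor (vdzbar \<xi> p)) p) = vdzbar (vdzbar \<xi>) p"
    by (simp add: vdz_cnj smooth s)
  finally show ?thesis .
qed

lemma perp_F4: "perp p (F4 p) = Db (Db \<kappa>) p - (c p / 2) *\<^sub>L \<kappa>b p"
proof -
  let ?d = "dzbar (\<lambda>q. c q / 2)"
  have "vdz N = (\<lambda>p. vdzbar \<kappa> p - (?d p *\<^sub>L \<Psi> p + (c p / 2) *\<^sub>L Pb p))"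
    using vdz_N by blast
  then have "F4 p = vdzbar (\<lambda>p. vdzbar \<kappa> p - (?d p *\<^sub>L \<Psi> p + (c p / 2) *\<^sub>L Pb p)) p"
    by (simp only:)
  also have "\<dots> = vdzbar (vdzbar \<kappa>) p - vdzbar (\<lambda>p. ?d p *\<^sub>L \<Psi> p + (c p / 2) *\<^sub>L Pb p) p"
    by (intro vdzbar_diff smooth)
  also have "vdzbar (\<lambda>p. ?d p *\<^sub>L \<Psi> p + (c p / 2) *\<^sub>L Pb p) p
      = vdzbar (\<lambda>p. ?d p *\<^sub>L \<Psi> p) p + vdzbar (\<lambda>p. (c p / 2) *\<^sub>L Pb p) p"
    by (intro vdzbar_add smooth)
  also have "vdzbar (\<lambda>p. ?d p *\<^sub>L \<Psi> p) p = dzbar ?d p *\<^sub>L \<Psi> p + ?d p *\<^sub>L Pb p"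
    by (intro vdzbar_scale smooth)
  also have "vdzbar (\<lambda>p. (c p / 2) *\<^sub>L Pb p) p = ?d p *\<^sub>L Pb p + (c p / 2) *\<^sub>L vdzbar Pb p"
    by (intro vdzbar_scale smooth)
  finally show ?thesis
    by (simp add: perp_linear perp_Pbb scale_clor_simps Db_Db[OF normal_field_kappa])
qed

text \<open>The Euler--Lagrange operator of the Willmore energy. Its reality, the Codazzi equation, is visible
  in \<open>E_F4\<close> because \<open>F4\<close> is real.\<close>

definition E :: "complex \<Rightarrow> 'n clor" where
  "E p = Db (Db \<kappa>) p + (cnj (c p) / 2) *\<^sub>L \<kappa> p"

lemma E_F4: "E p = perp p (F4 p) + (c p / 2) *\<^sub>L \<kappa>b p + (cnj (c p) / 2) *\<^sub>L \<kappa> p"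
  by (simp add: E_def perp_F4)

lemma cnj_E: "cnj_clor (E p) = E p"
  by (simp add: E_F4 cnj_perp)

lemma normal_field_E: "smooth_on E UNIV" "periodic E"
proof -
  note n = normal_fieldD[OF normal_field_Db[OF normal_field_Db[OF normal_field_kappa]]]
  show "smooth_on E UNIV" unfolding E_def[abs_def] by (intro smooth n)
  show "periodic E" using n(2) on_torus_c normal_fieldD(2)[OF normal_field_kappa]
    by (simp add: on_torus_def E_def)
qed

subsection \<open>Conservation of the Willmore energy\<close>

definition flat :: bool where
  "flat \<longleftrightarrow> (\<forall>\<xi>. normal_field \<xi> \<longrightarrow> (\<forall>p. D (Db \<xi>) p = Db (D \<xi>) p))"

text \<open>This is the Ricci equation for the normal field \<open>\<kappa>\<close> itself.\<close>

lemma flat_kappa: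
  assumes flat
  shows "h p *\<^sub>L \<kappa>b p = q p *\<^sub>L \<kappa> p"
proof -
  have "(2 * q p) *\<^sub>L \<kappa> p = (2 * h p) *\<^sub>L \<kappa>b p"
    using ricci[OF normal_field_kappa, of p] assms normal_field_kappa
    by (simp add: flat_def h_def kappa_kappabar)
  then have "(1/2) *\<^sub>L (2 * q p) *\<^sub>L \<kappa> p = (1/2) *\<^sub>L (2 * h p) *\<^sub>L \<kappa>b p" by (rule arg_cong)
  then show ?thesis by (simp add: scale_clor_simps)
qed

text \<open>The second derivatives integrate away: \<open>\<langle>D \<kappa>, D' D' \<kappa>\<rangle>\<close> is a total derivative minus
  \<open>\<langle>D' D \<kappa>, D' \<kappa>\<rangle>\<close>, and since \<open>D'\<close> and \<open>D\<close> commute the latter is half the derivative of \<open>\<langle>D' \<kappa>, D' \<kappa>\<rangle>\<close>.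
  Up to a total derivative the remaining term is \<open>- c'\<^sub>z h / 4\<close>; the Gauss equation and \<open>flat_kappa\<close> give
  \<open>c'\<^sub>z h = 2 (q h)\<^sub>z\<^sub>'\<close>.\<close>

lemma D_kappa_E:
  assumes flat
  shows "lorentz (D \<kappa> p) (E p)
    = dz (\<lambda>p. (-1/2) * lorentz (Db \<kappa> p) (Db \<kappa> p) + (1/4) * (cnj (c p) * h p)) p
      + dzbar (\<lambda>p. lorentz (D \<kappa> p) (Db \<kappa> p) + (-1/2) * (q p * h p)) p"
proof -
  let ?cb = "\<lambda>p. cnj (c p)"
  note sD = normal_fieldD(1)[OF normal_field_D[OF normal_field_kappa]]
    and sDb = normal_fieldD(1)[OF normal_field_Db[OF normal_field_kappa]]
  have 1: "dzbar (\<lambda>p. lorentz (D \<kappa> p) (Db \<kappa> p)) p = lorentz (Db (D \<kappa>) p) (Db \<kappa> p) + lorentz (D \<kappa> p) (Db (Db \<kappa>) p)"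
    by (rule dz_lorentz_normal(2)) (rule normal_fields)+
  have 2: "dz (\<lambda>p. lorentz (Db \<kappa> p) (Db \<kappa> p)) p = 2 * lorentz (Db (D \<kappa>) p) (Db \<kappa> p)"
  proof -
    have "D (Db \<kappa>) p = Db (D \<kappa>) p" using assms normal_field_kappa by (simp add: flat_def)
    then show ?thesis using dz_lorentz_normal(1)[of "Db \<kappa>" "Db \<kappa>" p] normal_fields by (simp add: lorentz_sym)
  qed
  have 3: "dz (\<lambda>p. ?cb p * h p) p = dz ?cb p * h p + ?cb p * dz h p"
    by (intro dz_mult smooth smooth_h)
  have 4: "dzbar (\<lambda>p. q p * h p) p = dzbar q p * h p + q p * dzbar h p"
    by (intro dzbar_mult smooth smooth_h)
  have 5: "dz ?cb p * h p = 2 * q p * dzbar h p + 2 * dzbar q p * h p"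
  proof -
    have "h p * lorentz (\<kappa>b p) (Db \<kappa> p) = lorentz (h p *\<^sub>L \<kappa>b p) (Db \<kappa> p)" by (simp add: lorentz_linear)
    also have "\<dots> = q p * lorentz (\<kappa> p) (Db \<kappa> p)" by (simp only: flat_kappa[OF assms] lorentz_linear)
    also have "\<dots> = q p * dzbar h p / 2" by (simp add: dzbar_h lorentz_sym)
    finally have e: "h p * (dz ?cb p / 4 - dzbar q p / 2) = q p * dzbar h p / 2"
      by (simp only: lorentz_D_right(2)[OF normal_kappa(2)] gauss_cnj)
    have "dz ?cb p * h p = 4 * (h p * (dz ?cb p / 4 - dzbar q p / 2)) + 2 * dzbar q p * h p"
      by (simp add: field_simps)
    then show ?thesis unfolding e by simp
  qed
  have "dz (\<lambda>p. (-1/2) * lorentz (Db \<kappa> p) (Db \<kappa> p) + (1/4) * (?cb p * h p)) p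
      = dz (\<lambda>p. (-1/2) * lorentz (Db \<kappa> p) (Db \<kappa> p)) p + dz (\<lambda>p. (1/4) * (?cb p * h p)) p"
    by (intro dz_add smooth smooth_h sDb)
  also have "dz (\<lambda>p. (-1/2) * lorentz (Db \<kappa> p) (Db \<kappa> p)) p = (-1/2) * dz (\<lambda>p. lorentz (Db \<kappa> p) (Db \<kappa> p)) p"
    by (intro dz_mult_const smooth sDb)
  also have "dz (\<lambda>p. (1/4) * (?cb p * h p)) p = (1/4) * dz (\<lambda>p. ?cb p * h p) p"
    by (intro dz_mult_const smooth smooth_h)
  finally have A: "dz (\<lambda>p. (-1/2) * lorentz (Db \<kappa> p) (Db \<kappa> p) + (1/4) * (?cb p * h p)) p
      = (-1/2) * dz (\<lambda>p. lorentz (Db \<kappa> p) (Db \<kappa> p)) p + (1/4) * dz (\<lambda>p. ?cb p * h p) p" .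
  have "dzbar (\<lambda>p. lorentz (D \<kappa> p) (Db \<kappa> p) + (-1/2) * (q p * h p)) p
      = dzbar (\<lambda>p. lorentz (D \<kappa> p) (Db \<kappa> p)) p + dzbar (\<lambda>p. (-1/2) * (q p * h p)) p"
    by (intro dzbar_add smooth smooth_h sDb sD)
  also have "dzbar (\<lambda>p. (-1/2) * (q p * h p)) p = (-1/2) * dzbar (\<lambda>p. q p * h p) p"
    by (intro dz_mult_const smooth smooth_h)
  finally have B: "dzbar (\<lambda>p. lorentz (D \<kappa> p) (Db \<kappa> p) + (-1/2) * (q p * h p)) p
      = dzbar (\<lambda>p. lorentz (D \<kappa> p) (Db \<kappa> p)) p + (-1/2) * dzbar (\<lambda>p. q p * h p) p" .
  have e: "lorentz (D \<kappa> p) (E p) = lorentz (D \<kappa> p) (Db (Db \<kappa>) p) + ?cb p * dz h p / 4"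
    by (simp add: E_def lorentz_linear dz_h)
  show ?thesis unfolding e A B 1 2 3 4 5 by (simp add: field_simps)
qed

lemma torus_integral_sigma_E:
  assumes flat
  shows "integ (\<lambda>p. lorentz (\<sigma> p) (E p)) = 0"
proof -
  note nD = normal_fieldD[OF normal_field_D[OF normal_field_kappa]]
    and nDb = normal_fieldD[OF normal_field_Db[OF normal_field_kappa]]
  have X: "integ (\<lambda>p. lorentz (D \<kappa> p) (E p)) = 0"
    unfolding D_kappa_E[OF assms]
    using nD(2) nDb(2) on_torus_c on_torus_q on_torus_h
    by (intro torus_integral_total_derivative smooth smooth_h nD(1) nDb(1)) (simp_all add: on_torus_def)
  have "lorentz (\<sigma> p) (E p) = (1/2) * lorentz (D \<kappa> p) (E p) + (1/2) * cnj (lorentz (D \<kappa> p) (E p))" for p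
    using Db_cnj[OF smooth_kappa, of p] by (simp add: \<sigma>_def lorentz_linear cnj_lorentz cnj_E algebra_simps)
  then have "integ (\<lambda>p. lorentz (\<sigma> p) (E p))
     = integ (\<lambda>p. (1/2) * lorentz (D \<kappa> p) (E p) + (1/2) * cnj (lorentz (D \<kappa> p) (E p)))"
    by presburger
  also have "\<dots> = integ (\<lambda>p. (1/2) * lorentz (D \<kappa> p) (E p))
      + integ (\<lambda>p. (1/2) * cnj (lorentz (D \<kappa> p) (E p)))"
    by (intro torus_integral_add smooth_on_continuous_on smooth nD(1) normal_field_E)
  also have "\<dots> = 0" unfolding torus_integral_cmult torus_integral_cnj X by simp
  finally show ?thesis .
qed

text \<open>For a conformal deformation with normal part \<open>\<sigma>\<close>, the first variation of the energy is the
  integral of \<open>\<langle>\<sigma>, E\<rangle>\<close> up to total derivatives: the tangential part of \<open>\<Phi>\<close> contributes exactly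
  the terms that complete \<open>perp F4\<close> to \<open>E\<close>.\<close>

lemma first_variation:
  assumes s: "smooth_on \<Phi> UNIV" and per: "periodic \<Phi>"
    and dec: "\<And>p. \<Phi> p = a p *\<^sub>L \<Psi> p + b p *\<^sub>L Pz p + cnj (b p) *\<^sub>L Pb p + \<sigma> p"
    and zz: "\<And>p. lorentz (vdz \<Phi> p) (Pz p) = 0"
    and zzbar: "\<And>p. lorentz (vdz \<Phi> p) (Pb p) + lorentz (Pz p) (vdzbar \<Phi> p) = 0"
    and fl: flat
  shows "integ (\<lambda>p. lorentz (vdz (vdzbar \<Phi>) p) (N p)) = 0"
proof -
  let ?bb = "\<lambda>p. cnj (b p)" and ?cb = "\<lambda>p. cnj (c p)"
  note n = normalD[OF normal_sigma]
  have b: "b = (\<lambda>p. 2 * lorentz (\<Phi> p) (Pb p))" and bb: "?bb = (\<lambda>p. 2 * lorentz (\<Phi> p) (Pz p))"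
    and a: "a = (\<lambda>p. -2 * lorentz (\<Phi> p) (N p))"
    using dec by (auto simp: lorentz_linear n)
  have sb: "smooth_on b UNIV" by (subst b) (intro smooth s)
  have perb: "periodic b" using per on_torus_frame by (subst b) (simp add: on_torus_def)
  have Pzz: "lorentz (\<Phi> p) (Pzz p) = lorentz (\<sigma> p) (\<kappa> p)" for p
  proof -
    have "lorentz (\<sigma> p) (\<kappa> p) = lorentz (\<sigma> p) (Pzz p)" by (simp add: \<kappa>_def lorentz_linear n)
    moreover have "lorentz (\<Psi> p) (Pzz p) = 0" "lorentz (Pz p) (Pzz p) = 0" "lorentz (Pb p) (Pzz p) = 0"
      by (simp_all add: lorentz_sym[of _ "Pzz p"])
    ultimately show ?thesis using dec[of p] by (simp add: lorentz_linear)
  qed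
  have dzbb: "dz ?bb p = 2 * lorentz (\<sigma> p) (\<kappa> p)" for p
  proof -
    have "dz ?bb p = 2 * dz (\<lambda>p. lorentz (\<Phi> p) (Pz p)) p"
      unfolding bb by (intro dz_mult_const smooth s)
    also have "dz (\<lambda>p. lorentz (\<Phi> p) (Pz p)) p = lorentz (vdz \<Phi> p) (Pz p) + lorentz (\<Phi> p) (Pzz p)"
      by (intro dz_lorentz smooth s)
    finally show ?thesis by (simp add: zz Pzz)
  qed
  have dzbarb: "dzbar b p = 2 * lorentz (\<sigma> p) (\<kappa>b p)" for p
  proof -
    have "dzbar b p = cnj (dz ?bb p)" using dz_cnj[OF sb, of p] by simp
    then show ?thesis by (simp add: dzbb cnj_lorentz cnj_sigma)
  qed
  have a_eq: "a p = - (1/2) * (dz b p + dzbar ?bb p)" for p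
  proof -
    have "dz b p = 2 * dz (\<lambda>p. lorentz (\<Phi> p) (Pb p)) p"
      by (subst b) (intro dz_mult_const smooth s)
    also have "dz (\<lambda>p. lorentz (\<Phi> p) (Pb p)) p = lorentz (vdz \<Phi> p) (Pb p) + lorentz (\<Phi> p) (N p)"
      by (intro dz_lorentz smooth s)
    finally have 1: "dz b p = 2 * (lorentz (vdz \<Phi> p) (Pb p) + lorentz (\<Phi> p) (N p))" .
    have "dzbar ?bb p = 2 * dzbar (\<lambda>p. lorentz (\<Phi> p) (Pz p)) p"
      unfolding bb by (intro dz_mult_const smooth s)
    also have "dzbar (\<lambda>p. lorentz (\<Phi> p) (Pz p)) p = lorentz (vdzbar \<Phi> p) (Pz p) + lorentz (\<Phi> p) (vdzbar Pz p)"
      by (intro dzbar_lorentz smooth s)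
    finally have 2: "dzbar ?bb p = 2 * (lorentz (Pz p) (vdzbar \<Phi> p) + lorentz (\<Phi> p) (N p))"
      by (simp add: lorentz_sym[of "vdzbar \<Phi> p"])
    have "dz b p + dzbar ?bb p = 2 * (lorentz (vdz \<Phi> p) (Pb p) + lorentz (Pz p) (vdzbar \<Phi> p))
        + 4 * lorentz (\<Phi> p) (N p)"
      unfolding 1 2 by simp
    also have "\<dots> = 4 * lorentz (\<Phi> p) (N p)" by (simp only: zzbar) simp
    finally show ?thesis by (simp add: a)
  qed
  have sF: "lorentz (\<sigma> p) (F4 p) = lorentz (\<sigma> p) (E p) - (c p / 4) * dzbar b p - (?cb p / 4) * dz ?bb p" for p
  proof -
    have "lorentz (\<sigma> p) (E p) = lorentz (\<sigma> p) (F4 p) + (c p / 2) * lorentz (\<sigma> p) (\<kappa>b p) + (?cb p / 2) * lorentz (\<sigma> p) (\<kappa> p)"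
      by (simp add: E_F4 lorentz_linear lorentz_perp_right[OF normal_sigma])
    then show ?thesis by (simp add: dzbb dzbarb)
  qed
  let ?f1 = "\<lambda>p. (-1/2) * (b p * q p)" and ?f2 = "\<lambda>p. (-1/4) * (?bb p * ?cb p)"
    and ?g1 = "\<lambda>p. (-1/2) * (?bb p * q p)" and ?g2 = "\<lambda>p. (-1/4) * (b p * c p)"
  have d: "dz ?f1 p = (-1/2) * (dz b p * q p + b p * dz q p)"
      "dz ?f2 p = (-1/4) * (dz ?bb p * ?cb p + ?bb p * dz ?cb p)"
      "dzbar ?g1 p = (-1/2) * (dzbar ?bb p * q p + ?bb p * dzbar q p)"
      "dzbar ?g2 p = (-1/4) * (dzbar b p * c p + b p * dzbar c p)" for p
    by (simp_all only: dz_mult_const[OF smooth_on_mult[OF open_UNIV sb smooth_q]]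
        dz_mult_const[OF smooth_on_mult[OF open_UNIV sb smooth_c]]
        dz_mult_const[OF smooth_on_mult[OF open_UNIV smooth_on_cnj[OF open_UNIV sb] smooth_q]]
        dz_mult_const[OF smooth_on_mult[OF open_UNIV smooth_on_cnj[OF open_UNIV sb] smooth_on_cnj[OF open_UNIV smooth_c]]]
        dz_mult[OF sb smooth_q] dzbar_mult[OF sb smooth_c]
        dzbar_mult[OF smooth_on_cnj[OF open_UNIV sb] smooth_q]
        dz_mult[OF smooth_on_cnj[OF open_UNIV sb] smooth_on_cnj[OF open_UNIV smooth_c]])
  have PF: "lorentz (\<Phi> p) (F4 p) = (dz ?f1 p + dz ?f2 p) + (dzbar ?g1 p + dzbar ?g2 p) + lorentz (\<sigma> p) (E p)" for p
  proof -
    have e: "lorentz (\<Phi> p) (F4 p) = a p * lorentz (\<Psi> p) (F4 p) + b p * lorentz (Pz p) (F4 p)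
        + ?bb p * lorentz (Pb p) (F4 p) + lorentz (\<sigma> p) (F4 p)"
      using dec[of p] by (simp add: lorentz_linear)
    show ?thesis unfolding e P_F4 Pz_F4 Pb_F4 sF a_eq d by (simp add: field_simps)
  qed
  let ?f3 = "\<lambda>p. lorentz (vdzbar \<Phi> p) (N p)" and ?g3 = "\<lambda>p. (-1) * lorentz (\<Phi> p) (vdz N p)"
  have parts: "lorentz (vdz (vdzbar \<Phi>) p) (N p) = dz ?f3 p + dzbar ?g3 p + lorentz (\<Phi> p) (F4 p)" for p
  proof -
    have "dz ?f3 p = lorentz (vdz (vdzbar \<Phi>) p) (N p) + lorentz (vdzbar \<Phi> p) (vdz N p)"
      by (intro dz_lorentz smooth s)
    moreover have "dzbar ?g3 p = (-1) * dzbar (\<lambda>p. lorentz (\<Phi> p) (vdz N p)) p"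
      by (intro dz_mult_const smooth s)
    moreover have "dzbar (\<lambda>p. lorentz (\<Phi> p) (vdz N p)) p = lorentz (vdzbar \<Phi> p) (vdz N p) + lorentz (\<Phi> p) (F4 p)"
      by (intro dzbar_lorentz smooth s)
    ultimately show ?thesis by simp
  qed
  let ?f = "\<lambda>p. ?f3 p + (?f1 p + ?f2 p)" and ?g = "\<lambda>p. ?g3 p + (?g1 p + ?g2 p)"
  have "dz ?f p = dz ?f3 p + dz (\<lambda>p. ?f1 p + ?f2 p) p" for p
    by (intro dz_add smooth s sb)
  moreover have "dz (\<lambda>p. ?f1 p + ?f2 p) p = dz ?f1 p + dz ?f2 p" for p
    by (intro dz_add smooth s sb)
  moreover have "dzbar ?g p = dzbar ?g3 p + dzbar (\<lambda>p. ?g1 p + ?g2 p) p" for p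
    by (intro dzbar_add smooth s sb)
  moreover have "dzbar (\<lambda>p. ?g1 p + ?g2 p) p = dzbar ?g1 p + dzbar ?g2 p" for p
    by (intro dzbar_add smooth s sb)
  ultimately have "lorentz (vdz (vdzbar \<Phi>) p) (N p) = (dz ?f p + dzbar ?g p) + lorentz (\<sigma> p) (E p)" for p
    unfolding parts PF by (simp only: add_ac)
  moreover have sf: "smooth_on ?f UNIV" and sg: "smooth_on ?g UNIV"
    by (intro smooth s sb)+
  moreover have "integ (\<lambda>p. (dz ?f p + dzbar ?g p) + lorentz (\<sigma> p) (E p))
      = integ (\<lambda>p. dz ?f p + dzbar ?g p) + integ (\<lambda>p. lorentz (\<sigma> p) (E p))"
    by (intro torus_integral_add smooth_on_continuous_on smooth_on_add open_UNIV smooth_on_dz[OF sf]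
        smooth_on_dzbar[OF sg] smooth_on_clor smooth_sigma normal_field_E)
  moreover have "integ (\<lambda>p. dz ?f p + dzbar ?g p) = 0"
  proof (rule torus_integral_total_derivative[OF _ sf _ sg])
    have "periodic (vdzbar \<Phi>)" "periodic (vdz N)"
      by (intro vdz_periodic per s on_torus_frame smooth)+
    then show "periodic ?f" "periodic ?g"
      using per perb on_torus_frame on_torus_q on_torus_c by (simp_all add: on_torus_def)
  qed
  ultimately show ?thesis using torus_integral_sigma_E[OF fl] by simp
qed

end

section \<open>The normalized lift\<close>

lemma lorentz_real: "lorentz v w = - fst v * fst w + snd v \<bullet> snd w" for v w :: "'n::finite lor"
  by (simp add: lorentz_def inner_vec_def)

lemma lorentz_scaleR: "lorentz (r *\<^sub>R v) w = r * lorentz v w" "lorentz v (r *\<^sub>R w) = r * lorentz v w"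
  for v w :: "'n::finite lor"
  by (simp_all add: lorentz_real algebra_simps)

definition lift_formula :: "(complex \<Rightarrow> (real, 'n::finite) vec) \<Rightarrow> complex \<Rightarrow> 'n lor" where
  "lift_formula f p =
     inverse (sqrt (frechet_derivative f (at p) 1 \<bullet> frechet_derivative f (at p) 1)) *\<^sub>R (1, f p)"

lemma smooth_on_Pair:
  "open S \<Longrightarrow> smooth_on f S \<Longrightarrow> smooth_on g S \<Longrightarrow> smooth_on (\<lambda>x. (f x, g x)) S"
proof -
  assume a: "open S" "smooth_on f S" "smooth_on g S"
  have "smooth_on (\<lambda>x. (f x, 0) + (0, g x)) S"
    by (intro smooth_on_add a smooth_on_bounded_linear[OF _ a(1,2)] smooth_on_bounded_linear[OF _ a(1,3)]
        bounded_linear_Pair bounded_linear_ident bounded_linear_zero)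
  then show ?thesis by simp
qed

context
  fixes \<omega>1 \<omega>2 :: complex and f :: "complex \<Rightarrow> (real, 'n::finite) vec"
  assumes f: "conformal_immersion \<omega>1 \<omega>2 f"
begin

private abbreviation "f' p \<equiv> frechet_derivative f (at p)"

lemma immersion_smooth: "smooth_on f UNIV"
  using f by (simp add: conformal_immersion_def)

lemma immersion_unit: "f p \<bullet> f p = 1"
  using f by (simp add: conformal_immersion_def dot_square_norm)

lemma immersion_orthogonal: "f p \<bullet> f' p v = 0"
proof -
  note D = smooth_on_UNIV_has_derivative[OF immersion_smooth, of p]
  have "((\<lambda>p. f p \<bullet> f p) has_derivative (\<lambda>v. f p \<bullet> f' p v + f' p v \<bullet> f p)) (at p)"
    by (rule has_derivative_inner[OF D D])
  then have "((\<lambda>p. 1) has_derivative (\<lambda>v. f p \<bullet> f' p v + f' p v \<bullet> f p)) (at p)"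
    by (simp only: immersion_unit)
  then have "(\<lambda>v. f p \<bullet> f' p v + f' p v \<bullet> f p) = (\<lambda>v. 0)"
    by (rule has_derivative_unique) (rule has_derivative_const)
  then have "f p \<bullet> f' p v + f' p v \<bullet> f p = 0" by (rule fun_cong)
  then show ?thesis by (simp add: inner_commute)
qed

lemma immersion_conformal: "f' p v \<bullet> f' p w = (f' p 1 \<bullet> f' p 1) * (v \<bullet> w)"
  and immersion_factor_pos: "f' p 1 \<bullet> f' p 1 > 0"
proof -
  obtain r where r: "r > 0" "\<forall>v w. f' p v \<bullet> f' p w = r * (v \<bullet> w)"
    using f unfolding conformal_immersion_def by blast
  have "f' p 1 \<bullet> f' p 1 = r" using r(2)[rule_format, of 1 1] by simp
  then show "f' p v \<bullet> f' p w = (f' p 1 \<bullet> f' p 1) * (v \<bullet> w)" "f' p 1 \<bullet> f' p 1 > 0"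
    using r by simp_all
qed

text \<open>Along \<open>(1, f)\<close> the form is degenerate, so only the derivative of \<open>f\<close> contributes to the metric
  of a lift \<open>\<mu> (1, f)\<close>.\<close>

lemma lift_metric:
  assumes "smooth_on \<mu> UNIV" and phi: "\<phi> = (\<lambda>p. \<mu> p *\<^sub>R (1, f p))"
  shows "lorentz (frechet_derivative \<phi> (at p) v) (frechet_derivative \<phi> (at p) v)
    = (\<mu> p)\<^sup>2 * (f' p 1 \<bullet> f' p 1) * (norm v)\<^sup>2"
proof -
  note D = smooth_on_UNIV_has_derivative[OF immersion_smooth, of p]
    and M = smooth_on_UNIV_has_derivative[OF assms(1), of p]
  have "((\<lambda>p. \<mu> p *\<^sub>R (1 :: real, f p)) has_derivative
      (\<lambda>v. \<mu> p *\<^sub>R (0, f' p v) + frechet_derivative \<mu> (at p) v *\<^sub>R (1, f p))) (at p)"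
    by (intro has_derivative_scaleR M has_derivative_Pair D has_derivative_const)
  then have "frechet_derivative \<phi> (at p) v = \<mu> p *\<^sub>R (0, f' p v) + frechet_derivative \<mu> (at p) v *\<^sub>R (1, f p)"
    unfolding phi by (rule fun_cong[OF frechet_derivative_at[symmetric]])
  then show ?thesis
    using immersion_unit[of p] immersion_orthogonal[of p v] immersion_orthogonal[of p v, unfolded inner_commute[of "f p"]]
      immersion_conformal[of p v v]
    by (simp add: lorentz_real inner_add_left inner_add_right power2_norm_eq_inner)
       (simp add: algebra_simps power2_eq_square)
qed

lemma smooth_lift_factor:
  "smooth_on (\<lambda>p. inverse (sqrt (f' p 1 \<bullet> f' p 1))) UNIV"
  by (intro smooth_on_inverse_sqrt open_UNIV immersion_factor_pos
      smooth_on_bilinear[OF bounded_bilinear_inner] smooth_on_frechet_derivative immersion_smooth)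

lemma lift_formula_is_lift: "is_normalized_lift f (lift_formula f)"
proof -
  let ?\<mu> = "\<lambda>p. inverse (sqrt (f' p 1 \<bullet> f' p 1))"
  have e: "lift_formula f = (\<lambda>p. ?\<mu> p *\<^sub>R (1, f p))" by (auto simp: lift_formula_def)
  have pos: "?\<mu> p > 0" for p using immersion_factor_pos by simp
  have "smooth_on (lift_formula f) UNIV" unfolding e
    by (intro smooth_on_bilinear[OF bounded_bilinear_scaleR] smooth_lift_factor open_UNIV smooth_on_Pair
        smooth_on_const immersion_smooth)
  moreover have "lift_formula f p \<in> forward_light_cone" for p
    using pos[of p] immersion_unit[of p] by (simp add: e forward_light_cone_def lorentz_scaleR) (simp add: lorentz_real)
  moreover have "span {lift_formula f p} = span {(1, f p)}" for p
    unfolding e using pos[of p] span_image_scale[of "{(1, f p)}" "\<lambda>_. ?\<mu> p"] by (simp del: scaleR_Pair)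
  moreover have "(?\<mu> p)\<^sup>2 * (f' p 1 \<bullet> f' p 1) = 1" for p
    using immersion_factor_pos[of p] by (simp add: power_inverse)
  ultimately show ?thesis
    using lift_metric[OF smooth_lift_factor e] unfolding is_normalized_lift_def by simp
qed

lemma normalized_lift_unique:
  assumes "is_normalized_lift f \<phi>"
  shows "\<phi> = lift_formula f"
proof
  fix p
  have sm: "smooth_on \<phi> UNIV" using assms by (simp add: is_normalized_lift_def)
  have phi: "\<phi> p = fst (\<phi> p) *\<^sub>R (1, f p)" for p
  proof -
    have "\<phi> p \<in> span {\<phi> p}" by (simp add: span_base)
    then have "\<phi> p \<in> span {(1, f p)}" using assms by (simp add: is_normalized_lift_def)
    then obtain k where "\<phi> p = k *\<^sub>R (1, f p)" by (auto simp: span_singleton)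
    then show ?thesis by simp
  qed
  have pos: "fst (\<phi> p) > 0" using assms by (simp add: is_normalized_lift_def forward_light_cone_def)
  have s: "smooth_on (\<lambda>p. fst (\<phi> p)) UNIV"
    by (rule smooth_on_bounded_linear[OF bounded_linear_fst open_UNIV sm])
  have "\<phi> = (\<lambda>p. fst (\<phi> p) *\<^sub>R (1, f p))" using phi by blast
  from lift_metric[OF s this, of p 1] have "(fst (\<phi> p))\<^sup>2 * (f' p 1 \<bullet> f' p 1) = 1"
    using assms by (simp add: is_normalized_lift_def)
  then have "(fst (\<phi> p))\<^sup>2 = inverse (f' p 1 \<bullet> f' p 1)"
    using immersion_factor_pos[of p] by (simp add: field_simps)
  then have "fst (\<phi> p) = inverse (sqrt (f' p 1 \<bullet> f' p 1))"
    using pos real_sqrt_unique[of "fst (\<phi> p)"] by (simp add: real_sqrt_inverse)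
  then show "\<phi> p = lift_formula f p" using phi[of p] by (simp add: lift_formula_def)
qed

lemma normalized_lift_eq: "normalized_lift f = lift_formula f"
  unfolding normalized_lift_def
  using lift_formula_is_lift normalized_lift_unique by (rule the_equality)

lemma normalized_lift_is_lift: "is_normalized_lift f (normalized_lift f)"
  using lift_formula_is_lift by (simp add: normalized_lift_eq)

lemma normalized_lift_periodic: "on_torus \<omega>1 \<omega>2 (normalized_lift f)"
proof -
  have "on_torus \<omega>1 \<omega>2 f" using f by (simp add: conformal_immersion_def)
  then show ?thesis using on_torus_frechet_derivative[OF _ immersion_smooth, of \<omega>1 \<omega>2 1]
    by (simp add: on_torus_def normalized_lift_eq lift_formula_def)
qed

end

section \<open>The invariants of an immersion\<close>

lemma to_clor_linear:
  "to_clor (v + w) = to_clor v + to_clor w" "to_clor (v - w) = to_clor v - to_clor w" "to_clor 0 = 0"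
  "to_clor (r *\<^sub>R v) = of_real r *\<^sub>L to_clor v"
  by (simp_all add: clor_eq_iff to_clor_def scale_clor_def)

lemma lorentz_to_clor: "lorentz (to_clor v) (to_clor w) = of_real (lorentz v w)"
  by (simp add: lorentz_def to_clor_def)

lemma cnj_to_clor [simp]: "cnj_clor (to_clor v) = to_clor v"
  by (simp add: clor_eq_iff to_clor_def cnj_clor_def)

lemma Re_to_clor [simp]: "Re_clor (to_clor v) = v" "Im_clor (to_clor v) = 0"
  by (simp_all add: to_clor_def Re_clor_def Im_clor_def prod_eq_iff vec_eq_iff)

lemma to_clor_Re: "cnj_clor w = w \<Longrightarrow> to_clor (Re_clor w) = w"
  by (auto simp: clor_eq_iff to_clor_def Re_clor_def cnj_clor_def complex_eq_iff)

lemma clor_decomp: "w = to_clor (Re_clor w) + \<i> *\<^sub>L to_clor (Im_clor w)"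
  by (simp add: clor_eq_iff to_clor_def Re_clor_def Im_clor_def scale_clor_def complex_eq_iff)

lemma Re_clor_linear:
  "Re_clor (v + w) = Re_clor v + Re_clor w" "Im_clor (v + w) = Im_clor v + Im_clor w"
  "Re_clor (a *\<^sub>L w) = Re a *\<^sub>R Re_clor w - Im a *\<^sub>R Im_clor w"
  "Im_clor (a *\<^sub>L w) = Re a *\<^sub>R Im_clor w + Im a *\<^sub>R Re_clor w"
  by (simp_all add: Re_clor_def Im_clor_def scale_clor_def prod_eq_iff vec_eq_iff)

lemma lorentz_to_clor_eq_0:
  "lorentz w (to_clor v) = 0 \<longleftrightarrow> lorentz (Re_clor w) v = 0 \<and> lorentz (Im_clor w) v = 0"
proof -
  have "lorentz w (to_clor v) = of_real (lorentz (Re_clor w) v) + \<i> * of_real (lorentz (Im_clor w) v)"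
    by (subst (1) clor_decomp[of w]) (simp only: lorentz_linear lorentz_to_clor)
  then show ?thesis by (simp add: complex_eq_iff)
qed

text \<open>A complex vector is orthogonal to a real one exactly if its real and imaginary parts are, so
  membership in the complexified complement can be tested with the complex bilinear form.\<close>

lemma complexify_perp_span:
  fixes S :: "'n::finite lor set"
  shows "w \<in> complexify (lorentz_perp (span S)) \<longleftrightarrow> (\<forall>v\<in>S. lorentz w (to_clor v) = 0)"
proof -
  have *: "u \<in> lorentz_perp (span S) \<longleftrightarrow> (\<forall>v\<in>S. lorentz u v = 0)" for u :: "'n lor"
  proof
    assume a: "\<forall>v\<in>S. lorentz u v = 0"
    have "lorentz u v = 0" if "v \<in> span S" for v
      using that
    proof (induction rule: span_induct)
      case base
      show ?case unfolding subspace_def by (auto simp: lorentz_add_right lorentz_scaleR)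
    qed (use a in auto)
    then show "u \<in> lorentz_perp (span S)" by (simp add: lorentz_perp_def)
  qed (auto simp: lorentz_perp_def span_base)
  show ?thesis by (auto simp: complexify_def * lorentz_to_clor_eq_0)
qed

lemma complexify_combine:
  assumes "subspace U"
  shows "v \<in> complexify U \<Longrightarrow> w \<in> complexify U \<Longrightarrow> v + w \<in> complexify U"
    and "w \<in> complexify U \<Longrightarrow> a *\<^sub>L w \<in> complexify U"
    and "u \<in> U \<Longrightarrow> to_clor u \<in> complexify U"
  using assms by (auto simp: complexify_def Re_clor_linear subspace_add subspace_diff subspace_scale subspace_0)

locale immersion = torus \<omega>1 \<omega>2 for \<omega>1 \<omega>2 +
  fixes f :: "complex \<Rightarrow> (real, 'n::finite) vec"
  assumes immersion: "conformal_immersion \<omega>1 \<omega>2 f"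
begin

abbreviation "\<psi> \<equiv> normalized_lift f"
abbreviation "\<psi>' p \<equiv> frechet_derivative \<psi> (at p)"

lemma psi_smooth: "smooth_on \<psi> UNIV"
  and psi_null: "lorentz (\<psi> p) (\<psi> p) = 0"
  and psi_metric: "lorentz (\<psi>' p v) (\<psi>' p v) = (norm v)\<^sup>2"
  using normalized_lift_is_lift[OF immersion] by (auto simp: is_normalized_lift_def forward_light_cone_def)

lemma psi_has_derivative: "(\<psi> has_derivative \<psi>' p) (at p)"
  by (rule smooth_on_UNIV_has_derivative[OF psi_smooth])

lemma psi_metric_polar: "lorentz (\<psi>' p v) (\<psi>' p w) = v \<bullet> w"
proof -
  have "\<psi>' p (v + w) = \<psi>' p v + \<psi>' p w"
    by (rule linear_add[OF has_derivative_linear[OF psi_has_derivative]])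
  then have "lorentz (\<psi>' p (v + w)) (\<psi>' p (v + w)) = lorentz (\<psi>' p v) (\<psi>' p v)
      + 2 * lorentz (\<psi>' p v) (\<psi>' p w) + lorentz (\<psi>' p w) (\<psi>' p w)"
    by (simp add: lorentz_linear lorentz_sym[of "\<psi>' p w" "\<psi>' p v"])
  then show ?thesis unfolding psi_metric power2_norm_eq_inner
    by (simp add: inner_add_left inner_add_right inner_commute)
qed

lemma clift_has_derivative: "(clift f has_derivative (\<lambda>v. to_clor (\<psi>' p v))) (at p)"
  unfolding clift_def[abs_def] by (rule bounded_linear.has_derivative[OF bounded_linear_to_clor psi_has_derivative])

lemmas clift_derivatives = vdz_eq[OF clift_has_derivative] vdzbar_eq[OF clift_has_derivative]

sublocale conformal_lift \<omega>1 \<omega>2 "clift f"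
proof
  show "smooth_on (clift f) UNIV"
    unfolding clift_def[abs_def] by (rule smooth_on_bounded_linear[OF bounded_linear_to_clor open_UNIV psi_smooth])
  show "periodic (clift f)"
    using normalized_lift_periodic[OF immersion] by (simp add: on_torus_def clift_def)
  show "cnj_clor (clift f p) = clift f p" for p by (simp add: clift_def)
  show "lorentz (clift f p) (clift f p) = 0" for p by (simp add: clift_def lorentz_to_clor psi_null)
  show "lorentz (vdz (clift f) p) (vdz (clift f) p) = 0" for p
    unfolding clift_derivatives by (simp add: lorentz_linear lorentz_to_clor psi_metric_polar)
  show "lorentz (vdz (clift f) p) (vdzbar (clift f) p) = 1 / 2" for p
    unfolding clift_derivatives by (simp add: lorentz_linear lorentz_to_clor psi_metric_polar)
qed

lemma clift_derivative_frame: "to_clor (\<psi>' p v) = v *\<^sub>L Pz p + cnj v *\<^sub>L Pb p"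
proof -
  note lin = has_derivative_linear[OF psi_has_derivative, of p]
  have v: "Re v *\<^sub>R 1 + Im v *\<^sub>R \<i> = v" by (simp add: complex_eq_iff)
  have "\<psi>' p (Re v *\<^sub>R 1 + Im v *\<^sub>R \<i>) = Re v *\<^sub>R \<psi>' p 1 + Im v *\<^sub>R \<psi>' p \<i>"
    by (simp only: linear_add[OF lin] linear_scale[OF lin])
  then have "\<psi>' p v = Re v *\<^sub>R \<psi>' p 1 + Im v *\<^sub>R \<psi>' p \<i>" by (simp only: v)
  then have "to_clor (\<psi>' p v) = of_real (Re v) *\<^sub>L to_clor (\<psi>' p 1) + of_real (Im v) *\<^sub>L to_clor (\<psi>' p \<i>)"
    by (simp add: to_clor_linear)
  then show ?thesis unfolding clift_derivatives
    by (simp add: clor_eq_iff scale_clor_def complex_eq_iff field_simps)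
qed

lemma to_clor_Re_N: "to_clor (Re_clor (N p)) = N p"
  by (rule to_clor_Re) simp

lemma complexify_V_perp: "w \<in> complexify (V_perp f p) \<longleftrightarrow> normal_at p w"
proof -
  have "w \<in> complexify (V_perp f p) \<longleftrightarrow> lorentz w (clift f p) = 0
      \<and> (\<forall>v. lorentz w (to_clor (\<psi>' p v)) = 0) \<and> lorentz w (N p) = 0"
    unfolding V_bundle_def complexify_perp_span by (auto simp: clift_def to_clor_Re_N)
  also have "(\<forall>v. lorentz w (to_clor (\<psi>' p v)) = 0) \<longleftrightarrow> lorentz w (Pz p) = 0 \<and> lorentz w (Pb p) = 0"
  proof
    assume *: "\<forall>v. lorentz w (to_clor (\<psi>' p v)) = 0"
    show "lorentz w (Pz p) = 0 \<and> lorentz w (Pb p) = 0"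
      unfolding clift_derivatives using * by (simp add: lorentz_linear)
  qed (simp add: clift_derivative_frame lorentz_linear)
  finally show ?thesis by (auto simp: normal_at_def)
qed

text \<open>The projection kills the generators of \<open>V\<close>. With \<open>tang_V_bundle\<close> this shows that \<open>V\<close> is nondegenerate
  and identifies \<open>perp\<close> with the projection in the definition of the normal connection.\<close>

lemma perp_V_bundle:
  assumes "w \<in> complexify (V_bundle f p)"
  shows "perp p w = 0"
proof -
  have "perp p (to_clor v) = 0" if "v \<in> V_bundle f p" for v
    using that unfolding V_bundle_def
  proof (induction rule: span_induct)
    case base
    show ?case unfolding subspace_def
      by (auto simp: to_clor_linear perp_linear scale_clor_simps) (simp add: perp_def tang_def scale_clor_simps)
  next
    case (step v)
    then show ?case
    proof (elim UnE)
      assume "v \<in> {\<psi> p}"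
      then show ?thesis using perp_frame(1)[of p] by (simp add: clift_def[symmetric])
    next
      assume "v \<in> range (\<psi>' p)"
      then show ?thesis by (auto simp: clift_derivative_frame perp_linear scale_clor_simps)
    next
      assume "v \<in> {Re_clor (N p)}"
      then show ?thesis by (simp add: to_clor_Re_N)
    qed
  qed
  then have "perp p (to_clor (Re_clor w)) = 0" "perp p (to_clor (Im_clor w)) = 0"
    using assms by (simp_all add: complexify_def)
  then show ?thesis by (subst clor_decomp) (simp only: perp_linear scale_clor_simps add_0_left)
qed

lemma tang_V_bundle: "tang p w \<in> complexify (V_bundle f p)"
proof -
  have sub: "subspace (V_bundle f p)" unfolding V_bundle_def by (rule subspace_span)
  have 1: "clift f p \<in> complexify (V_bundle f p)"
    unfolding clift_def by (rule complexify_combine(3)[OF sub]) (simp add: V_bundle_def span_base)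
  have 2: "N p \<in> complexify (V_bundle f p)"
    using complexify_combine(3)[OF sub, of "Re_clor (N p)"] by (simp add: to_clor_Re_N V_bundle_def span_base)
  have 3: "to_clor (\<psi>' p v) \<in> complexify (V_bundle f p)" for v
    by (rule complexify_combine(3)[OF sub]) (simp add: V_bundle_def span_base)
  have z: "Pz p = (1/2) *\<^sub>L (to_clor (\<psi>' p 1) + (- \<i>) *\<^sub>L to_clor (\<psi>' p \<i>))"
    unfolding clift_derivatives by (simp add: scale_clor_simps)
  have 4: "Pz p \<in> complexify (V_bundle f p)"
    unfolding z by (intro complexify_combine(1,2)[OF sub] 3)
  have 5: "Pb p \<in> complexify (V_bundle f p)"
    unfolding clift_derivatives by (intro complexify_combine(1,2)[OF sub] 3)
  show ?thesis unfolding tang_def by (intro complexify_combine(1,2)[OF sub] 1 2 4 5)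
qed

lemma perp_proj_eq: "perp_proj (V_bundle f p) w = perp p w"
  unfolding perp_proj_def
proof (rule the_equality)
  have "w - perp p w = tang p w" by (simp add: perp_def)
  then show "perp p w \<in> complexify (V_perp f p) \<and> w - perp p w \<in> complexify (V_bundle f p)"
    using normal_perp tang_V_bundle by (simp add: complexify_V_perp)
  fix u assume u: "u \<in> complexify (V_perp f p) \<and> w - u \<in> complexify (V_bundle f p)"
  then have "perp p (w - u) = 0" by (intro perp_V_bundle) simp
  moreover have "perp p u = u" using u by (intro perp_normal) (simp add: complexify_V_perp)
  ultimately show "u = perp p w" by (simp add: perp_linear)
qed

lemma schwarzian_eq: "schwarzian f p = c p"
  unfolding schwarzian_def
proof (rule the_equality)
  show "Pzz p + (c p / 2) *\<^sub>L clift f p \<in> complexify (V_perp f p)"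
    using normal_kappa(1)[of p] by (simp add: complexify_V_perp \<kappa>_def)
  fix d assume "Pzz p + (d / 2) *\<^sub>L clift f p \<in> complexify (V_perp f p)"
  then have "lorentz (Pzz p + (d / 2) *\<^sub>L clift f p) (N p) = 0"
    by (simp add: complexify_V_perp normal_at_def)
  then show "d = c p" by (auto simp: lorentz_linear c_def mult.commute)
qed

lemma hopf_eq: "hopf f = \<kappa>"
  by (auto simp: hopf_def \<kappa>_def schwarzian_eq)

lemma D_z_eq: "D_z f = D" and D_zbar_eq: "D_zbar f = Db"
  by (auto simp: fun_eq_iff D_z_def D_zbar_def D_def Db_def perp_proj_eq)

lemma to_clor_NV_variation: "to_clor (NV_variation f p) = \<sigma> p"
proof -
  have "NV_variation f p = Re_clor (\<sigma> p)"
    by (simp add: NV_variation_def \<sigma>_def hopf_eq D_z_eq D_zbar_eq)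
  then show ?thesis using to_clor_Re[OF cnj_sigma] by simp
qed

lemma normal_section_iff: "normal_section \<omega>1 \<omega>2 f \<xi> \<longleftrightarrow> normal_field \<xi>"
  by (auto simp: normal_section_def normal_field_def complexify_V_perp)

lemma flat_iff: "flat_normal_bundle \<omega>1 \<omega>2 f \<longleftrightarrow> flat"
  by (simp add: flat_normal_bundle_def flat_def normal_section_iff D_z_eq D_zbar_eq)

lemma willmore_eq: "willmore \<omega>1 \<omega>2 f = Re (integ q)"
proof -
  have "willmore \<omega>1 \<omega>2 f = integ (\<lambda>p. Re (q p))"
    by (simp add: willmore_def hopf_eq kappa_kappabar)
  then show ?thesis using torus_integral_Re[OF smooth_on_continuous_on[OF smooth_q]] by simp
qed

lemma solves_dbar_iff: "solves_dbar \<omega>1 \<omega>2 f (NV_variation f) b \<longleftrightarrow>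
    periodic b \<and> smooth_on b UNIV \<and> (\<forall>p. dz (\<lambda>q. cnj (b q)) p = 2 * lorentz (\<sigma> p) (\<kappa> p))"
  by (simp add: solves_dbar_def to_clor_NV_variation hopf_eq)

theorem NV_dbar_problem:
  "\<exists>!b. solves_dbar \<omega>1 \<omega>2 f (NV_variation f) b \<and> integ b = 0"
proof (rule ex_ex1I)
  show "\<exists>b. solves_dbar \<omega>1 \<omega>2 f (NV_variation f) b \<and> integ b = 0"
    unfolding solves_dbar_iff using dbar_solution by metis
  fix b d
  assume b: "solves_dbar \<omega>1 \<omega>2 f (NV_variation f) b \<and> integ b = 0"
    and d: "solves_dbar \<omega>1 \<omega>2 f (NV_variation f) d \<and> integ d = 0"
  let ?u = "\<lambda>p. cnj (b p) + (-1) * cnj (d p)"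
  have sb: "smooth_on b UNIV" and sd: "smooth_on d UNIV" using b d by (simp_all add: solves_dbar_iff)
  have u: "periodic ?u" "smooth_on ?u UNIV"
    using b d by (simp add: solves_dbar_iff on_torus_def) (intro smooth sb sd)
  have "dz ?u p = dz (\<lambda>p. cnj (b p)) p + dz (\<lambda>p. (-1) * cnj (d p)) p" for p
    by (intro dz_add smooth sb sd)
  moreover have "dz (\<lambda>p. (-1) * cnj (d p)) p = (-1) * dz (\<lambda>p. cnj (d p)) p" for p
    by (intro dz_mult_const smooth sd)
  ultimately have "dz ?u = (\<lambda>p. 0)" using b d by (auto simp: solves_dbar_iff)
  moreover have "integ ?u = 0"
  proof -
    have "integ ?u = integ (\<lambda>p. cnj (b p)) + integ (\<lambda>p. (-1) * cnj (d p))"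
      by (intro torus_integral_add smooth_on_continuous_on smooth sb sd)
    then show ?thesis using b d by (simp only: torus_integral_cmult torus_integral_cnj) simp
  qed
  ultimately have "?u p = 0" for p by (rule dz_equation_unique[OF u])
  then show "b = d" by (simp add: fun_eq_iff)
qed

text \<open>The four directions of the frame together with two independent normal vectors would be six
  independent vectors in a space of dimension five.\<close>

lemma normal_rank_1:
  assumes "CARD('n) = 4" and x: "normal_at p (to_clor x)" and y: "normal_at p (to_clor y)" "y \<noteq> 0"
  obtains r where "x = r *\<^sub>R y"
proof -
  let ?L = "\<lambda>(s :: real, v :: complex, t :: real, k :: real, l :: real).
      s *\<^sub>R \<psi> p + \<psi>' p v + t *\<^sub>R Re_clor (N p) + k *\<^sub>R x + l *\<^sub>R y"
  have lin: "linear ?L"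
    using has_derivative_linear[OF psi_has_derivative, of p]
    by (intro linearI) (auto simp: linear_add linear_scale algebra_simps)
  have "\<not> inj ?L"
  proof
    assume "inj ?L"
    then have "dim (range ?L) = dim (UNIV :: (real \<times> complex \<times> real \<times> real \<times> real) set)"
      by (intro dim_image_eq lin) auto
    moreover have "dim (range ?L) \<le> dim (UNIV :: 'n lor set)" by (rule dim_subset_UNIV[THEN order_trans]) simp
    ultimately show False using assms(1) by simp
  qed
  then obtain z where "z \<noteq> 0" "?L z = 0" using linear_injective_0[OF lin] by blast
  then obtain s v t k l where nz: "(s, v, t, k, l) \<noteq> (0, 0, 0, 0, 0)"
    and "s *\<^sub>R \<psi> p + \<psi>' p v + t *\<^sub>R Re_clor (N p) + k *\<^sub>R x + l *\<^sub>R y = 0"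
    by (cases z) (auto simp: zero_prod_def)
  then have "to_clor (s *\<^sub>R \<psi> p + \<psi>' p v + t *\<^sub>R Re_clor (N p) + k *\<^sub>R x + l *\<^sub>R y) = 0"
    by (simp add: to_clor_linear)
  then have z: "of_real s *\<^sub>L clift f p + (v *\<^sub>L Pz p + cnj v *\<^sub>L Pb p) + of_real t *\<^sub>L N p
      + of_real k *\<^sub>L to_clor x + of_real l *\<^sub>L to_clor y = 0" (is "?z = 0")
    by (simp add: to_clor_linear clift_derivative_frame to_clor_Re_N clift_def)
  have "lorentz ?z (clift f p) = 0" "lorentz ?z (Pb p) = 0" "lorentz ?z (N p) = 0" by (simp_all add: z)
  then have "t = 0" "v = 0" "s = 0" using normalD[OF x] normalD[OF y(1)] by (auto simp: lorentz_linear)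
  then have kl: "k *\<^sub>R x + l *\<^sub>R y = 0" "(k, l) \<noteq> (0, 0)"
    using nz \<open>s *\<^sub>R \<psi> p + \<psi>' p v + t *\<^sub>R Re_clor (N p) + k *\<^sub>R x + l *\<^sub>R y = 0\<close>
      linear_0[OF has_derivative_linear[OF psi_has_derivative]] by auto
  then have "k \<noteq> 0" using y(2) by auto
  then have "x = (1 / k) *\<^sub>R (k *\<^sub>R x)" by simp
  also have "\<dots> = (- l / k) *\<^sub>R y" using kl(1) by (simp add: eq_neg_iff_add_eq_0[symmetric])
  finally show ?thesis by (rule that)
qed

text \<open>On a complex line the two terms of the Ricci equation are equal.\<close>

lemma flat_codimension_1:
  assumes "CARD('n) = 4"
  shows flat
  unfolding flat_def
proof (intro allI impI)
  fix \<xi> p assume xi: "normal_field \<xi>"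
  have real_parts: "normal_at p (to_clor (Re_clor w))" "normal_at p (to_clor (Im_clor w))" if "normal_at p w" for w
  proof -
    have "w \<in> complexify (V_perp f p)" using that by (simp add: complexify_V_perp)
    then have "Re_clor w \<in> V_perp f p" "Im_clor w \<in> V_perp f p" by (simp_all add: complexify_def)
    moreover have "0 \<in> V_perp f p" by (simp add: lorentz_perp_def)
    ultimately show "normal_at p (to_clor (Re_clor w))" "normal_at p (to_clor (Im_clor w))"
      by (simp_all add: complexify_V_perp[symmetric] complexify_def)
  qed
  have "lorentz (\<xi> p) (\<kappa>b p) *\<^sub>L \<kappa> p = lorentz (\<xi> p) (\<kappa> p) *\<^sub>L \<kappa>b p"
  proof (cases "\<exists>y. y \<noteq> 0 \<and> normal_at p (to_clor y)")
    case True
    then obtain y where y: "y \<noteq> 0" "normal_at p (to_clor y)" by blast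
    have mult: "\<exists>a. w = a *\<^sub>L to_clor y" if w: "normal_at p w" for w
    proof -
      obtain r s where "Re_clor w = r *\<^sub>R y" "Im_clor w = s *\<^sub>R y"
        using normal_rank_1[OF assms real_parts(1)[OF w] y(2,1)] normal_rank_1[OF assms real_parts(2)[OF w] y(2,1)]
        by metis
      then have "w = (of_real r + \<i> * of_real s) *\<^sub>L to_clor y"
        using clor_decomp[of w] by (simp add: to_clor_linear scale_clor_simps)
      then show ?thesis by blast
    qed
    obtain a b where "\<xi> p = a *\<^sub>L to_clor y" "\<kappa> p = b *\<^sub>L to_clor y"
      using mult normal_kappa(1) normal_fieldD(3)[OF xi] by meson
    then show ?thesis by (simp add: lorentz_linear scale_clor_simps mult_ac)
  next
    case False
    then have "Re_clor (\<kappa> p) = 0" "Im_clor (\<kappa> p) = 0" using real_parts[OF normal_kappa(1)] by blast+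
    then have "\<kappa> p = 0" using clor_decomp[of "\<kappa> p"] by (simp add: to_clor_linear scale_clor_simps)
    then show ?thesis by (simp add: scale_clor_simps)
  qed
  then have "2 *\<^sub>L lorentz (\<xi> p) (\<kappa>b p) *\<^sub>L \<kappa> p = 2 *\<^sub>L lorentz (\<xi> p) (\<kappa> p) *\<^sub>L \<kappa>b p" by simp
  then show "D (Db \<xi>) p = Db (D \<xi>) p" using ricci[OF xi, of p] by (simp add: scale_clor_simps)
qed

end

section \<open>Families of immersions\<close>

text \<open>Derivatives of a function of \<open>(t, z)\<close>; on the domain of smoothness they commute.\<close>

definition dt :: "(real \<times> complex \<Rightarrow> 'b::real_normed_vector) \<Rightarrow> real \<times> complex \<Rightarrow> 'b" where
  "dt U x = frechet_derivative U (at x) (1, 0)"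

definition pz :: "(real \<times> complex \<Rightarrow> 'n::finite clor) \<Rightarrow> real \<times> complex \<Rightarrow> 'n clor" where
  "pz U x = (1/2) *\<^sub>L (frechet_derivative U (at x) (0, 1) - \<i> *\<^sub>L frechet_derivative U (at x) (0, \<i>))"

definition pzbar :: "(real \<times> complex \<Rightarrow> 'n::finite clor) \<Rightarrow> real \<times> complex \<Rightarrow> 'n clor" where
  "pzbar U x = (1/2) *\<^sub>L (frechet_derivative U (at x) (0, 1) + \<i> *\<^sub>L frechet_derivative U (at x) (0, \<i>))"

context
  fixes I :: "real set"
  assumes I: "open I"
begin

lemma open_Omega: "open (I \<times> (UNIV :: 'a::topological_space set))"
  by (intro open_Times I open_UNIV)

lemma slice_has_derivative:
  assumes "smooth_on U (I \<times> UNIV)" "t \<in> I"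
  shows "((\<lambda>p. U (t, p)) has_derivative (\<lambda>v. frechet_derivative U (at (t, p)) (0, v))) (at p)"
proof -
  have 1: "((\<lambda>p. (t, p)) has_derivative (\<lambda>v. (0, v))) (at p)" by (auto intro!: derivative_eq_intros)
  have 2: "(U has_derivative frechet_derivative U (at (t, p))) (at (t, p))"
    using smooth_on_has_derivative[OF assms(1) open_Omega] assms(2) by simp
  show ?thesis using diff_chain_at[OF 1 2] by (simp add: o_def)
qed

lemma time_has_vector_derivative:
  assumes "smooth_on U (I \<times> UNIV)" "t \<in> I"
  shows "((\<lambda>s. U (s, p)) has_vector_derivative dt U (t, p)) (at t)"
proof -
  have 1: "((\<lambda>s. (s, p)) has_derivative (\<lambda>k. k *\<^sub>R (1, 0))) (at t)"
    by (auto intro!: derivative_eq_intros)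
  have 2: "(U has_derivative frechet_derivative U (at (t, p))) (at (t, p))"
    using smooth_on_has_derivative[OF assms(1) open_Omega] assms(2) by simp
  show ?thesis using diff_chain_at[OF 1 2] linear_scale[OF has_derivative_linear[OF 2]]
    by (simp add: o_def has_vector_derivative_def dt_def del: scaleR_Pair)
qed

lemma slice_smooth:
  assumes "smooth_on U (I \<times> UNIV)" "t \<in> I"
  shows "smooth_on (\<lambda>p. U (t, p)) UNIV"
proof -
  have "smooth_on (\<lambda>p. U ((0, p) + (t, 0))) UNIV"
    using assms(2) by (intro smooth_on_compose_affine[OF _ open_UNIV open_Omega _ assms(1)]
        bounded_linear_Pair bounded_linear_zero bounded_linear_ident) auto
  then show ?thesis by simp
qed

lemma
  assumes "smooth_on U (I \<times> UNIV)"
  shows smooth_pz: "smooth_on (pz U) (I \<times> UNIV)" and smooth_pzbar: "smooth_on (pzbar U) (I \<times> UNIV)"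
  unfolding pz_def[abs_def] pzbar_def[abs_def]
  by (intro smooth_on_clor(2) smooth_on_const smooth_on_diff smooth_on_add open_Omega
      smooth_on_frechet_derivative assms)+

lemma smooth_dt: "smooth_on U (I \<times> UNIV) \<Longrightarrow> smooth_on (dt U) (I \<times> UNIV)"
  unfolding dt_def[abs_def] by (rule smooth_on_frechet_derivative)

lemma
  assumes "smooth_on U (I \<times> UNIV)" "t \<in> I"
  shows vdz_slice: "vdz (\<lambda>p. U (t, p)) p = pz U (t, p)"
    and vdzbar_slice: "vdzbar (\<lambda>p. U (t, p)) p = pzbar U (t, p)"
  using vdz_eq[OF slice_has_derivative[OF assms]] vdzbar_eq[OF slice_has_derivative[OF assms]]
  by (simp_all add: pz_def pzbar_def)

lemma
  fixes U :: "real \<times> complex \<Rightarrow> 'n::finite clor"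
  assumes "smooth_on U (I \<times> UNIV)" "x \<in> (I \<times> UNIV)"
  shows dt_pz: "dt (pz U) x = pz (dt U) x" and dt_pzbar: "dt (pzbar U) x = pzbar (dt U) x"
proof -
  let ?x = "\<lambda>y. frechet_derivative U (at y) (0, 1)" and ?y = "\<lambda>y. frechet_derivative U (at y) (0, \<i>)"
  note D = smooth_on_has_derivative[OF smooth_on_frechet_derivative[OF assms(1)] open_Omega assms(2)]
  note sc = bounded_linear.has_derivative[OF bounded_bilinear.bounded_linear_right[OF bounded_bilinear_scale_clor]]
  note com = smooth_on_commute_derivatives[OF assms(1) open_Omega assms(2)]
  have A: "(pz U has_derivative (\<lambda>v. (1/2) *\<^sub>L (frechet_derivative ?x (at x) v - \<i> *\<^sub>L frechet_derivative ?y (at x) v))) (at x)"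
    unfolding pz_def[abs_def] by (intro sc has_derivative_diff D)
  have B: "(pzbar U has_derivative (\<lambda>v. (1/2) *\<^sub>L (frechet_derivative ?x (at x) v + \<i> *\<^sub>L frechet_derivative ?y (at x) v))) (at x)"
    unfolding pzbar_def[abs_def] by (intro sc has_derivative_add D)
  show "dt (pz U) x = pz (dt U) x"
    unfolding dt_def[of "pz U"] frechet_derivative_at[OF A, symmetric] com[of _ "(1, 0)"]
    by (simp add: pz_def dt_def[abs_def])
  show "dt (pzbar U) x = pzbar (dt U) x"
    unfolding dt_def[of "pzbar U"] frechet_derivative_at[OF B, symmetric] com[of _ "(1, 0)"]
    by (simp add: pzbar_def dt_def[abs_def])
qed

lemma dt_lorentz:
  fixes U V :: "real \<times> complex \<Rightarrow> 'n::finite clor"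
  assumes "smooth_on U (I \<times> UNIV)" "smooth_on V (I \<times> UNIV)" "x \<in> (I \<times> UNIV)"
  shows "dt (\<lambda>x. lorentz (U x) (V x)) x = lorentz (dt U x) (V x) + lorentz (U x) (dt V x)"
proof -
  note D = smooth_on_has_derivative[OF assms(1) open_Omega assms(3)] smooth_on_has_derivative[OF assms(2) open_Omega assms(3)]
  note l = bounded_bilinear.FDERIV[OF bounded_bilinear_lorentz D]
  show ?thesis unfolding dt_def frechet_derivative_at[OF l, symmetric] by simp
qed

text \<open>This is how the constraints on the lift of every surface in the family restrict its variation.\<close>

lemma dt_lorentz_const:
  fixes U V :: "real \<times> complex \<Rightarrow> 'n::finite clor"
  assumes "smooth_on U (I \<times> UNIV)" "smooth_on V (I \<times> UNIV)" "x \<in> (I \<times> UNIV)" "\<And>y. y \<in> (I \<times> UNIV) \<Longrightarrow> lorentz (U y) (V y) = k"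
  shows "lorentz (dt U x) (V x) + lorentz (U x) (dt V x) = 0"
proof -
  have "((\<lambda>x. lorentz (U x) (V x)) has_derivative (\<lambda>v. 0)) (at x)"
    by (rule has_derivative_transform_within_open[OF has_derivative_const open_Omega assms(3)])
       (simp add: assms(4))
  then have "dt (\<lambda>x. lorentz (U x) (V x)) x = 0"
    unfolding dt_def using frechet_derivative_at by metis
  then show ?thesis using dt_lorentz[OF assms(1-3)] by simp
qed

end

section \<open>Conservation of the Willmore energy along the flow\<close>

text \<open>The normalized lifts of the surfaces as one function of \<open>(t, z)\<close>, given by the explicit formula
  because its smoothness in \<open>t\<close> cannot be read off from the lifts at fixed times.\<close>

definition joint_lift :: "(real \<Rightarrow> complex \<Rightarrow> (real, 'n::finite) vec) \<Rightarrow> real \<times> complex \<Rightarrow> 'n lor" where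
  "joint_lift f x = inverse (sqrt (frechet_derivative (\<lambda>(t, p). f t p) (at x) (0, 1)
      \<bullet> frechet_derivative (\<lambda>(t, p). f t p) (at x) (0, 1))) *\<^sub>R (1, f (fst x) (snd x))"

context
  fixes \<omega>1 \<omega>2 :: complex and I :: "real set" and f :: "real \<Rightarrow> complex \<Rightarrow> (real, 'n::finite) vec"
  assumes lattice: "lattice_basis \<omega>1 \<omega>2"
    and I: "open I"
    and family: "smooth_family \<omega>1 \<omega>2 I f"
begin

definition \<Theta> :: "real \<times> complex \<Rightarrow> 'n clor" where "\<Theta> x = to_clor (joint_lift f x)"

lemma family_immersion: "t \<in> I \<Longrightarrow> conformal_immersion \<omega>1 \<omega>2 (f t)"
  using family by (simp add: smooth_family_def)

lemma immersion_slice: "t \<in> I \<Longrightarrow> immersion \<omega>1 \<omega>2 (f t)"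
  using lattice family_immersion by (simp add: immersion_def immersion_axioms_def torus_def)

lemma family_smooth: "smooth_on (\<lambda>(t, p). f t p) (I \<times> UNIV)"
  using family by (simp add: smooth_family_def)

lemma slice_derivative:
  assumes "t \<in> I"
  shows "frechet_derivative (f t) (at p) v = frechet_derivative (\<lambda>(t, p). f t p) (at (t, p)) (0, v)"
  using frechet_derivative_at[OF slice_has_derivative[OF I family_smooth assms]] by (simp add: fun_eq_iff)

lemma joint_lift_slice: "t \<in> I \<Longrightarrow> joint_lift f (t, p) = normalized_lift (f t) p"
  by (simp add: normalized_lift_eq[OF family_immersion] lift_formula_def joint_lift_def slice_derivative)

lemma smooth_joint_lift: "smooth_on (joint_lift f) (I \<times> UNIV)"
proof -
  have "smooth_on (\<lambda>x. f (fst x) (snd x)) (I \<times> UNIV)" using family_smooth by (simp add: case_prod_unfold)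
  moreover have "frechet_derivative (\<lambda>(t, p). f t p) (at x) (0, 1) \<bullet> frechet_derivative (\<lambda>(t, p). f t p) (at x) (0, 1) > 0"
    if "x \<in> (I \<times> UNIV)" for x
    using that immersion_factor_pos[OF family_immersion, of "fst x" "snd x"] slice_derivative[of "fst x" "snd x" 1]
    by auto
  ultimately show ?thesis unfolding joint_lift_def[abs_def]
    by (intro smooth_on_bilinear[OF bounded_bilinear_scaleR] smooth_on_inverse_sqrt open_Omega[OF I] smooth_on_Pair
        smooth_on_const smooth_on_bilinear[OF bounded_bilinear_inner] smooth_on_frechet_derivative family_smooth)
qed

lemma smooth_Theta: "smooth_on \<Theta> (I \<times> UNIV)"
  unfolding \<Theta>_def[abs_def]
  by (rule smooth_on_bounded_linear[OF bounded_linear_to_clor open_Omega[OF I] smooth_joint_lift])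

lemma Theta_slice: "t \<in> I \<Longrightarrow> clift (f t) = (\<lambda>p. \<Theta> (t, p))"
  by (auto simp: clift_def \<Theta>_def joint_lift_slice)

lemma Theta_z_slice:
  assumes "t \<in> I"
  shows "vdz (clift (f t)) p = pz \<Theta> (t, p)" "vdzbar (clift (f t)) p = pzbar \<Theta> (t, p)"
    "vdz (vdzbar (clift (f t))) p = pz (pzbar \<Theta>) (t, p)"
proof -
  show "vdz (clift (f t)) p = pz \<Theta> (t, p)"
    unfolding Theta_slice[OF assms] by (rule vdz_slice[OF I smooth_Theta assms])
  have b: "vdzbar (clift (f t)) p = pzbar \<Theta> (t, p)" for p
    unfolding Theta_slice[OF assms] by (rule vdzbar_slice[OF I smooth_Theta assms])
  show "vdzbar (clift (f t)) p = pzbar \<Theta> (t, p)" by (rule b)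
  have "vdzbar (clift (f t)) = (\<lambda>p. pzbar \<Theta> (t, p))" using b by blast
  then show "vdz (vdzbar (clift (f t))) p = pz (pzbar \<Theta>) (t, p)"
    using vdz_slice[OF I smooth_pzbar[OF I smooth_Theta] assms] by simp
qed

lemma dt_Theta:
  assumes "t \<in> I"
  shows "dt \<Theta> (t, p) = to_clor (vector_derivative (\<lambda>s. normalized_lift (f s) p) (at t))"
proof -
  have 1: "((\<lambda>s. joint_lift f (s, p)) has_vector_derivative dt (joint_lift f) (t, p)) (at t)"
    by (rule time_has_vector_derivative[OF I smooth_joint_lift assms])
  have "((\<lambda>s. normalized_lift (f s) p) has_vector_derivative dt (joint_lift f) (t, p)) (at t)"
    by (rule has_vector_derivative_transform_within_open[OF 1 I assms]) (rule joint_lift_slice)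
  then have "vector_derivative (\<lambda>s. normalized_lift (f s) p) (at t) = dt (joint_lift f) (t, p)"
    by (rule vector_derivative_at)
  moreover have "((\<lambda>s. \<Theta> (s, p)) has_vector_derivative to_clor (dt (joint_lift f) (t, p))) (at t)"
    unfolding \<Theta>_def by (rule bounded_linear.has_vector_derivative[OF bounded_linear_to_clor 1])
  then have "dt \<Theta> (t, p) = to_clor (dt (joint_lift f) (t, p))"
    by (rule vector_derivative_unique_at[OF time_has_vector_derivative[OF I smooth_Theta assms]])
  ultimately show ?thesis by simp
qed

lemma dt_Theta_periodic:
  assumes "t \<in> I"
  shows "on_torus \<omega>1 \<omega>2 (\<lambda>p. dt \<Theta> (t, p))"
proof -
  have "dt \<Theta> (t, p + w) = dt \<Theta> (t, p)" if w: "w = \<omega>1 \<or> w = \<omega>2" for p w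
  proof -
    have per: "\<Theta> (s, p) = \<Theta> (s, p + w)" if "s \<in> I" for s
      using normalized_lift_periodic[OF family_immersion[OF that]] w
      by (auto simp: \<Theta>_def joint_lift_slice[OF that] on_torus_def)
    have "((\<lambda>s. \<Theta> (s, p + w)) has_vector_derivative dt \<Theta> (t, p)) (at t)"
      by (rule has_vector_derivative_transform_within_open[OF time_has_vector_derivative[OF I smooth_Theta assms] I assms per])
    then show ?thesis
      by (rule vector_derivative_unique_at[OF time_has_vector_derivative[OF I smooth_Theta assms]])
  qed
  then show ?thesis by (simp add: on_torus_def)
qed

text \<open>The variation field satisfies the hypotheses of \<open>first_variation\<close>: the two scalar product
  conditions are the time derivatives of the conformality relations of the lifts, because time and
  space derivatives commute.\<close>

lemma willmore_stationary:
  assumes t: "t \<in> I" and flow: "variation_decomposition f t a b (NV_variation (f t))"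
    and flat: "flat_normal_bundle \<omega>1 \<omega>2 (f t)"
  shows "torus_integral \<omega>1 \<omega>2 (\<lambda>p. lorentz (dt (pz (pzbar \<Theta>)) (t, p)) (pz (pzbar \<Theta>) (t, p))) = 0"
proof -
  interpret immersion \<omega>1 \<omega>2 "f t" by (rule immersion_slice[OF t])
  let ?\<Phi> = "\<lambda>p. dt \<Theta> (t, p)"
  note sT = smooth_Theta and sdT = smooth_dt[OF I smooth_Theta]
  have mem: "(t, p) \<in> (I \<times> UNIV)" for p using t by simp
  have z: "vdz ?\<Phi> p = dt (pz \<Theta>) (t, p)" for p
    by (simp only: vdz_slice[OF I sdT t] dt_pz[OF I sT mem])
  have zb: "vdzbar ?\<Phi> p = dt (pzbar \<Theta>) (t, p)" for p
    by (simp only: vdzbar_slice[OF I sdT t] dt_pzbar[OF I sT mem])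
  have metric: "lorentz (pz \<Theta> y) (pz \<Theta> y) = 0" "lorentz (pz \<Theta> y) (pzbar \<Theta> y) = 1/2" if "y \<in> (I \<times> UNIV)" for y
  proof -
    have y: "fst y \<in> I" using that by auto
    interpret s: immersion \<omega>1 \<omega>2 "f (fst y)" by (rule immersion_slice[OF y])
    show "lorentz (pz \<Theta> y) (pz \<Theta> y) = 0" "lorentz (pz \<Theta> y) (pzbar \<Theta> y) = 1/2"
      using s.conformal_zz[of "snd y"] s.conformal_zzbar[of "snd y"] Theta_z_slice[OF y, of "snd y"] by simp_all
  qed
  have "torus_integral \<omega>1 \<omega>2 (\<lambda>p. lorentz (vdz (vdzbar ?\<Phi>) p) (N p)) = 0"
  proof (rule first_variation)
    show "smooth_on ?\<Phi> UNIV" by (rule slice_smooth[OF I sdT t])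
    show "on_torus \<omega>1 \<omega>2 ?\<Phi>" by (rule dt_Theta_periodic[OF t])
    show "?\<Phi> p = of_real (a p) *\<^sub>L clift (f t) p + b p *\<^sub>L Pz p + cnj (b p) *\<^sub>L Pb p + \<sigma> p" for p
      using flow by (simp add: variation_decomposition_def dt_Theta[OF t] to_clor_NV_variation)
    show "lorentz (vdz ?\<Phi> p) (Pz p) = 0" for p
      using dt_lorentz_const[OF I smooth_pz[OF I sT] smooth_pz[OF I sT] mem metric(1), of p]
      by (simp add: z Theta_z_slice[OF t] lorentz_sym)
    show "lorentz (vdz ?\<Phi> p) (Pb p) + lorentz (Pz p) (vdzbar ?\<Phi> p) = 0" for p
      using dt_lorentz_const[OF I smooth_pz[OF I sT] smooth_pzbar[OF I sT] mem metric(2), of p]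
      by (simp add: z zb Theta_z_slice[OF t])
    show flat using assms(3) by (simp add: flat_iff)
  qed
  moreover have "vdz (vdzbar ?\<Phi>) p = dt (pz (pzbar \<Theta>)) (t, p)" for p
  proof -
    have "vdzbar ?\<Phi> = (\<lambda>p. dt (pzbar \<Theta>) (t, p))" using zb by blast
    then have "vdz (vdzbar ?\<Phi>) p = pz (dt (pzbar \<Theta>)) (t, p)"
      using vdz_slice[OF I smooth_dt[OF I smooth_pzbar[OF I sT]] t] by simp
    then show ?thesis by (simp only: dt_pz[OF I smooth_pzbar[OF I sT] mem])
  qed
  ultimately show ?thesis by (simp only: Theta_z_slice[OF t])
qed

end

theorem willmore_conserved:
  fixes f :: "real \<Rightarrow> complex \<Rightarrow> (real, 'n::finite) vec"
  assumes lattice: "lattice_basis \<omega>1 \<omega>2" and I: "open I" "is_interval I"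
    and flow: "NV_flow \<omega>1 \<omega>2 I f" and flat: "\<And>t. t \<in> I \<Longrightarrow> flat_normal_bundle \<omega>1 \<omega>2 (f t)"
    and st: "s \<in> I" "t \<in> I"
  shows "willmore \<omega>1 \<omega>2 (f s) = willmore \<omega>1 \<omega>2 (f t)"
proof -
  interpret torus \<omega>1 \<omega>2 by unfold_locales (rule lattice)
  have family: "smooth_family \<omega>1 \<omega>2 I f" using flow by (simp add: NV_flow_def)
  let ?N = "pz (pzbar (\<Theta> f))"
  let ?Q = "\<lambda>x. lorentz (?N x) (?N x)"
  have sN: "smooth_on ?N (I \<times> UNIV)"
    by (intro smooth_pz[OF I(1)] smooth_pzbar[OF I(1)] smooth_Theta[OF lattice I(1) family])
  have sQ: "smooth_on ?Q (I \<times> UNIV)"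
    by (intro smooth_on_clor sN open_Omega[OF I(1)])
  have "((\<lambda>s. torus_integral \<omega>1 \<omega>2 (\<lambda>p. ?Q (s, p))) has_vector_derivative 0) (at r)" if r: "r \<in> I" for r
  proof -
    obtain a b where flow_r: "variation_decomposition f r a b (NV_variation (f r))"
      using flow r unfolding NV_flow_def by blast
    have "((\<lambda>s. torus_integral \<omega>1 \<omega>2 (\<lambda>p. ?Q (s, p))) has_vector_derivative
        torus_integral \<omega>1 \<omega>2 (\<lambda>p. dt ?Q (r, p))) (at r)"
    proof (rule torus_integral_has_vector_derivative[OF I(1) r])
      show "((\<lambda>s. ?Q (s, p)) has_vector_derivative dt ?Q (s, p)) (at s)" if "s \<in> I" for s p
        by (rule time_has_vector_derivative[OF I(1) sQ that])
      show "continuous_on (I \<times> UNIV) (\<lambda>(s, p). dt ?Q (s, p))"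
        using smooth_on_continuous_on[OF smooth_dt[OF I(1) sQ]] by simp
      show "continuous_on UNIV (\<lambda>p. ?Q (s, p))" if "s \<in> I" for s
        by (rule smooth_on_continuous_on[OF slice_smooth[OF I(1) sQ that]])
    qed
    also have "(\<lambda>p. dt ?Q (r, p)) = (\<lambda>p. 2 * lorentz (dt ?N (r, p)) (?N (r, p)))"
      using dt_lorentz[OF I(1) sN sN, of "(r, _)"] r by (auto simp: lorentz_sym)
    also have "torus_integral \<omega>1 \<omega>2 \<dots> = 0"
      unfolding torus_integral_cmult
      by (simp only: willmore_stationary[OF lattice I(1) family r flow_r flat[OF r]]) simp
    finally show ?thesis .
  qed
  then have "((\<lambda>s. torus_integral \<omega>1 \<omega>2 (\<lambda>p. ?Q (s, p))) has_vector_derivative 0) (at r within I)"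
    if "r \<in> I" for r
    using that has_vector_derivative_at_within by blast
  then obtain k where k: "\<And>r. r \<in> I \<Longrightarrow> torus_integral \<omega>1 \<omega>2 (\<lambda>p. ?Q (r, p)) = k"
    using has_vector_derivative_zero_constant[of I] is_interval_convex[OF I(2)] by blast
  have "willmore \<omega>1 \<omega>2 (f r) = Re k" if r: "r \<in> I" for r
  proof -
    interpret s: immersion \<omega>1 \<omega>2 "f r" by (rule immersion_slice[OF lattice I(1) family r])
    have "s.q = (\<lambda>p. ?Q (r, p))"
      using Theta_z_slice(3)[OF lattice I(1) family r] by (auto simp: s.q_def)
    then show ?thesis using k[OF r] by (simp add: s.willmore_eq)
  qed
  then show ?thesis using st by simp
qed

theorem mainTheorem5:
  fixes \<omega>1 \<omega>2 :: complex
  assumes "lattice_basis \<omega>1 \<omega>2"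
    and "CARD('n::finite) \<ge> 4"
  shows "(\<forall>f :: complex \<Rightarrow> (real, 'n) vec. conformal_immersion \<omega>1 \<omega>2 f \<longrightarrow>
            (\<exists>!b. solves_dbar \<omega>1 \<omega>2 f (NV_variation f) b \<and> torus_integral \<omega>1 \<omega>2 b = 0))
       \<and> (\<forall>(I :: real set) (f :: real \<Rightarrow> complex \<Rightarrow> (real, 'n) vec).
            open I \<and> is_interval I \<and> NV_flow \<omega>1 \<omega>2 I f \<and>
            (\<forall>t\<in>I. flat_normal_bundle \<omega>1 \<omega>2 (f t)) \<longrightarrow>
            (\<forall>s\<in>I. \<forall>t\<in>I. willmore \<omega>1 \<omega>2 (f s) = willmore \<omega>1 \<omega>2 (f t)))
       \<and> (CARD('n) = 4 \<longrightarrow>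
            (\<forall>f :: complex \<Rightarrow> (real, 'n) vec. conformal_immersion \<omega>1 \<omega>2 f \<longrightarrow> flat_normal_bundle \<omega>1 \<omega>2 f))"
proof -
  have imm: "immersion \<omega>1 \<omega>2 f" if "conformal_immersion \<omega>1 \<omega>2 f" for f :: "complex \<Rightarrow> (real, 'n) vec"
    using assms(1) that by (simp add: immersion_def immersion_axioms_def torus_def)
  have flat: "flat_normal_bundle \<omega>1 \<omega>2 f" if "conformal_immersion \<omega>1 \<omega>2 f" "CARD('n) = 4"
    for f :: "complex \<Rightarrow> (real, 'n) vec"
    using immersion.flat_iff[OF imm[OF that(1)]] immersion.flat_codimension_1[OF imm[OF that(1)] that(2)] by simp
  show ?thesis
    using immersion.NV_dbar_problem[OF imm] willmore_conserved[OF assms(1)] flat by blast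
qed

end
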